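(* Let $\mathcal{R}\subset I\times J$ be a relation with $|I|=n$, $|J|=m$, and let $\phi(x,y)=x^*\Phi y$ be a nondegenerate symmetric bilinear form on $\mathbb{R}^{d+1}$. There is a type $\mathcal{R}$ cone in $\mathbb{R}^{d+1}$, none of whose facet hyperplanes is lightlike, with Gramian $G$ with respect to $\phi$ if and only if the maxbiclique lattice $\mathcal{P}$ of $\mathcal{R}$ is a rank $d+1$ diamond lattice with connected bipartite flag graph, and $G$ is an $n\times n$ real symmetric matrix with all diagonal entries $\pm1$ and the same signature as $\Phi$ satisfying: (1) for every vertex $j\in J$ and the set $\{i_1,\dots,i_s\}$ of all facets incident to it, $\mathrm{rank}\big([G]^{i_1\cdots i_s}_{i_1\cdots i_s}\big)=d$; (2) for every pair of super cycles $F_{i_1},\dots,F_{i_{d+1}}$ and $F_{j_1},\dots,F_{j_{d+1}}$ with the same orientation, $\det\big([G]^{i_1\cdots i_{d+1}}_{j_1\cdots j_{d+1}}\big)\det(\Phi)>0$. Moreover, $G$ parameterizes the realization space of such type $\mathcal{R}$ cones modulo orthogonal transformations of $\phi$ (linear $Q$ with $Q^*\Phi Q=\Phi$).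
   Context: A maxbiclique of $\mathcal{R}$ is an inclusion-maximal pair $(I_0,J_0)$, $I_0\subset I$, $J_0\subset J$, with $I_0\times J_0\subset\mathcal{R}$; the maxbiclique lattice orders these by $(I_0,J_0)\le(I_1,J_1)$ iff $J_0\subset J_1$. Its elements are called faces; the meet irreducibles (corresponding to $I$) are facets $F_i$ and join irreducibles (corresponding to $J$) are vertices; $\wedge$ is the meet, $\top,\bot$ the greatest and least elements. Flags are maximal chains; graded means all flags have the same length (the rank; a singleton has rank $0$). Diamond: graded and every interval $[a,b]$ with $\mathrm{rank}(b)=\mathrm{rank}(a)+2$ has exactly 4 elements. The flag graph has a node per flag and an edge between flags differing in exactly one element. A cycle is a sequence of $d$ facets $F_{i_1},\dots,F_{i_d}$ whose meet is a vertex; a super cycle is a cycle together with one more facet $F_{i_{d+1}}$ such that $\bigwedge_{k=1}^{d+1}F_{i_k}=\bot$. A (super) cycle induces the flag consisting of $\bot$, $\top$ and $\bigwedge_{k=1}^tF_{i_k}$ for $1\le t\le d$; when the flag graph is bipartite, two super cycles have the same orientation if their induced flags lie in the same part. $[G]^{i_1\cdots i_k}_{j_1\cdots j_l}$ is the submatrix with rows $i_1,\dots,i_k$ and columns $j_1,\dots,j_l$. The signature of a symmetric matrix is $(p,q)$, the total dimensions of its positive and negative eigenspaces. A cone is the set of nonnegative combinations of finitely many vectors in $\mathbb{R}^{d+1}$ containing no line; a type $\mathcal{R}$ cone has facets indexed by $I$, extreme rays indexed by $J$, facet $i$ containing ray $j$ iff $(i,j)\in\mathcal{R}$. A hyperplane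 is lightlike if $\phi(x,x)=0$ on it away from the origin. A half-space bounded by a non-lightlike hyperplane through the origin has the form $\{x:\phi(h,x)\le0\}$ for a unique outward normal $h$ with $|\phi(h,h)|=1$. For a cone with no lightlike facet hyperplane, with outward normals $h_i$ of its facet half-spaces, its Gramian is $[G]_{i,k}=\phi(h_i,h_k)$.
   Formalization: Cones in the equivalence and parameterization must also have no lightlike extreme ray, as (1) fails at such rays (e.g. the cone over an ideal hyperbolic triangle); a hyperplane is read as lightlike if it is the φ-orthogonal complement of a nonzero null vector. *)

theory Defs
  imports
    "HOL-Analysis.Analysis"
    "HOL-Algebra.Complete_Lattice"
    "Graph_Theory.Digraph_Component"
    "Jordan_Normal_Form.DL_Rank"
begin

no_notation Matrix.vec_index (infixl \<open>$\<close> 100)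


section \<open>Graded lattices, flags and the flag graph\<close>

definition flags :: "('a, 'b) gorder_scheme \<Rightarrow> 'a set set" where
  "flags L = {F. pred_on.maxchain (carrier L) (le L) F}"

definition graded :: "('a, 'b) gorder_scheme \<Rightarrow> bool" where
  "graded L \<longleftrightarrow> (\<forall>F\<in>flags L. \<forall>F'\<in>flags L. card F = card F')"

text \<open>The length of a flag is the number of its steps, so that a singleton has rank 0. This is
  only meaningful for graded orders.\<close>
definition rank_of :: "('a, 'b) gorder_scheme \<Rightarrow> nat" where
  "rank_of L = card (SOME F. F \<in> flags L) - 1"

definition element_rank :: "('a, 'b) gorder_scheme \<Rightarrow> 'a \<Rightarrow> nat" where
  "element_rank L a = rank_of (L\<lparr>carrier := \<lbrace>\<bottom>\<^bsub>L\<^esub>..a\<rbrace>\<^bsub>L\<^esub>\<rparr>)"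

definition diamond_lattice :: "('a, 'b) gorder_scheme \<Rightarrow> bool" where
  "diamond_lattice L \<longleftrightarrow> lattice L \<and> graded L \<and>
     (\<forall>a\<in>carrier L. \<forall>b\<in>carrier L.
        a \<sqsubseteq>\<^bsub>L\<^esub> b \<and> element_rank L b = element_rank L a + 2 \<longrightarrow> card \<lbrace>a..b\<rbrace>\<^bsub>L\<^esub> = 4)"

text \<open>An undirected graph is represented by a digraph with a symmetric set of arcs.\<close>
definition flag_graph :: "('a, 'b) gorder_scheme \<Rightarrow> 'a set pair_pre_digraph" where
  "flag_graph L = \<lparr>pverts = flags L,
     parcs = {(F, F'). F \<in> flags L \<and> F' \<in> flags L \<and> card (F - F') = 1 \<and> card (F' - F) = 1}\<rparr>"

definition bipartition :: "'a pair_pre_digraph \<Rightarrow> 'a set \<Rightarrow> 'a set \<Rightarrow> bool" where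
  "bipartition \<Gamma> U V \<longleftrightarrow> U \<union> V = pverts \<Gamma> \<and> U \<inter> V = {} \<and> parcs \<Gamma> \<subseteq> U \<times> V \<union> V \<times> U"

definition bipartite :: "'a pair_pre_digraph \<Rightarrow> bool" where
  "bipartite \<Gamma> \<longleftrightarrow> (\<exists>U V. bipartition \<Gamma> U V)"

text \<open>For a connected bipartite graph the two parts are unique up to exchanging them, so this does
  not depend on the choice of the bipartition.\<close>
definition same_part :: "'a pair_pre_digraph \<Rightarrow> 'a \<Rightarrow> 'a \<Rightarrow> bool" where
  "same_part \<Gamma> x y \<longleftrightarrow> (\<exists>U V. bipartition \<Gamma> U V \<and> x \<in> U \<and> y \<in> U)"

definition meet_irreducibles :: "('a, 'b) gorder_scheme \<Rightarrow> 'a set" where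
  "meet_irreducibles L = {a \<in> carrier L. a \<noteq> \<top>\<^bsub>L\<^esub> \<and>
     (\<forall>x\<in>carrier L. \<forall>y\<in>carrier L. a = x \<sqinter>\<^bsub>L\<^esub> y \<longrightarrow> a = x \<or> a = y)}"

definition join_irreducibles :: "('a, 'b) gorder_scheme \<Rightarrow> 'a set" where
  "join_irreducibles L = {a \<in> carrier L. a \<noteq> \<bottom>\<^bsub>L\<^esub> \<and>
     (\<forall>x\<in>carrier L. \<forall>y\<in>carrier L. a = x \<squnion>\<^bsub>L\<^esub> y \<longrightarrow> a = x \<or> a = y)}"


section \<open>The maxbiclique lattice of a relation\<close>

definition maxbicliques :: "('i \<times> 'j) set \<Rightarrow> ('i set \<times> 'j set) set" where
  "maxbicliques R = {(A, B). A \<times> B \<subseteq> R \<and>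
     (\<forall>A' B'. A \<subseteq> A' \<and> B \<subseteq> B' \<and> A' \<times> B' \<subseteq> R \<longrightarrow> A' = A \<and> B' = B)}"

definition maxbiclique_lattice :: "('i \<times> 'j) set \<Rightarrow> ('i set \<times> 'j set) gorder" where
  "maxbiclique_lattice R =
     \<lparr>carrier = maxbicliques R, eq = (=), le = (\<lambda>p q. snd p \<subseteq> snd q)\<rparr>"

text \<open>The greatest face whose first component contains \<^term>\<open>i\<close>, and the least face whose second
  component contains \<^term>\<open>j\<close>.\<close>
definition facet :: "('i \<times> 'j) set \<Rightarrow> 'i \<Rightarrow> 'i set \<times> 'j set" where
  "facet R i = ({i'. \<forall>j. (i, j) \<in> R \<longrightarrow> (i', j) \<in> R}, {j. (i, j) \<in> R})"

definition vertex :: "('i \<times> 'j) set \<Rightarrow> 'j \<Rightarrow> 'i set \<times> 'j set" where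
  "vertex R j = ({i. (i, j) \<in> R}, {j'. \<forall>i. (i, j) \<in> R \<longrightarrow> (i, j') \<in> R})"

text \<open>The convention that the left (right) index set labels the meet (join) irreducibles. It fails,
  for instance, if two rows of the relation coincide.\<close>
definition indexed_by_irreducibles :: "('i \<times> 'j) set \<Rightarrow> bool" where
  "indexed_by_irreducibles R \<longleftrightarrow>
     bij_betw (facet R) UNIV (meet_irreducibles (maxbiclique_lattice R)) \<and>
     bij_betw (vertex R) UNIV (join_irreducibles (maxbiclique_lattice R))"

definition facet_meet :: "('i \<times> 'j) set \<Rightarrow> 'i list \<Rightarrow> 'i set \<times> 'j set" where
  "facet_meet R is = \<Sqinter>\<^bsub>maxbiclique_lattice R\<^esub>(facet R ` set is)"

definition is_cycle :: "('i \<times> 'j) set \<Rightarrow> nat \<Rightarrow> 'i list \<Rightarrow> bool" where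
  "is_cycle R d is \<longleftrightarrow> length is = d \<and> facet_meet R is \<in> range (vertex R)"

definition super_cycle :: "('i \<times> 'j) set \<Rightarrow> nat \<Rightarrow> 'i list \<Rightarrow> bool" where
  "super_cycle R d is \<longleftrightarrow> length is = d + 1 \<and> is_cycle R d (take d is) \<and>
     facet_meet R is = \<bottom>\<^bsub>maxbiclique_lattice R\<^esub>"

text \<open>This set need not be a flag: two opposite side facets of a quadrangular pyramid already meet
  in its apex, so that a cycle starting with them induces a chain that skips the edges. Since the
  parts of the flag graph consist of flags, such super cycles have the same orientation as no
  super cycle.\<close>
definition induced_flag :: "('i \<times> 'j) set \<Rightarrow> nat \<Rightarrow> 'i list \<Rightarrow> ('i set \<times> 'j set) set" where
  "induced_flag R d is =
     {\<bottom>\<^bsub>maxbiclique_lattice R\<^esub>, \<top>\<^bsub>maxbiclique_lattice R\<^esub>} \<union> {facet_meet R (take t is) | t. 1 \<le> t \<and> t \<le> d}"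

definition same_orientation :: "('i \<times> 'j) set \<Rightarrow> nat \<Rightarrow> 'i list \<Rightarrow> 'i list \<Rightarrow> bool" where
  "same_orientation R d is js \<longleftrightarrow>
     same_part (flag_graph (maxbiclique_lattice R)) (induced_flag R d is) (induced_flag R d js)"


section \<open>Matrices\<close>

text \<open>The rows and columns of a submatrix are given by lists, whose order matters for the sign of
  a determinant.\<close>
definition submatrix_of :: "real^'i^'i \<Rightarrow> 'i list \<Rightarrow> 'i list \<Rightarrow> real mat" where
  "submatrix_of G is js = Matrix.mat (length is) (length js) (\<lambda>(a, b). G $ (is ! a) $ (js ! b))"

definition eigenspace :: "real^'n^'n \<Rightarrow> real \<Rightarrow> (real^'n) set" where
  "eigenspace A l = {x. A *v x = l *\<^sub>R x}"

definition signature :: "real^'n^'n \<Rightarrow> nat \<times> nat" where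
  "signature A =
     ((\<Sum>l | l > 0 \<and> eigenspace A l \<noteq> {0}. dim (eigenspace A l)),
      (\<Sum>l | l < 0 \<and> eigenspace A l \<noteq> {0}. dim (eigenspace A l)))"


section \<open>Cones and their Gramians\<close>

definition form :: "real^'n^'n \<Rightarrow> real^'n \<Rightarrow> real^'n \<Rightarrow> real" where
  "form \<Phi> x y = x \<bullet> (\<Phi> *v y)"

definition pointed_cone :: "'a::real_vector set \<Rightarrow> bool" where
  "pointed_cone C \<longleftrightarrow>
     (\<exists>V. finite V \<and> C = {\<Sum>v\<in>V. c v *\<^sub>R v | c. \<forall>v\<in>V. (0::real) \<le> c v}) \<and>
     \<not> (\<exists>a u. u \<noteq> 0 \<and> range (\<lambda>t::real. a + t *\<^sub>R u) \<subseteq> C)"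

text \<open>A cone together with the labelling of its facets by \<^term>\<open>f\<close> and of its extreme rays by
  \<^term>\<open>r\<close>. The interior is required to be nonempty because otherwise facets do not span
  hyperplanes. The edges of a pointed cone are its extreme rays.\<close>
type_synonym ('n, 'i, 'j) labelled_cone =
  "(real^'n) set \<times> ('i \<Rightarrow> (real^'n) set) \<times> ('j \<Rightarrow> (real^'n) set)"

definition type_cone :: "('i \<times> 'j) set \<Rightarrow> ('n::finite, 'i, 'j) labelled_cone \<Rightarrow> bool" where
  "type_cone R = (\<lambda>(C, f, r). pointed_cone C \<and> interior C \<noteq> {} \<and>
     bij_betw f UNIV {F. F facet_of C} \<and>
     bij_betw r UNIV {e. e edge_of C} \<and>
     (\<forall>i j. r j \<subseteq> f i \<longleftrightarrow> (i, j) \<in> R))"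

text \<open>A hyperplane is lightlike if it is tangent to the null cone of the form, i.e. if it is the
  orthogonal complement of a nonzero null vector (which it then contains). These are precisely
  the hyperplanes without a normal that can be scaled to \<^term>\<open>\<bar>form \<Phi> h h\<bar> = 1\<close>.\<close>
definition lightlike_hyperplane :: "real^'n^'n \<Rightarrow> (real^'n) set \<Rightarrow> bool" where
  "lightlike_hyperplane \<Phi> H \<longleftrightarrow> (\<exists>x. x \<noteq> 0 \<and> form \<Phi> x x = 0 \<and> H = {y. form \<Phi> x y = 0})"

definition lightlike_ray :: "real^'n^'n \<Rightarrow> (real^'n) set \<Rightarrow> bool" where
  "lightlike_ray \<Phi> e \<longleftrightarrow> (\<forall>x\<in>e. form \<Phi> x x = 0)"

definition outward_normal :: "real^'n^'n \<Rightarrow> (real^'n) set \<Rightarrow> (real^'n) set \<Rightarrow> real^'n" where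
  "outward_normal \<Phi> C F = (THE h. \<bar>form \<Phi> h h\<bar> = 1 \<and>
     {x. form \<Phi> h x = 0} = span F \<and> C \<subseteq> {x. form \<Phi> h x \<le> 0})"

definition gramian :: "real^'n^'n \<Rightarrow> ('n::finite, 'i::finite, 'j) labelled_cone \<Rightarrow> real^'i^'i" where
  "gramian \<Phi> = (\<lambda>(C, f, r).
     \<chi> i k. form \<Phi> (outward_normal \<Phi> C (f i)) (outward_normal \<Phi> C (f k)))"

definition realizations ::
  "real^'n^'n \<Rightarrow> ('i \<times> 'j) set \<Rightarrow> ('n::finite, 'i, 'j) labelled_cone set" where
  "realizations \<Phi> R =
     {(C, f, r). type_cone R (C, f, r) \<and> (\<forall>i. \<not> lightlike_hyperplane \<Phi> (span (f i)))}"

text \<open>The vertex condition below forces the extreme rays to be non-lightlike as well: if the ray of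
  \<^term>\<open>j\<close> is lightlike, the form degenerates on the span of the normals of the facets containing
  it, and their Gram matrix only has rank \<^term>\<open>d - 1\<close>. An ideal hyperbolic triangle is an
  example.\<close>
definition nonlightlike_realizations ::
  "real^'n^'n \<Rightarrow> ('i \<times> 'j) set \<Rightarrow> ('n::finite, 'i, 'j) labelled_cone set" where
  "nonlightlike_realizations \<Phi> R =
     {(C, f, r) \<in> realizations \<Phi> R. \<forall>j. \<not> lightlike_ray \<Phi> (r j)}"

definition orthogonally_equivalent ::
  "real^'n^'n \<Rightarrow> (('n::finite, 'i, 'j) labelled_cone \<times> ('n, 'i, 'j) labelled_cone) set" where
  "orthogonally_equivalent \<Phi> = {((C, f, r), (C', f', r')).
     \<exists>Q::real^'n^'n. Finite_Cartesian_Product.transpose Q ** \<Phi> ** Q = \<Phi> \<and>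
       C' = (*v) Q ` C \<and> (\<forall>i. f' i = (*v) Q ` f i) \<and> (\<forall>j. r' j = (*v) Q ` r j)}"


section \<open>The conditions on the relation and on the Gramian\<close>

definition combinatorial_condition :: "('i \<times> 'j) set \<Rightarrow> nat \<Rightarrow> bool" where
  "combinatorial_condition R d \<longleftrightarrow>
     indexed_by_irreducibles R \<and>
     diamond_lattice (maxbiclique_lattice R) \<and> rank_of (maxbiclique_lattice R) = d + 1 \<and>
     Digraph_Component.connected (with_proj (flag_graph (maxbiclique_lattice R))) \<and>
     bipartite (flag_graph (maxbiclique_lattice R))"

definition signature_condition :: "real^'n^'n \<Rightarrow> real^'i^'i \<Rightarrow> bool" where
  "signature_condition \<Phi> G \<longleftrightarrow>
     Finite_Cartesian_Product.transpose G = G \<and> (\<forall>i. G $ i $ i = 1 \<or> G $ i $ i = -1) \<and>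
     signature G = signature \<Phi>"

definition vertex_condition :: "('i \<times> 'j) set \<Rightarrow> nat \<Rightarrow> real^'i^'i \<Rightarrow> 'j \<Rightarrow> bool" where
  "vertex_condition R d G j \<longleftrightarrow>
     (\<forall>is. distinct is \<and> set is = {i. (i, j) \<in> R} \<longrightarrow>
        vec_space.rank (length is) (submatrix_of G is is) = d)"

definition orientation_condition :: "real^'n^'n \<Rightarrow> ('i \<times> 'j) set \<Rightarrow> nat \<Rightarrow> real^'i^'i \<Rightarrow> bool" where
  "orientation_condition \<Phi> R d G \<longleftrightarrow>
     (\<forall>is js. super_cycle R d is \<and> super_cycle R d js \<and> same_orientation R d is js \<longrightarrow>
        Determinant.det (submatrix_of G is js) * Determinants.det \<Phi> > 0)"

end

theory Submission
  imports Defs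
begin

text \<open>A cone with facet normals \<open>n i\<close> and ray generators \<open>v j\<close> is a dual pair: the sign pattern of the numbers
  \<open>n i \<bullet> v j \<le> 0\<close> is the relation, and the faces of the cone are the maxbicliques, with dimension as rank. In the
  two-dimensional quotient of a face by a face of codimension 2 there are exactly two boundary rays, which gives
  the diamond property; the determinant of a flag of relative interior points changes sign along every edge of
  the flag graph, which gives bipartiteness and identifies orientations with signs of determinants.

  Conversely, a symmetric matrix with the signature of \<open>\<Phi>\<close> is the Gram matrix of spanning vectors \<open>h i\<close>. The rank
  condition makes the orthogonal complement of the \<open>h i\<close> at a vertex \<open>j\<close> a line, and super cycles
  sharing their cycle put all other \<open>h i\<close> on the same side of it, so that generators \<open>v j\<close> with the right sign
  pattern exist. That they generate the whole cone \<open>{x. \<forall>i. form \<Phi> (h i) x \<le> 0}\<close> follows by induction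
  on the rank from gradedness and the diamond property: a generic path in the boundary of a face only crosses faces
  of codimension at most 2, where the coatoms of the lattice describe the boundary completely. The
  same argument shows that the coatoms of a face are connected through adjacency, hence that the
  flag graph is connected.\<close>

section \<open>Finite orders with an exact rank function\<close>

text \<open>Both directions meet in the locale \<open>dual_pair\<close>, where normals and
  generators describe the same cone. A realization supplies one directly. From a matrix one first
  obtains only a \<open>sign_pattern\<close>, and the obstacle is that no hypothesis says that the
  generators \<open>v j\<close> exhaust the half-space cone. Linear hulls of faces grow strictly
  along the lattice order, so a lattice of rank d+1 in dimension d+1 leaves no freedom: the
  dimension of the hull of a face must be its rank. A path avoiding codimension 3 then meets only
  places where one or two coatoms are active.

  The factor \<open>det \<Phi>\<close> in the orientation condition arises because a Gram submatrix
  is a product of a matrix of normals, \<open>\<Phi>\<close>, and the transpose of another matrix of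
  normals. Multiplying by \<open>det \<Phi>\<close> once more leaves a square, so the condition
  compares the orientations of two lists of normals. Each list is tested against the interior points
  of its induced flag, which makes the sign depend on that flag alone.\<close>

lemma finite_arg_max:
  fixes f :: "'a \<Rightarrow> 'b::linorder"
  assumes "finite A" "A \<noteq> {}"
  shows "\<exists>a\<in>A. \<forall>x\<in>A. f x \<le> f a"
proof -
  have "Max (f ` A) \<in> f ` A" using Max_in[of "f ` A"] assms by simp
  then obtain a where "a \<in> A" "Max (f ` A) = f a" by (rule imageE)
  moreover have "f x \<le> Max (f ` A)" if "x \<in> A" for x
    using that assms by simp
  ultimately show ?thesis by metis
qed

lemma finite_arg_min:
  fixes f :: "'a \<Rightarrow> 'b::linorder"
  assumes "finite A" "A \<noteq> {}"
  shows "\<exists>a\<in>A. \<forall>x\<in>A. f a \<le> f x"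
proof -
  have "Min (f ` A) \<in> f ` A" using Min_in[of "f ` A"] assms by simp
  then obtain a where "a \<in> A" "Min (f ` A) = f a" by (rule imageE)
  moreover have "Min (f ` A) \<le> f x" if "x \<in> A" for x
    using that assms by simp
  ultimately show ?thesis by metis
qed

locale finite_order =
  fixes X :: "'a set" and leq :: "'a \<Rightarrow> 'a \<Rightarrow> bool"
  assumes fin: "finite X"
    and refl: "x \<in> X \<Longrightarrow> leq x x"
    and antisym: "x \<in> X \<Longrightarrow> y \<in> X \<Longrightarrow> leq x y \<Longrightarrow> leq y x \<Longrightarrow> x = y"
    and trans: "x \<in> X \<Longrightarrow> y \<in> X \<Longrightarrow> z \<in> X \<Longrightarrow> leq x y \<Longrightarrow> leq y z \<Longrightarrow> leq x z"

text \<open>Covers raise \<open>r\<close> by exactly one, expressed through gaps instead of covers: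
  a jump by two or more always has an element strictly inside. In this form the property passes to
  intervals and is verified by exhibiting a single intermediate element.\<close>

definition exact_rank :: "'a set \<Rightarrow> ('a \<Rightarrow> 'a \<Rightarrow> bool) \<Rightarrow> ('a \<Rightarrow> nat) \<Rightarrow> bool" where
  "exact_rank X leq r \<longleftrightarrow> (\<forall>a\<in>X. \<forall>b\<in>X. leq a b \<and> a \<noteq> b \<longrightarrow>
     r a < r b \<and> (r a + 1 < r b \<longrightarrow> (\<exists>c\<in>X. leq a c \<and> c \<noteq> a \<and> leq c b \<and> c \<noteq> b)))"

lemma exact_rank_less: "exact_rank X leq r \<Longrightarrow> a \<in> X \<Longrightarrow> b \<in> X \<Longrightarrow> leq a b \<Longrightarrow> a \<noteq> b \<Longrightarrow> r a < r b"
  unfolding exact_rank_def by blast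

lemma exact_rank_between:
  assumes "exact_rank X leq r" "a \<in> X" "b \<in> X" "leq a b" "a \<noteq> b" "r a + 1 < r b"
  obtains c where "c \<in> X" "leq a c" "c \<noteq> a" "leq c b" "c \<noteq> b"
  using assms unfolding exact_rank_def by blast

context finite_order
begin

lemma chain_iff: "pred_on.chain X leq F \<longleftrightarrow> F \<subseteq> X \<and> (\<forall>x\<in>F. \<forall>y\<in>F. leq x y \<or> leq y x)"
  unfolding pred_on.chain_def using refl by (simp; blast)

lemma maxchain_iff:
  "pred_on.maxchain X leq F \<longleftrightarrow> F \<subseteq> X \<and> (\<forall>x\<in>F. \<forall>y\<in>F. leq x y \<or> leq y x) \<and>
     (\<forall>x\<in>X. (\<forall>y\<in>F. leq x y \<or> leq y x) \<longrightarrow> x \<in> F)" (is "?l \<longleftrightarrow> ?r")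
proof
  assume l: ?l
  hence c: "pred_on.chain X leq F" by (simp add: pred_on.maxchain_def)
  have "x \<in> F" if "x \<in> X" "\<forall>y\<in>F. leq x y \<or> leq y x" for x
  proof (rule ccontr)
    assume "x \<notin> F"
    have "pred_on.chain X leq (insert x F)" using c that refl unfolding chain_iff by blast
    with \<open>x \<notin> F\<close> l show False unfolding pred_on.maxchain_def by blast
  qed
  with c show ?r unfolding chain_iff by blast
next
  assume r: ?r
  have "\<not> (pred_on.chain X leq S \<and> F \<subset> S)" for S
    using r unfolding chain_iff by blast
  with r show ?l unfolding pred_on.maxchain_def chain_iff by blast
qed

lemma chain_extend:
  assumes "pred_on.chain X leq C"
  obtains F where "pred_on.maxchain X leq F" "C \<subseteq> F"
proof -
  let ?S = "{F. pred_on.chain X leq F \<and> C \<subseteq> F}"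
  have "finite ?S" by (rule finite_subset[of _ "Pow X"]) (auto simp: chain_iff fin)
  then obtain F where F: "F \<in> ?S" "\<And>F'. F' \<in> ?S \<Longrightarrow> F \<subseteq> F' \<Longrightarrow> F' = F"
    using assms finite_has_maximal[of ?S] by (metis (no_types, lifting) empty_iff mem_Collect_eq subset_refl)
  hence "pred_on.maxchain X leq F" unfolding pred_on.maxchain_def by blast
  with F that show ?thesis by blast
qed

lemma maxchain_exists: "\<exists>F. pred_on.maxchain X leq F"
  by (rule chain_extend[of "{}"]) (auto simp: chain_iff)

text \<open>A flag cannot skip a rank \<open>k\<close>: between its highest element below
  \<open>k\<close> and its lowest element above \<open>k\<close> there is an element comparable with
  the whole flag, which maximality places in the flag.\<close>

lemma maxchain_bij_rank:
  assumes F: "pred_on.maxchain X leq F" and r: "exact_rank X leq r"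
    and z: "z \<in> X" "\<And>x. x \<in> X \<Longrightarrow> leq z x" and t: "t \<in> X" "\<And>x. x \<in> X \<Longrightarrow> leq x t"
  shows "z \<in> F" "t \<in> F" "bij_betw r F {r z..r t}"
proof -
  note FX = F[unfolded maxchain_iff]
  show zF: "z \<in> F" and tF: "t \<in> F" using FX z t by blast+
  have rl: "r x < r y" if "x \<in> F" "y \<in> F" "leq x y" "x \<noteq> y" for x y
    using exact_rank_less[OF r] FX that by blast
  have cmp: "leq x y \<or> leq y x" if "x \<in> F" "y \<in> F" for x y using FX that by blast
  have inj: "inj_on r F"
    by (rule inj_onI) (metis cmp less_irrefl rl)
  have rle: "leq x y" if "x \<in> F" "y \<in> F" "r x \<le> r y" for x y
    using rl[of y x] cmp[OF that(1,2)] that refl[of x] FX by (cases "x = y") auto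
  have rg: "r x \<in> {r z..r t}" if "x \<in> F" for x
  proof -
    have x: "x \<in> X" using FX that by (meson subsetD)
    have "r z \<le> r x" using exact_rank_less[OF r z(1) x z(2)[OF x]] by (cases "z = x") auto
    moreover have "r x \<le> r t" using exact_rank_less[OF r x t(1) t(2)[OF x]] by (cases "x = t") auto
    ultimately show ?thesis by simp
  qed
  have "k \<in> r ` F" if k: "k \<in> {r z..r t}" for k
  proof (rule ccontr)
    assume nk: "k \<notin> r ` F"
    have fF: "finite F" using FX fin finite_subset by blast
    let ?A = "{x\<in>F. r x < k}" and ?B = "{x\<in>F. k < r x}"
    have A: "finite ?A" "?A \<noteq> {}" using fF zF k nk by (auto simp: order_le_less)
    have B: "finite ?B" "?B \<noteq> {}" using fF tF k nk by (auto simp: order_le_less)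
    obtain a where a: "a \<in> ?A" "\<And>x. x \<in> ?A \<Longrightarrow> r x \<le> r a"
      using finite_arg_max[OF A, of r] by blast
    obtain b where b: "b \<in> ?B" "\<And>x. x \<in> ?B \<Longrightarrow> r b \<le> r x"
      using finite_arg_min[OF B, of r] by blast
    have aX: "a \<in> F" "a \<in> X" "r a < k" and bX: "b \<in> F" "b \<in> X" "k < r b" using a b FX by blast+
    have ab: "leq a b" "a \<noteq> b" using rle[OF aX(1) bX(1)] aX(3) bX(3) by auto
    have "r a + 1 < r b" using aX bX by simp
    then obtain c where c: "c \<in> X" "leq a c" "c \<noteq> a" "leq c b" "c \<noteq> b"
      using exact_rank_between[OF r aX(2) bX(2) ab] by blast
    have "leq c y \<or> leq y c" if y: "y \<in> F" for y
    proof (cases "r y < k")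
      case True
      hence "leq y a" using rle[OF y aX(1)] a(2)[of y] y by blast
      thus ?thesis using trans[OF _ aX(2) c(1) _ c(2)] y FX by blast
    next
      case False
      hence "k < r y" using nk y by (metis imageI linorder_neqE_nat)
      hence "leq b y" using rle[OF bX(1) y] b(2)[of y] y by blast
      thus ?thesis using trans[OF c(1) bX(2) _ c(4)] y FX by blast
    qed
    hence cF: "c \<in> F" using FX c(1) by blast
    have "r a < r c" "r c < r b" using rl[OF aX(1) cF c(2)] rl[OF cF bX(1) c(4)] c by auto
    moreover have "r c \<noteq> k" using nk cF by blast
    ultimately show False using a(2)[of c] b(2)[of c] cF by fastforce
  qed
  thus "bij_betw r F {r z..r t}" using inj rg unfolding bij_betw_def by blast
qed

lemma sub_order:
  assumes "Y \<subseteq> X"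
  shows "finite_order Y leq"
proof
  show "finite Y" using assms fin by (rule finite_subset)
  fix x y z
  show "x \<in> Y \<Longrightarrow> leq x x" using assms refl by blast
  show "x \<in> Y \<Longrightarrow> y \<in> Y \<Longrightarrow> leq x y \<Longrightarrow> leq y x \<Longrightarrow> x = y" using assms antisym[of x y] by blast
  show "x \<in> Y \<Longrightarrow> y \<in> Y \<Longrightarrow> z \<in> Y \<Longrightarrow> leq x y \<Longrightarrow> leq y z \<Longrightarrow> leq x z" 
    using trans[OF subsetD[OF assms] subsetD[OF assms] subsetD[OF assms]] .
qed

lemma exact_rank_interval:
  assumes "exact_rank X leq r" "a \<in> X" "b \<in> X"
  shows "exact_rank {x\<in>X. leq a x \<and> leq x b} leq r"
  unfolding exact_rank_def
proof (intro ballI impI)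
  fix x y assume x: "x \<in> {x\<in>X. leq a x \<and> leq x b}" and y: "y \<in> {x\<in>X. leq a x \<and> leq x b}" and xy: "leq x y \<and> x \<noteq> y"
  have "\<exists>c\<in>{x\<in>X. leq a x \<and> leq x b}. leq x c \<and> c \<noteq> x \<and> leq c y \<and> c \<noteq> y" if gap: "r x + 1 < r y"
  proof -
    obtain c where c: "c \<in> X" "leq x c" "c \<noteq> x" "leq c y" "c \<noteq> y"
      using exact_rank_between[OF assms(1), of x y] x y xy gap by auto
    have "leq a c" "leq c b" using x y trans[OF assms(2) _ c(1) _ c(2)] trans[OF c(1) _ assms(3) c(4)] by auto
    thus ?thesis using c by blast
  qed
  thus "r x < r y \<and> (r x + 1 < r y \<longrightarrow> (\<exists>c\<in>{x\<in>X. leq a x \<and> leq x b}. leq x c \<and> c \<noteq> x \<and> leq c y \<and> c \<noteq> y))"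
    using exact_rank_less[OF assms(1)] x y xy by blast
qed

text \<open>Gluing at \<open>a\<close> makes lengths additive, which is how gradedness of the whole
  order controls the flags of a lower interval.\<close>

lemma maxchain_Un:
  assumes "a \<in> X" "pred_on.maxchain {x\<in>X. leq x a} leq F" "pred_on.maxchain {x\<in>X. leq a x} leq F'"
  shows "pred_on.maxchain X leq (F \<union> F')" "F \<inter> F' = {a}"
proof -
  interpret l: finite_order "{x\<in>X. leq x a}" leq by (rule sub_order) blast
  interpret u: finite_order "{x\<in>X. leq a x}" leq by (rule sub_order) blast
  note F = assms(2)[unfolded l.maxchain_iff] and F' = assms(3)[unfolded u.maxchain_iff]
  have aF: "a \<in> F" "a \<in> F'" using F F' assms(1) refl by blast+
  show "F \<inter> F' = {a}" using aF F F' antisym assms(1) by blast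
  have lf: "leq x y" if "x \<in> F" "y \<in> F'" for x y
    using that F F' trans[of x a y] assms(1) by blast
  have "x \<in> F \<union> F'" if x: "x \<in> X" "\<forall>y\<in>F \<union> F'. leq x y \<or> leq y x" for x
    using x aF F F' by blast
  moreover have "leq x y \<or> leq y x" if "x \<in> F \<union> F'" "y \<in> F \<union> F'" for x y
    using that lf[of x y] lf[of y x] F F' by (elim UnE) simp_all
  moreover have "F \<union> F' \<subseteq> X" using F F' by blast
  ultimately show "pred_on.maxchain X leq (F \<union> F')"
    unfolding maxchain_iff by blast
qed

lemma exact_rank_card_maxchain:
  assumes z: "z \<in> X" "\<And>x. x \<in> X \<Longrightarrow> leq z x" and t: "t \<in> X" "\<And>x. x \<in> X \<Longrightarrow> leq x t"
    and graded: "\<And>F. pred_on.maxchain X leq F \<Longrightarrow> card F = N + 1"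
  defines "r \<equiv> \<lambda>a. card (SOME F. pred_on.maxchain {x\<in>X. leq x a} leq F) - 1"
  shows "exact_rank X leq r" "r z = 0" "r t = N"
proof -
  have ex: "\<exists>F. pred_on.maxchain {x\<in>X. leq x a} leq F" "\<exists>F. pred_on.maxchain {x\<in>X. leq a x} leq F" for a
  proof -
    interpret l: finite_order "{x\<in>X. leq x a}" leq by (rule sub_order) blast
    interpret u: finite_order "{x\<in>X. leq a x}" leq by (rule sub_order) blast
    show "\<exists>F. pred_on.maxchain {x\<in>X. leq x a} leq F" by (rule l.maxchain_exists)
    show "\<exists>F. pred_on.maxchain {x\<in>X. leq a x} leq F" by (rule u.maxchain_exists)
  qed
  have r1: "card F = r a + 1" if a: "a \<in> X" and F: "pred_on.maxchain {x\<in>X. leq x a} leq F" for a F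
  proof -
    obtain K where K: "pred_on.maxchain {x\<in>X. leq a x} leq K" using ex by blast
    \<comment> \<open>One upper flag \<open>K\<close> completes every lower flag \<open>F\<close> to
      a flag with \<open>N + 1\<close> elements, and the two share only \<open>a\<close>. So
      \<open>card F\<close> does not depend on \<open>F\<close>, and the choice in \<open>r\<close>
      is harmless.\<close>
    have *: "card F = N + 2 - card K" "card F \<ge> 1" if F: "pred_on.maxchain {x\<in>X. leq x a} leq F" for F
    proof -
      note m = maxchain_Un[OF a F K]
      have f: "finite F" "finite K"
        using F K unfolding pred_on.maxchain_def pred_on.chain_def by (auto intro: finite_subset[OF _ fin])
      show "card F = N + 2 - card K"
        using card_Un_Int[OF f] graded[OF m(1)] m(2) by simp
      have "a \<in> F" using m(2) by blast
      thus "card F \<ge> 1" using f by (metis One_nat_def Suc_leI card_gt_0_iff empty_iff)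
    qed
    show ?thesis using *[OF F] *[OF someI_ex[OF ex(1)]] unfolding r_def by simp
  qed
  \<comment> \<open>A cover extends a flag of the lower interval by one element. Conversely,
    elements whose ranks differ by at least 2 do not form a cover, which fills the gaps.\<close>
  have cov: "r b = r a + 1" if ab: "a \<in> X" "b \<in> X" "leq a b" "a \<noteq> b"
    and nb: "\<And>c. c \<in> X \<Longrightarrow> leq a c \<Longrightarrow> leq c b \<Longrightarrow> c = a \<or> c = b" for a b
  proof -
    interpret l: finite_order "{x\<in>X. leq x a}" leq by (rule sub_order) blast
    interpret b: finite_order "{x\<in>X. leq x b}" leq by (rule sub_order) blast
    obtain F where F: "pred_on.maxchain {x\<in>X. leq x a} leq F" using ex by blast
    note FX = F[unfolded l.maxchain_iff]
    have aF: "a \<in> F" using FX ab refl by blast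
    have "b \<notin> F" using FX ab antisym by blast
    have bF: "leq y b" if "y \<in> F" for y using that FX ab trans[of y a b] by blast
    have "x \<in> insert b F" if x: "x \<in> {x\<in>X. leq x b}" "\<forall>y\<in>insert b F. leq x y \<or> leq y x" for x
    proof (cases "leq x a")
      case True
      thus ?thesis using FX x by blast
    next
      case False
      thus ?thesis using nb[of x] x aF ab by blast
    qed
    moreover have "insert b F \<subseteq> {x\<in>X. leq x b}" using bF FX ab refl by blast
    moreover have "\<forall>x\<in>insert b F. \<forall>y\<in>insert b F. leq x y \<or> leq y x" using FX bF ab refl by blast
    ultimately have "pred_on.maxchain {x\<in>X. leq x b} leq (insert b F)"
      unfolding b.maxchain_iff by blast
    from r1[OF ab(2) this] r1[OF ab(1) F] show ?thesis
      using \<open>b \<notin> F\<close> FX finite_subset[OF _ l.fin] by simp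
  qed
  have "leq a b \<Longrightarrow> a \<noteq> b \<Longrightarrow> r a < r b" if "a \<in> X" "b \<in> X" for a b
    using that
  proof (induction "card {c\<in>X. leq a c \<and> leq c b}" arbitrary: a b rule: less_induct)
    case less
    show ?case
    proof (cases "\<exists>c\<in>X. leq a c \<and> leq c b \<and> c \<noteq> a \<and> c \<noteq> b")
      case True
      then obtain c where c: "c \<in> X" "leq a c" "leq c b" "c \<noteq> a" "c \<noteq> b" by blast
      have "{x\<in>X. leq a x \<and> leq x c} \<subset> {x\<in>X. leq a x \<and> leq x b}"
      proof (rule psubsetI)
        show "{x\<in>X. leq a x \<and> leq x c} \<subseteq> {x\<in>X. leq a x \<and> leq x b}"
          using trans[OF _ c(1) less.prems(4) _ c(3)] by auto
        have "b \<in> {x\<in>X. leq a x \<and> leq x b}" "b \<notin> {x\<in>X. leq a x \<and> leq x c}"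
          using less.prems refl[of b] antisym[of b c] c by auto
        thus "{x\<in>X. leq a x \<and> leq x c} \<noteq> {x\<in>X. leq a x \<and> leq x b}" by metis
      qed
      hence "card {x\<in>X. leq a x \<and> leq x c} < card {x\<in>X. leq a x \<and> leq x b}"
        by (rule psubset_card_mono[rotated]) (simp add: fin)
      hence 1: "r a < r c" using less.hyps less.prems c by blast
      have "{x\<in>X. leq c x \<and> leq x b} \<subset> {x\<in>X. leq a x \<and> leq x b}"
      proof (rule psubsetI)
        show "{x\<in>X. leq c x \<and> leq x b} \<subseteq> {x\<in>X. leq a x \<and> leq x b}"
          using trans[OF less.prems(3) c(1) _ c(2)] by auto
        have "a \<in> {x\<in>X. leq a x \<and> leq x b}" "a \<notin> {x\<in>X. leq c x \<and> leq x b}"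
          using less.prems refl[of a] antisym[of a c] c by auto
        thus "{x\<in>X. leq c x \<and> leq x b} \<noteq> {x\<in>X. leq a x \<and> leq x b}" by metis
      qed
      hence "card {x\<in>X. leq c x \<and> leq x b} < card {x\<in>X. leq a x \<and> leq x b}"
        by (rule psubset_card_mono[rotated]) (simp add: fin)
      hence "r c < r b" using less.hyps less.prems c by blast
      with 1 show ?thesis by simp
    next
      case False
      thus ?thesis using cov[of a b] less.prems by fastforce
    qed
  qed
  moreover have "\<exists>c\<in>X. leq a c \<and> c \<noteq> a \<and> leq c b \<and> c \<noteq> b" if "a \<in> X" "b \<in> X" "leq a b" "a \<noteq> b" "r a + 1 < r b" for a b
    using cov[of a b] that by (metis nat_neq_iff)
  ultimately show "exact_rank X leq r" unfolding exact_rank_def by blast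
  interpret l: finite_order "{x\<in>X. leq x z}" leq by (rule sub_order) blast
  have "pred_on.maxchain {x\<in>X. leq x z} leq {z}" unfolding l.maxchain_iff using z refl antisym by blast
  from r1[OF z(1) this] show "r z = 0" by simp
  have "{x\<in>X. leq x t} = X" using t by blast
  with r1[OF t(1)] ex(1)[of t] graded show "r t = N" by (metis add_right_cancel)
qed

lemma exact_rank_cover_up:
  assumes r: "exact_rank X leq r" and ab: "a \<in> X" "b \<in> X" "leq a b" "a \<noteq> b"
  obtains c where "c \<in> X" "leq a c" "leq c b" "r c = r a + 1"
proof -
  let ?A = "{c\<in>X. leq a c \<and> leq c b \<and> a \<noteq> c}"
  have "finite ?A" "?A \<noteq> {}" using ab fin refl[of b] by auto
  then obtain c where c: "c \<in> ?A" "\<And>x. x \<in> ?A \<Longrightarrow> r c \<le> r x" using finite_arg_min[of ?A r] by blast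
  have lt: "r a < r c" using exact_rank_less[OF r, of a c] c ab by blast
  have "\<not> r a + 1 < r c"
  proof
    assume gap: "r a + 1 < r c"
    obtain x where x: "x \<in> X" "leq a x" "x \<noteq> a" "leq x c" "x \<noteq> c"
      using exact_rank_between[OF r, of a c] c ab gap by auto
    have "leq x b" using trans[OF x(1) _ ab(2) x(4)] c by blast
    hence "r c \<le> r x" using x c(2)[of x] by blast
    moreover have "r x < r c" using exact_rank_less[OF r x(1) _ x(4,5)] c by blast
    ultimately show False by simp
  qed
  with lt c show ?thesis by (intro that[of c]) auto
qed

lemma exact_rank_cover_down:
  assumes r: "exact_rank X leq r" and ab: "a \<in> X" "b \<in> X" "leq a b" "a \<noteq> b"
  obtains c where "c \<in> X" "leq a c" "leq c b" "r c + 1 = r b"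
proof -
  let ?A = "{c\<in>X. leq a c \<and> leq c b \<and> c \<noteq> b}"
  have "finite ?A" "?A \<noteq> {}" using ab fin refl[of a] by auto
  then obtain c where c: "c \<in> ?A" "\<And>x. x \<in> ?A \<Longrightarrow> r x \<le> r c" using finite_arg_max[of ?A r] by blast
  have lt: "r c < r b" using exact_rank_less[OF r, of c b] c ab by blast
  have "\<not> r c + 1 < r b"
  proof
    assume gap: "r c + 1 < r b"
    obtain x where x: "x \<in> X" "leq c x" "x \<noteq> c" "leq x b" "x \<noteq> b"
      using exact_rank_between[OF r, of c b] c ab gap by auto
    have "leq a x" using trans[OF ab(1) _ x(1) _ x(2)] c by blast
    hence "r x \<le> r c" using x c(2)[of x] by blast
    moreover have "r c < r x" using exact_rank_less[OF r _ x(1) x(2)] x(3) c by blast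
    ultimately show False by simp
  qed
  with lt c show ?thesis by (intro that[of c]) auto
qed

lemma exact_rank_inj:
  "exact_rank X leq r \<Longrightarrow> a \<in> X \<Longrightarrow> b \<in> X \<Longrightarrow> leq a b \<Longrightarrow> r a = r b \<Longrightarrow> a = b"
  using exact_rank_less[of X leq r a b] by auto

lemma exact_rank_mono:
  "exact_rank X leq r \<Longrightarrow> a \<in> X \<Longrightarrow> b \<in> X \<Longrightarrow> leq a b \<Longrightarrow> r a \<le> r b"
  using exact_rank_less[of X leq r a b] by (cases "a = b") auto

lemma exact_rank_chain_le:
  "exact_rank X leq r \<Longrightarrow> a \<in> X \<Longrightarrow> b \<in> X \<Longrightarrow> leq a b \<or> leq b a \<Longrightarrow> r a \<le> r b \<Longrightarrow> leq a b"
  using exact_rank_less[of X leq r b a] refl[of a] by (cases "a = b") auto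

end

section \<open>Connectivity of flags through coatoms\<close>

definition coatoms :: "'a set \<Rightarrow> ('a \<Rightarrow> 'a \<Rightarrow> bool) \<Rightarrow> ('a \<Rightarrow> nat) \<Rightarrow> 'a \<Rightarrow> 'a set" where
  "coatoms X leq r b = {c\<in>X. leq c b \<and> r c + 1 = r b}"

text \<open>The unions of connected components of the graph on the coatoms of \<open>b\<close>, two
  of them adjacent when they share a lower bound of rank \<open>r b - 2\<close>. Closed sets replace
  paths: connectivity says that a nonempty closed set is everything.\<close>

definition adjacency_closed :: "'a set \<Rightarrow> ('a \<Rightarrow> 'a \<Rightarrow> bool) \<Rightarrow> ('a \<Rightarrow> nat) \<Rightarrow> 'a \<Rightarrow> 'a set \<Rightarrow> bool" where
  "adjacency_closed X leq r b S \<longleftrightarrow> S \<subseteq> coatoms X leq r b \<and>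
     (\<forall>c\<in>S. \<forall>c'\<in>coatoms X leq r b. \<forall>e\<in>X. leq e c \<and> leq e c' \<and> r e + 2 = r b \<longrightarrow> c' \<in> S)"

locale ranked_order = finite_order +
  fixes r :: "'a \<Rightarrow> nat" and z t :: 'a
  assumes exact: "exact_rank X leq r"
    and z: "z \<in> X" "\<And>x. x \<in> X \<Longrightarrow> leq z x" "r z = 0"
    and t: "t \<in> X" "\<And>x. x \<in> X \<Longrightarrow> leq x t"
begin

abbreviation "flag F \<equiv> pred_on.maxchain X leq F"

lemma flag_bij: "flag F \<Longrightarrow> bij_betw r F {0..r t}"
  using maxchain_bij_rank(3)[OF _ exact z(1,2) t] z(3) by simp

lemma flag_zt: "flag F \<Longrightarrow> z \<in> F" "flag F \<Longrightarrow> t \<in> F"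
  using maxchain_bij_rank(1,2)[OF _ exact z(1,2) t] by blast+

lemma flag_subset: "flag F \<Longrightarrow> F \<subseteq> X"
  unfolding maxchain_iff by blast

lemma flag_chain: "flag F \<Longrightarrow> x \<in> F \<Longrightarrow> y \<in> F \<Longrightarrow> leq x y \<or> leq y x"
  unfolding maxchain_iff by blast

lemma flag_le: "flag F \<Longrightarrow> x \<in> F \<Longrightarrow> y \<in> F \<Longrightarrow> r x \<le> r y \<Longrightarrow> leq x y"
  using exact_rank_chain_le[OF exact, of x y] flag_chain[of F x y] flag_subset[of F] by blast

lemma flag_obtain:
  assumes "flag F" "k \<le> r t"
  obtains x where "x \<in> F" "r x = k"
  using flag_bij[OF assms(1)] assms(2) unfolding bij_betw_def by (metis atLeastAtMost_iff imageE zero_le)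

lemma rank_le_top: "x \<in> X \<Longrightarrow> r x \<le> r t"
  using exact_rank_mono[OF exact _ t(1)] t(2) by blast

lemma flag_if_full:
  assumes "F \<subseteq> X" "\<And>x y. x \<in> F \<Longrightarrow> y \<in> F \<Longrightarrow> leq x y \<or> leq y x" "{0..r t} \<subseteq> r ` F"
  shows "flag F"
proof -
  have "x \<in> F" if x: "x \<in> X" "\<forall>y\<in>F. leq x y \<or> leq y x" for x
  proof -
    have "r x \<in> {0..r t}" using rank_le_top[OF x(1)] by simp
    then obtain y where y: "y \<in> F" "r y = r x" using assms(3) by (metis imageE subsetD)
    have "y \<in> X" using y assms(1) by blast
    hence "x = y" using exact_rank_inj[OF exact x(1), of y] exact_rank_inj[OF exact _ x(1), of y] x(2) y by metis
    with y show ?thesis by simp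
  qed
  with assms show ?thesis unfolding maxchain_iff by blast
qed

lemma flag_swap:
  assumes F: "flag F" "flag F'" and card: "card (F - F') = 1" "card (F' - F) = 1"
  obtains c c' where "F - F' = {c}" "F' - F = {c'}" "r c = r c'" "0 < r c" "r c < r t"
proof -
  obtain c c' where c: "F - F' = {c}" "F' - F = {c'}" using card by (metis card_1_singletonE)
  have inj: "inj_on r F" "inj_on r F'" and im: "r ` F = r ` F'"
    using flag_bij F unfolding bij_betw_def by blast+
  have cF: "c \<in> F" "c' \<in> F'" "c \<notin> F'" "c' \<notin> F" using c by blast+
  obtain x where x: "x \<in> F'" "r x = r c" using im cF(1) by (metis imageE imageI)
  have "x \<notin> F" using inj(1) x cF by (metis inj_onD)
  hence "x = c'" using c x by blast
  moreover have "c \<noteq> z" "c \<noteq> t" using flag_zt F cF by blast+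
  moreover have "r z < r c" "r c < r t"
    using exact_rank_less[OF exact z(1), of c] exact_rank_less[OF exact _ t(1), of c] z t calculation cF
      flag_subset[OF F(1)] by auto
  ultimately show ?thesis using that c x by auto
qed

text \<open>Flags that agree above \<open>b\<close> are linked by induction on the rank of
  \<open>b\<close>. Walking between adjacent coatoms \<open>c\<close> and \<open>c'\<close> of
  \<open>b\<close> means replacing \<open>c\<close> by \<open>c'\<close> in a flag through their
  common lower bound \<open>e\<close>, a single edge of the flag graph.\<close>

lemma flags_connected:
  assumes coatoms: "\<And>b S. b \<in> X \<Longrightarrow> adjacency_closed X leq r b S \<Longrightarrow> S \<noteq> {} \<Longrightarrow> S = coatoms X leq r b"
    and T: "\<And>F. F \<in> T \<Longrightarrow> flag F"
    and closed: "\<And>F F'. F \<in> T \<Longrightarrow> flag F' \<Longrightarrow> card (F - F') = 1 \<Longrightarrow> card (F' - F) = 1 \<Longrightarrow> F' \<in> T"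
    and F: "F \<in> T" "flag F'"
  shows "F' \<in> T"
proof -
  \<comment> \<open>\<open>U\<close> is a flag of the interval above \<open>b\<close>, shared by
    both flags. The claim is the case of the top element; at the bottom element both flags equal
    \<open>U\<close>.\<close>
  have main: "F' \<in> T" if "b \<in> X" "pred_on.maxchain {x\<in>X. leq b x} leq U" "U \<subseteq> F" "U \<subseteq> F'" "F \<in> T" "flag F'" for b U F F'
    using that
  proof (induction "r b" arbitrary: b U F F')
    case 0
    have "b = z" using exact_rank_inj[OF exact z(1) 0(2)] z 0 by simp
    hence "{x\<in>X. leq b x} = X" using z(2) by blast
    hence "flag U" using 0(3) by simp
    hence "F = U" "F' = U" using T[OF 0(6)] 0(4,5,7) unfolding pred_on.maxchain_def by blast+
    thus ?case using 0 by simp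
  next
    case (Suc k)
    note IH = Suc.hyps(1) and k = Suc.hyps(2) and b = Suc.prems(1) and U = Suc.prems(2)
    interpret u: finite_order "{x\<in>X. leq b x}" leq by (rule sub_order) blast
    note UX = U[unfolded u.maxchain_iff]
    have bU: "b \<in> U" using UX b refl by blast
    have Ub: "leq b x" "x \<in> X" if "x \<in> U" for x using that UX by blast+
    have coatom: "c \<in> coatoms X leq r b" if "flag Y" "b \<in> Y" "c \<in> Y" "r c = k" for c Y
      using flag_le[OF that(1,3,2)] that k flag_subset[OF that(1)] unfolding coatoms_def by auto
    have ins: "pred_on.maxchain {x\<in>X. leq c x} leq (insert c U)" if c: "c \<in> coatoms X leq r b" for c
    proof -
      interpret v: finite_order "{x\<in>X. leq c x}" leq by (rule sub_order) blast
      have c': "c \<in> X" "leq c b" "r c = k" using c k unfolding coatoms_def by auto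
      have cU: "leq c x" if "x \<in> U" for x using trans[OF c'(1) b _ c'(2) Ub(1)[OF that]] Ub(2)[OF that] by simp
      have "x \<in> insert c U" if x: "x \<in> X" "leq c x" "\<forall>y\<in>insert c U. leq x y \<or> leq y x" for x
      proof (cases "leq b x")
        case True
        thus ?thesis using UX x by blast
      next
        case False
        hence xb: "leq x b" "x \<noteq> b" using x bU refl[of b] b by blast+
        have "r x < r b" using exact_rank_less[OF exact x(1) b xb] .
        moreover have "r c \<le> r x" using exact_rank_mono[OF exact c'(1) x(1,2)] .
        ultimately have "r c = r x" using c' k by simp
        thus ?thesis using exact_rank_inj[OF exact c'(1) x(1,2)] by simp
      qed
      moreover have "insert c U \<subseteq> {x\<in>X. leq c x}" using cU Ub c' refl by auto
      moreover have "\<forall>x\<in>insert c U. \<forall>y\<in>insert c U. leq x y \<or> leq y x" using cU UX c' refl by blast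
      ultimately show ?thesis unfolding v.maxchain_iff by blast
    qed
    \<comment> \<open>The coatoms of \<open>b\<close> already reached: some flag in \<open>T\<close>
      contains \<open>c\<close> together with the common upper part \<open>U\<close>.\<close>
    define S where "S = {c \<in> coatoms X leq r b. \<exists>F\<in>T. insert c U \<subseteq> F}"
    have "k \<le> r t" using rank_le_top[OF b] k by simp
    have "c' \<in> S" if c: "c \<in> S" and c': "c' \<in> coatoms X leq r b"
      and e: "e \<in> X" "leq e c" "leq e c'" "r e + 2 = r b" for c c' e
    proof (cases "c = c'")
      case False
      obtain F1 where F1: "F1 \<in> T" "insert c U \<subseteq> F1" using c S_def by blast
      have cc: "c \<in> coatoms X leq r b" using c S_def by blast
      have cX: "c \<in> X" "leq c b" "r c = k" "c' \<in> X" "leq c' b" "r c' = k"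
        using cc c' k unfolding coatoms_def by auto
      have cU: "leq c x" if "x \<in> U" for x using trans[OF cX(1) b _ cX(2) Ub(1)[OF that]] Ub(2)[OF that] by simp
      have eU: "leq e x" if "x \<in> U" for x using trans[OF e(1) cX(1) _ e(2) cU[OF that]] Ub(2)[OF that] by simp
      have "x \<in> insert e (insert c U) \<Longrightarrow> y \<in> insert e (insert c U) \<Longrightarrow> leq x y \<or> leq y x" for x y
        using cU eU UX e refl[OF e(1)] refl[OF cX(1)] by (elim insertE) auto
      moreover have "insert e (insert c U) \<subseteq> X" using e cX Ub by auto
      ultimately have "pred_on.chain X leq (insert e (insert c U))"
        unfolding chain_iff by blast
      then obtain Y where Y: "flag Y" "insert e (insert c U) \<subseteq> Y" by (rule chain_extend)
      \<comment> \<open>\<open>Y\<close> and \<open>F1\<close> agree above \<open>c\<close>, which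
        has smaller rank than \<open>b\<close>, so the induction hypothesis carries membership in
        \<open>T\<close> from \<open>F1\<close> to \<open>Y\<close>.\<close>
      have YT: "Y \<in> T" using IH[of c "insert c U" F1 Y] cX ins[OF cc] F1 Y by auto
      let ?Y = "insert c' (Y - {c})"
      have cmp: "leq c' y \<or> leq y c'" if y: "y \<in> Y" "y \<noteq> c" for y
      proof -
        have yX: "y \<in> X" using y flag_subset[OF Y(1)] by blast
        have "r y \<noteq> k" using flag_bij[OF Y(1)] y Y(2) cX(3) unfolding bij_betw_def by (metis inj_onD insert_subset)
        then consider "r y \<le> r e" | "r b \<le> r y" using e(4) k by linarith
        thus ?thesis
        proof cases
          case 1
          hence "leq y e" using flag_le[OF Y(1) y(1)] Y(2) by blast
          thus ?thesis using trans[OF yX e(1) cX(4) _ e(3)] by blast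
        next
          case 2
          hence "leq b y" using flag_le[OF Y(1) _ y(1)] Y(2) bU by blast
          thus ?thesis using trans[OF cX(4) b yX cX(5)] by blast
        qed
      qed
      have c'Y: "c' \<notin> Y"
        using flag_bij[OF Y(1)] Y(2) cX(3,6) False unfolding bij_betw_def by (metis inj_onD insert_subset)
      have "r ` ?Y = r ` Y" using Y(2) cX(3,6) by (auto simp: image_iff)
      hence "flag ?Y"
        using flag_bij[OF Y(1)] cmp flag_chain[OF Y(1)] flag_subset[OF Y(1)] cX refl[OF cX(4)]
        by (intro flag_if_full) (auto simp: bij_betw_def)
      moreover have "Y - ?Y = {c}" "?Y - Y = {c'}" using Y(2) c'Y False by auto
      ultimately have "?Y \<in> T" using closed[OF YT, of ?Y] by simp
      moreover have "insert c' U \<subseteq> ?Y"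
        using Y(2) Ub[of c] exact_rank_mono[OF exact b cX(1)] cX k by fastforce
      ultimately show ?thesis using c' unfolding S_def by auto
    qed (use c in simp)
    hence "adjacency_closed X leq r b S" unfolding adjacency_closed_def S_def by blast
    moreover obtain c where c: "c \<in> F" "r c = k" using flag_obtain[OF T[OF Suc.prems(5)] \<open>k \<le> r t\<close>] .
    hence "c \<in> S" using coatom[OF T[OF Suc.prems(5)] _ c] Suc.prems(3,5) bU unfolding S_def by blast
    ultimately have S: "S = coatoms X leq r b" using coatoms[OF b] by blast
    obtain c' where c': "c' \<in> F'" "r c' = k" using flag_obtain[OF Suc.prems(6) \<open>k \<le> r t\<close>] .
    hence c'S: "c' \<in> coatoms X leq r b" using coatom[OF Suc.prems(6)] Suc.prems(4) bU by blast
    then obtain F2 where F2: "F2 \<in> T" "insert c' U \<subseteq> F2" using S S_def by blast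
    show ?case
      using IH[of c' "insert c' U" F2 F'] c' c'S ins[OF c'S] F2 Suc.prems(4,6) unfolding coatoms_def by auto
  qed
  interpret u: finite_order "{x\<in>X. leq t x}" leq by (rule sub_order) blast
  have "{x\<in>X. leq t x} = {t}" using t antisym[OF _ t(1)] refl[OF t(1)] by auto
  hence "pred_on.maxchain {x\<in>X. leq t x} leq {t}" unfolding u.maxchain_iff using refl[OF t(1)] by auto
  from main[OF t(1) this _ _ F] flag_zt(2)[OF T[OF F(1)]] flag_zt(2)[OF F(2)] show ?thesis by simp
qed

end

section \<open>The lattice of maximal bicliques\<close>

text \<open>The closures of the Galois connection of \<open>R\<close>: \<open>row_face R A\<close>
  is the meet of the facets in \<open>A\<close>, and \<open>column_face R B\<close> the join of the
  vertices in \<open>B\<close>. All rows give the least face, no rows the greatest.\<close>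

definition row_face :: "('i \<times> 'j) set \<Rightarrow> 'i set \<Rightarrow> 'i set \<times> 'j set" where
  "row_face R A = ({i. \<forall>j. (\<forall>i'\<in>A. (i', j) \<in> R) \<longrightarrow> (i, j) \<in> R}, {j. \<forall>i\<in>A. (i, j) \<in> R})"

definition column_face :: "('i \<times> 'j) set \<Rightarrow> 'j set \<Rightarrow> 'i set \<times> 'j set" where
  "column_face R B = ({i. \<forall>j\<in>B. (i, j) \<in> R}, {j. \<forall>i. (\<forall>j'\<in>B. (i, j') \<in> R) \<longrightarrow> (i, j) \<in> R})"

abbreviation below :: "'i set \<times> 'j set \<Rightarrow> 'i set \<times> 'j set \<Rightarrow> bool" where
  "below p q \<equiv> snd p \<subseteq> snd q"

abbreviation faces_between :: "('i \<times> 'j) set \<Rightarrow> 'i set \<times> 'j set \<Rightarrow> 'i set \<times> 'j set \<Rightarrow> ('i set \<times> 'j set) set" where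
  "faces_between R a b \<equiv> {c\<in>maxbicliques R. below a c \<and> below c b}"

lemma maxbicliques_iff:
  "p \<in> maxbicliques R \<longleftrightarrow> fst p = {i. \<forall>j\<in>snd p. (i, j) \<in> R} \<and> snd p = {j. \<forall>i\<in>fst p. (i, j) \<in> R}"
proof (cases p)
  case (Pair A B)
  have "(A, B) \<in> maxbicliques R \<longleftrightarrow> A = {i. \<forall>j\<in>B. (i, j) \<in> R} \<and> B = {j. \<forall>i\<in>A. (i, j) \<in> R}"
  proof
    assume "(A, B) \<in> maxbicliques R"
    hence AB: "A \<times> B \<subseteq> R" "\<And>A' B'. A \<subseteq> A' \<Longrightarrow> B \<subseteq> B' \<Longrightarrow> A' \<times> B' \<subseteq> R \<Longrightarrow> A' = A \<and> B' = B"
      unfolding maxbicliques_def by blast+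
    from AB(1) AB(2)[of "{i. \<forall>j\<in>B. (i, j) \<in> R}" B] AB(2)[of A "{j. \<forall>i\<in>A. (i, j) \<in> R}"]
    show "A = {i. \<forall>j\<in>B. (i, j) \<in> R} \<and> B = {j. \<forall>i\<in>A. (i, j) \<in> R}" by blast
  next
    assume "A = {i. \<forall>j\<in>B. (i, j) \<in> R} \<and> B = {j. \<forall>i\<in>A. (i, j) \<in> R}"
    hence A: "A = {i. \<forall>j\<in>B. (i, j) \<in> R}" and B: "B = {j. \<forall>i\<in>A. (i, j) \<in> R}" by blast+
    have "A' = A \<and> B' = B" if "A \<subseteq> A'" "B \<subseteq> B'" "A' \<times> B' \<subseteq> R" for A' B'
    proof
      have "i \<in> A" if "i \<in> A'" for i by (subst A) (use \<open>A' \<times> B' \<subseteq> R\<close> \<open>B \<subseteq> B'\<close> that in blast)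
      with that(1) show "A' = A" by blast
      have "j \<in> B" if "j \<in> B'" for j by (subst B) (use \<open>A' \<times> B' \<subseteq> R\<close> \<open>A \<subseteq> A'\<close> that in blast)
      with that(2) show "B' = B" by blast
    qed
    moreover have "A \<times> B \<subseteq> R" using A by blast
    ultimately show "(A, B) \<in> maxbicliques R" unfolding maxbicliques_def by blast
  qed
  with Pair show ?thesis by simp
qed

lemma row_face_in: "row_face R A \<in> maxbicliques R"
  unfolding maxbicliques_iff row_face_def by auto

lemma column_face_in: "column_face R B \<in> maxbicliques R"
  unfolding maxbicliques_iff column_face_def by auto

lemma facet_eq: "facet R i = row_face R {i}" and vertex_eq: "vertex R j = column_face R {j}"
  unfolding facet_def row_face_def vertex_def column_face_def by auto

lemma face_fst:
  assumes "p \<in> maxbicliques R"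
  shows "i \<in> fst p \<longleftrightarrow> (\<forall>j\<in>snd p. (i, j) \<in> R)"
  using assms[unfolded maxbicliques_iff, THEN conjunct1] by simp

lemma face_snd:
  assumes "p \<in> maxbicliques R"
  shows "j \<in> snd p \<longleftrightarrow> (\<forall>i\<in>fst p. (i, j) \<in> R)"
  using assms[unfolded maxbicliques_iff, THEN conjunct2] by simp

lemma face_eqI:
  assumes "p \<in> maxbicliques R" "q \<in> maxbicliques R" "snd p = snd q"
  shows "p = q"
proof (rule prod_eqI[OF _ assms(3)])
  show "fst p = fst q" using face_fst[OF assms(1)] face_fst[OF assms(2)] assms(3) by blast
qed

lemma face_eqI_fst:
  assumes "p \<in> maxbicliques R" "q \<in> maxbicliques R" "fst p = fst q"
  shows "p = q"
proof (rule prod_eqI[OF assms(3)])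
  show "snd p = snd q" using face_snd[OF assms(1)] face_snd[OF assms(2)] assms(3) by blast
qed

lemma below_fst:
  assumes "p \<in> maxbicliques R" "q \<in> maxbicliques R"
  shows "below p q \<longleftrightarrow> fst q \<subseteq> fst p"
proof
  show "below p q \<Longrightarrow> fst q \<subseteq> fst p"
    using face_fst[OF assms(1)] face_fst[OF assms(2)] by blast
  show "fst q \<subseteq> fst p \<Longrightarrow> below p q"
    using face_snd[OF assms(1)] face_snd[OF assms(2)] by blast
qed

lemma below_row_face:
  assumes "p \<in> maxbicliques R"
  shows "below p (row_face R A) \<longleftrightarrow> A \<subseteq> fst p"
  by (auto simp: row_face_def subset_iff face_fst[OF assms])

lemma below_column_face:
  assumes "p \<in> maxbicliques R"
  shows "below (column_face R B) p \<longleftrightarrow> B \<subseteq> snd p"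
  by (auto simp: column_face_def subset_iff face_snd[OF assms])

lemma below_facet: "p \<in> maxbicliques R \<Longrightarrow> below p (facet R i) \<longleftrightarrow> i \<in> fst p"
  by (simp add: below_row_face facet_eq)

lemma facet_in: "facet R i \<in> maxbicliques R" and vertex_in: "vertex R j \<in> maxbicliques R"
  by (simp_all add: facet_eq vertex_eq row_face_in column_face_in)

abbreviation face_bot :: "('i \<times> 'j) set \<Rightarrow> 'i set \<times> 'j set" where "face_bot R \<equiv> row_face R UNIV"
abbreviation face_top :: "('i \<times> 'j) set \<Rightarrow> 'i set \<times> 'j set" where "face_top R \<equiv> row_face R {}"

lemma face_bot_below: "p \<in> maxbicliques R \<Longrightarrow> below (face_bot R) p"
  by (auto simp: row_face_def face_snd)

lemma snd_face_top [simp]: "snd (face_top R) = UNIV" and fst_face_bot [simp]: "fst (face_bot R) = UNIV"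
  by (auto simp: row_face_def)

lemma below_antisym: "p \<in> maxbicliques R \<Longrightarrow> q \<in> maxbicliques R \<Longrightarrow> below p q \<Longrightarrow> below q p \<Longrightarrow> p = q"
  by (rule face_eqI) auto

interpretation faces: finite_order "maxbicliques R" below for R :: "('i::finite \<times> 'j::finite) set"
  by unfold_locales (simp, simp, rule below_antisym, assumption+, rule subset_trans, assumption+)

lemma least_iff: "least (maxbiclique_lattice R) l A \<longleftrightarrow> A \<subseteq> maxbicliques R \<and> l \<in> A \<and> (\<forall>x\<in>A. below l x)"
  unfolding least_def maxbiclique_lattice_def by auto

lemma greatest_iff: "greatest (maxbiclique_lattice R) l A \<longleftrightarrow> A \<subseteq> maxbicliques R \<and> l \<in> A \<and> (\<forall>x\<in>A. below x l)"
  unfolding greatest_def maxbiclique_lattice_def by auto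

lemma lattice_carrier [simp]: "carrier (maxbiclique_lattice R) = maxbicliques R"
  and lattice_le [simp]: "le (maxbiclique_lattice R) = below"
  and lattice_eq [simp]: "eq (maxbiclique_lattice R) = (=)"
  unfolding maxbiclique_lattice_def by auto

lemma some_least: "least (maxbiclique_lattice R) l A \<Longrightarrow> (SOME x. least (maxbiclique_lattice R) x A) = l"
  by (rule some_equality) (auto simp: least_iff intro!: below_antisym)

lemma some_greatest: "greatest (maxbiclique_lattice R) l A \<Longrightarrow> (SOME x. greatest (maxbiclique_lattice R) x A) = l"
  by (rule some_equality) (auto simp: greatest_iff intro!: below_antisym)

lemma lattice_bot [simp]: "\<bottom>\<^bsub>maxbiclique_lattice R\<^esub> = face_bot R"
  unfolding bottom_def by (rule some_least) (auto simp: least_iff row_face_in face_bot_below)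

lemma lattice_top [simp]: "\<top>\<^bsub>maxbiclique_lattice R\<^esub> = face_top R"
  unfolding top_def by (rule some_greatest) (simp add: greatest_iff row_face_in)

lemma greatest_row_face:
  assumes "P \<subseteq> maxbicliques R"
  shows "greatest (maxbiclique_lattice R) (row_face R (\<Union>(fst ` P))) (Lower (maxbiclique_lattice R) P)"
proof -
  have "x \<in> Lower (maxbiclique_lattice R) P \<longleftrightarrow> x \<in> maxbicliques R \<and> below x (row_face R (\<Union>(fst ` P)))" for x
  proof -
    have "x \<in> Lower (maxbiclique_lattice R) P \<longleftrightarrow> x \<in> maxbicliques R \<and> (\<forall>p\<in>P. below x p)"
      using assms unfolding Lower_def by (simp del: split_paired_All) blast
    also have "\<dots> \<longleftrightarrow> x \<in> maxbicliques R \<and> (\<forall>p\<in>P. fst p \<subseteq> fst x)"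
      using below_fst assms by blast
    also have "\<dots> \<longleftrightarrow> x \<in> maxbicliques R \<and> below x (row_face R (\<Union>(fst ` P)))"
      using below_row_face[of x R "\<Union>(fst ` P)"] by blast
    finally show ?thesis .
  qed
  thus ?thesis unfolding greatest_iff using row_face_in by blast
qed

lemma least_column_face:
  assumes "P \<subseteq> maxbicliques R"
  shows "least (maxbiclique_lattice R) (column_face R (\<Union>(snd ` P))) (Upper (maxbiclique_lattice R) P)"
proof -
  have "x \<in> Upper (maxbiclique_lattice R) P \<longleftrightarrow> x \<in> maxbicliques R \<and> below (column_face R (\<Union>(snd ` P))) x" for x
  proof -
    have "x \<in> Upper (maxbiclique_lattice R) P \<longleftrightarrow> x \<in> maxbicliques R \<and> (\<forall>p\<in>P. below p x)"
      using assms unfolding Upper_def by (simp del: split_paired_All) blast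
    also have "\<dots> \<longleftrightarrow> x \<in> maxbicliques R \<and> below (column_face R (\<Union>(snd ` P))) x"
      using below_column_face[of x R "\<Union>(snd ` P)"] by blast
    finally show ?thesis .
  qed
  thus ?thesis unfolding least_iff using column_face_in by blast
qed

lemma lattice_Inf: "P \<subseteq> maxbicliques R \<Longrightarrow> \<Sqinter>\<^bsub>maxbiclique_lattice R\<^esub>P = row_face R (\<Union>(fst ` P))"
  unfolding Lattice.inf_def by (rule some_greatest[OF greatest_row_face])

lemma lattice_Sup: "P \<subseteq> maxbicliques R \<Longrightarrow> \<Squnion>\<^bsub>maxbiclique_lattice R\<^esub>P = column_face R (\<Union>(snd ` P))"
  unfolding Lattice.sup_def by (rule some_least[OF least_column_face])

lemma lattice_meet: "p \<in> maxbicliques R \<Longrightarrow> q \<in> maxbicliques R \<Longrightarrow>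
    p \<sqinter>\<^bsub>maxbiclique_lattice R\<^esub> q = row_face R (fst p \<union> fst q)"
  unfolding meet_def by (simp add: lattice_Inf)

lemma lattice_join: "p \<in> maxbicliques R \<Longrightarrow> q \<in> maxbicliques R \<Longrightarrow>
    p \<squnion>\<^bsub>maxbiclique_lattice R\<^esub> q = column_face R (snd p \<union> snd q)"
  unfolding join_def by (simp add: lattice_Sup)

lemma facet_meet_eq: "facet_meet R is = row_face R (set is)"
proof -
  have "facet_meet R is = row_face R (\<Union>(fst ` facet R ` set is))"
    unfolding facet_meet_def by (rule lattice_Inf) (auto simp: facet_in)
  also have "\<dots> = row_face R (set is)"
    by (rule face_eqI[OF row_face_in row_face_in]) (auto simp: row_face_def facet_def)
  finally show ?thesis .
qed

lemma lattice_maxbiclique_lattice: "lattice (maxbiclique_lattice R)"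
proof -
  interpret partial_order "maxbiclique_lattice R"
    by unfold_locales ((simp; fail) | (simp, rule below_antisym, assumption+) | (simp, rule subset_trans, assumption+))+
  show ?thesis
  proof
    fix x y assume xy: "x \<in> carrier (maxbiclique_lattice R)" "y \<in> carrier (maxbiclique_lattice R)"
    show "\<exists>s. least (maxbiclique_lattice R) s (Upper (maxbiclique_lattice R) {x, y})"
      by (rule exI, rule least_column_face) (use xy in simp)
    show "\<exists>s. greatest (maxbiclique_lattice R) s (Lower (maxbiclique_lattice R) {x, y})"
      by (rule exI, rule greatest_row_face) (use xy in simp)
  qed
qed

lemma flags_iff: "F \<in> flags (maxbiclique_lattice R) \<longleftrightarrow> pred_on.maxchain (maxbicliques R) below F"
  unfolding flags_def maxbiclique_lattice_def by simp

section \<open>Ranks of faces, the diamond property and irreducible elements\<close>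

definition diamond_rank :: "('i \<times> 'j) set \<Rightarrow> ('i set \<times> 'j set \<Rightarrow> nat) \<Rightarrow> bool" where
  "diamond_rank R r \<longleftrightarrow> (\<forall>a\<in>maxbicliques R. \<forall>b\<in>maxbicliques R.
     below a b \<and> r b = r a + 2 \<longrightarrow> card (faces_between R a b) = 4)"

lemma interval_eq:
  "a \<in> maxbicliques R \<Longrightarrow> \<lbrace>a..b\<rbrace>\<^bsub>maxbiclique_lattice R\<^esub> = faces_between R a b"
  unfolding at_least_at_most_def by simp

locale ranked_faces = ranked_order "maxbicliques R" below r "face_bot R" "face_top R"
  for R :: "('i::finite \<times> 'j::finite) set" and r
begin

lemma rank_of_lattice: "rank_of (maxbiclique_lattice R) = r (face_top R)"
  and graded_lattice: "graded (maxbiclique_lattice R)"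
proof -
  have c: "card F = r (face_top R) + 1" if "F \<in> flags (maxbiclique_lattice R)" for F
    using bij_betw_same_card[OF flag_bij] that unfolding flags_iff by simp
  thus "graded (maxbiclique_lattice R)" unfolding graded_def by simp
  have "\<exists>F. F \<in> flags (maxbiclique_lattice R)" unfolding flags_iff using maxchain_exists .
  from someI_ex[OF this] c show "rank_of (maxbiclique_lattice R) = r (face_top R)"
    unfolding rank_of_def by simp
qed

lemma element_rank_eq:
  assumes a: "a \<in> maxbicliques R"
  shows "element_rank (maxbiclique_lattice R) a = r a"
proof -
  let ?X = "{x\<in>maxbicliques R. below (face_bot R) x \<and> below x a}"
  let ?L = "maxbiclique_lattice R\<lparr>carrier := \<lbrace>\<bottom>\<^bsub>maxbiclique_lattice R\<^esub>..a\<rbrace>\<^bsub>maxbiclique_lattice R\<^esub>\<rparr>"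
  interpret l: finite_order ?X below by (rule sub_order) blast
  interpret l: ranked_order ?X below r "face_bot R" a
    by unfold_locales (use exact_rank_interval[OF exact z(1) a] z a face_bot_below in auto)
  have fl: "flags ?L = {F. pred_on.maxchain ?X below F}"
    unfolding flags_def by (simp add: interval_eq row_face_in)
  have "\<exists>F. F \<in> flags ?L" using l.maxchain_exists unfolding fl by blast
  from someI_ex[OF this] have "card (SOME F. F \<in> flags ?L) = r a + 1"
    using bij_betw_same_card[OF l.flag_bij] unfolding fl by simp
  thus ?thesis unfolding element_rank_def rank_of_def by simp
qed

lemma diamond_lattice_iff: "diamond_lattice (maxbiclique_lattice R) \<longleftrightarrow> diamond_rank R r"
  unfolding diamond_lattice_def diamond_rank_def
  using lattice_maxbiclique_lattice graded_lattice by (auto simp: element_rank_eq interval_eq)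

end

lemma ranked_faces_element_rank:
  fixes R :: "('i::finite \<times> 'j::finite) set"
  assumes "graded (maxbiclique_lattice R)" "rank_of (maxbiclique_lattice R) = N" "0 < N"
  shows "ranked_faces R (element_rank (maxbiclique_lattice R))"
    "element_rank (maxbiclique_lattice R) (face_top R) = N"
proof -
  define r where "r = (\<lambda>a. card (SOME F. pred_on.maxchain {x\<in>maxbicliques R. below x a} below F) - 1)"
  have er: "element_rank (maxbiclique_lattice R) a = r a" for a
  proof -
    have "faces_between R (face_bot R) a = {x\<in>maxbicliques R. below x a}"
      using face_bot_below by blast
    thus ?thesis unfolding element_rank_def rank_of_def r_def flags_def
      by (simp add: interval_eq row_face_in)
  qed
  have c: "card F = N + 1" if "pred_on.maxchain (maxbicliques R) below F" for F
  proof -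
    have "F \<in> flags (maxbiclique_lattice R)" using that flags_iff by blast
    moreover from this have "(SOME F. F \<in> flags (maxbiclique_lattice R)) \<in> flags (maxbiclique_lattice R)"
      by (metis someI)
    ultimately have "card F = card (SOME F. F \<in> flags (maxbiclique_lattice R))"
      using assms(1) unfolding graded_def by blast
    \<comment> \<open>\<open>rank_of\<close> subtracts one from a cardinality. As \<open>N\<close>
      is positive the subtraction is not truncated, and flags have \<open>N + 1\<close>
      elements.\<close>
    thus ?thesis using assms(2,3) unfolding rank_of_def by simp
  qed
  note e' = faces.exact_rank_card_maxchain[of "face_bot R" R "face_top R" N, OF row_face_in face_bot_below row_face_in _ c]
  have e: "exact_rank (maxbicliques R) below r" "r (face_bot R) = 0" "r (face_top R) = N"
    unfolding r_def by (rule e'; simp)+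
  have "ranked_faces R r"
  proof
    show "exact_rank (maxbicliques R) below r" "r (face_bot R) = 0" by (rule e)+
    show "face_bot R \<in> maxbicliques R" "face_top R \<in> maxbicliques R" by (rule row_face_in)+
    show "below (face_bot R) x" if "x \<in> maxbicliques R" for x using that by (rule face_bot_below)
    show "below x (face_top R)" for x :: "'i set \<times> 'j set" by simp
  qed
  thus "ranked_faces R (element_rank (maxbiclique_lattice R))" using er by (metis ext)
  show "element_rank (maxbiclique_lattice R) (face_top R) = N" using e er by simp
qed

context ranked_faces
begin

lemma diamond_other:
  assumes d: "diamond_rank R r" and X: "e \<in> maxbicliques R" "c \<in> maxbicliques R" "b \<in> maxbicliques R"
    and le: "below e c" "below c b" and rk: "r c = r e + 1" "r b = r c + 1"
  obtains c' where "c' \<in> maxbicliques R" "below e c'" "below c' b" "c' \<noteq> c" "r c' = r c"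
proof -
  have "below e b" using le by blast
  hence "card (faces_between R e b) = 4" using d X rk unfolding diamond_rank_def by simp
  moreover have "card {e, c, b} \<le> 3" by (simp add: card_insert_if)
  ultimately have "\<not> faces_between R e b \<subseteq> {e, c, b}"
    using card_mono[of "{e, c, b}" "faces_between R e b"] by auto
  then obtain c' where c': "c' \<in> maxbicliques R" "below e c'" "below c' b" "c' \<noteq> c" "c' \<noteq> e" "c' \<noteq> b" by blast
  have "r e < r c'" "r c' < r b"
    using exact_rank_less[OF exact X(1) c'(1)] exact_rank_less[OF exact c'(1) X(3)] c' by auto
  with rk c' that show ?thesis by simp
qed

text \<open>An element of corank at least 2 is the bottom of a diamond and so the meet of the two
  middle elements, both different from it. An element of corank 1 has only the top strictly above
  it, and a meet of tops is the top.\<close>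

lemma meet_irreducibles_eq:
  assumes d: "diamond_rank R r"
  shows "meet_irreducibles (maxbiclique_lattice R) = {a\<in>maxbicliques R. r a + 1 = r (face_top R)}"
proof (intro Set.set_eqI iffI)
  fix a assume a: "a \<in> meet_irreducibles (maxbiclique_lattice R)"
  hence aX: "a \<in> maxbicliques R" and at: "a \<noteq> face_top R"
    and irr: "\<And>x y. x \<in> maxbicliques R \<Longrightarrow> y \<in> maxbicliques R \<Longrightarrow> a = row_face R (fst x \<union> fst y) \<Longrightarrow> a = x \<or> a = y"
    unfolding meet_irreducibles_def by (auto simp: lattice_meet)
  have "r a < r (face_top R)" using exact_rank_less[OF exact aX row_face_in _ at] by simp
  moreover have "\<not> r a + 1 < r (face_top R)"
  proof
    assume lt: "r a + 1 < r (face_top R)"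
    obtain c where c: "c \<in> maxbicliques R" "below a c" "r c = r a + 1"
      using exact_rank_cover_up[OF exact aX row_face_in _ at] by auto
    have "c \<noteq> face_top R" using c lt by auto
    then obtain b where b: "b \<in> maxbicliques R" "below c b" "r b = r c + 1"
      using exact_rank_cover_up[OF exact c(1) row_face_in, of "{}"] by auto
    obtain c' where c': "c' \<in> maxbicliques R" "below a c'" "c' \<noteq> c" "r c' = r c"
      using diamond_other[OF d aX c(1) b(1) c(2) b(2) c(3) b(3)] by metis
    \<comment> \<open>The meet of the two middle elements is strictly below \<open>c\<close> and
      above \<open>a\<close>, whose ranks differ by one; hence it is \<open>a\<close>.\<close>
    let ?m = "row_face R (fst c \<union> fst c')"
    have m: "?m \<in> maxbicliques R" "below ?m c" "below ?m c'" "below a ?m"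
      using row_face_in below_row_face[OF aX] below_row_face[OF row_face_in, of R "fst c \<union> fst c'" "fst c \<union> fst c'"]
        below_fst[OF aX c(1)] below_fst[OF aX c'(1)] below_fst[OF row_face_in c(1)] below_fst[OF row_face_in c'(1)] c c'
      by auto
    have "?m \<noteq> c"
      using exact_rank_inj[OF exact c(1) c'(1)] m(3) c'(3,4) by auto
    hence "r ?m < r c" using exact_rank_less[OF exact m(1) c(1) m(2)] by simp
    hence "a = ?m" using exact_rank_mono[OF exact aX m(1) m(4)] exact_rank_inj[OF exact aX m(1) m(4)] c by simp
    hence "a = c \<or> a = c'" using irr c c' by blast
    thus False using c c' by auto
  qed
  ultimately show "a \<in> {a\<in>maxbicliques R. r a + 1 = r (face_top R)}" using aX by simp
next
  fix a assume a: "a \<in> {a\<in>maxbicliques R. r a + 1 = r (face_top R)}"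
  have "a = x \<or> a = y" if xy: "x \<in> maxbicliques R" "y \<in> maxbicliques R" and e: "a = row_face R (fst x \<union> fst y)" for x y
  proof (rule ccontr)
    assume n: "\<not> (a = x \<or> a = y)"
    have "x = face_top R" if xX: "x \<in> maxbicliques R" and ax: "below a x" "a \<noteq> x" for x
      using exact_rank_less[OF exact _ xX ax] a exact_rank_inj[OF exact xX row_face_in, of "{}"] rank_le_top[OF xX] by simp
    moreover have "below a x" "below a y"
      using a e below_fst[of a R] xy below_row_face[of a R "fst x \<union> fst y"] by auto
    ultimately have "x = face_top R" "y = face_top R" using n xy by blast+
    hence "a = face_top R" using e face_eqI[OF row_face_in row_face_in, of R "fst x \<union> fst y" "{}"]
      by (simp add: row_face_def)
    thus False using a by simp
  qed
  moreover have "a \<noteq> face_top R" using a by auto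
  ultimately show "a \<in> meet_irreducibles (maxbiclique_lattice R)"
    unfolding meet_irreducibles_def using a by (auto simp: lattice_meet)
qed

text \<open>The dual argument: an element of rank at least 2 is the top of a diamond and so the join
  of the two middle elements.\<close>

lemma join_irreducibles_eq:
  assumes d: "diamond_rank R r"
  shows "join_irreducibles (maxbiclique_lattice R) = {a\<in>maxbicliques R. r a = 1}"
proof (intro Set.set_eqI iffI)
  fix a assume a: "a \<in> join_irreducibles (maxbiclique_lattice R)"
  hence aX: "a \<in> maxbicliques R" and at: "face_bot R \<noteq> a"
    and irr: "\<And>x y. x \<in> maxbicliques R \<Longrightarrow> y \<in> maxbicliques R \<Longrightarrow> a = column_face R (snd x \<union> snd y) \<Longrightarrow> a = x \<or> a = y"
    unfolding join_irreducibles_def by (auto simp: lattice_join)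
  have "0 < r a" using exact_rank_less[OF exact row_face_in aX face_bot_below[OF aX] at] by simp
  moreover have "\<not> 1 < r a"
  proof
    assume lt: "1 < r a"
    obtain c where c: "c \<in> maxbicliques R" "below c a" "r c + 1 = r a"
      using exact_rank_cover_down[OF exact row_face_in aX face_bot_below[OF aX] at] by metis
    have "face_bot R \<noteq> c" using c lt z(3) by auto
    then obtain e where e: "e \<in> maxbicliques R" "below e c" "r e + 1 = r c"
      using exact_rank_cover_down[OF exact row_face_in c(1) face_bot_below[OF c(1)]] by metis
    obtain c' where c': "c' \<in> maxbicliques R" "below c' a" "c' \<noteq> c" "r c' = r c"
      using diamond_other[OF d e(1) c(1) aX e(2) c(2)] c(3) e(3) by metis
    let ?m = "column_face R (snd c \<union> snd c')"
    have m: "?m \<in> maxbicliques R" "below c ?m" "below c' ?m" "below ?m a"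
      using column_face_in below_column_face[OF aX] c c'
        below_column_face[OF column_face_in, of R "snd c \<union> snd c'" "snd c \<union> snd c'"]
      by auto
    have "c \<noteq> ?m"
      using exact_rank_inj[OF exact c'(1) c(1)] m(3) c'(3,4) by auto
    hence "r c < r ?m" using exact_rank_less[OF exact c(1) m(1) m(2)] by simp
    hence "?m = a" using exact_rank_mono[OF exact m(1) aX m(4)] exact_rank_inj[OF exact m(1) aX m(4)] c by simp
    hence "a = c \<or> a = c'" using irr c c' by blast
    thus False using c c' by auto
  qed
  ultimately show "a \<in> {a\<in>maxbicliques R. r a = 1}" using aX by simp
next
  fix a assume a: "a \<in> {a\<in>maxbicliques R. r a = 1}"
  have "a = x \<or> a = y" if xy: "x \<in> maxbicliques R" "y \<in> maxbicliques R" and e: "a = column_face R (snd x \<union> snd y)" for x y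
  proof (rule ccontr)
    assume n: "\<not> (a = x \<or> a = y)"
    have "x = face_bot R" if xX: "x \<in> maxbicliques R" and ax: "below x a" "x \<noteq> a" for x
      using exact_rank_less[OF exact xX _ ax] a exact_rank_inj[OF exact row_face_in xX face_bot_below[OF xX]] z(3) by simp
    moreover have "below x a" "below y a"
      using a e below_column_face[of a R "snd x \<union> snd y"] by auto
    ultimately have "x = face_bot R" "y = face_bot R" using n xy by blast+
    hence "a = column_face R (snd (face_bot R))" using e by simp
    hence "below a (face_bot R)" using below_column_face[OF row_face_in, of R "snd (face_bot R)" UNIV] by simp
    hence "a = face_bot R" using below_antisym[OF _ row_face_in] face_bot_below a by blast
    thus False using a z(3) by simp
  qed
  moreover have "a \<noteq> face_bot R" using a z(3) by auto
  ultimately show "a \<in> join_irreducibles (maxbiclique_lattice R)"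
    unfolding join_irreducibles_def using a by (auto simp: lattice_join)
qed

end

no_notation scalar_prod (infix \<open>\<bullet>\<close> 70)

section \<open>Sign patterns\<close>

lemma one_dim_extension:
  fixes S T :: "'a::euclidean_space set"
  assumes S: "Real_Vector_Spaces.subspace S" and T: "Real_Vector_Spaces.subspace T" and "S \<subseteq> T"
    and dim: "dim T \<le> dim S + 1" and w: "w \<in> T" "w \<notin> S" and x: "x \<in> T"
  obtains a where "x - a *\<^sub>R w \<in> S"
proof -
  have "span S = S" using S by (simp add: span_eq_iff)
  have "Real_Vector_Spaces.subspace (span (insert w S))" by simp
  moreover have "span (insert w S) \<subseteq> T"
    using \<open>S \<subseteq> T\<close> w T by (intro span_minimal) auto
  moreover have "dim T \<le> dim (span (insert w S))"
  proof -
    have "w \<notin> span S" using w \<open>span S = S\<close> by metis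
    thus ?thesis using dim by (simp add: dim_insert)
  qed
  ultimately have "span (insert w S) = T" using T by (intro subspace_dim_equal)
  with x obtain a where "x - a *\<^sub>R w \<in> span S" using span_breakdown_eq[of x w S] by blast
  hence "x - a *\<^sub>R w \<in> S" using \<open>span S = S\<close> by metis
  thus ?thesis by (rule that)
qed

text \<open>Finitely many subspaces not containing \<open>U\<close> cannot cover an open part of it:
  the point is moved out of one subspace at a time, by an amount too small to leave \<open>W\<close>
  or to return to those already avoided.\<close>

lemma generic_point:
  fixes U :: "'a::euclidean_space set"
  assumes "finite \<T>" and U: "Real_Vector_Spaces.subspace U"
    and \<T>: "\<And>T. T \<in> \<T> \<Longrightarrow> Real_Vector_Spaces.subspace T \<and> \<not> U \<subseteq> T"
    and "z \<in> U" "open W" "z \<in> W"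
  obtains z' where "z' \<in> U" "z' \<in> W" "\<And>T. T \<in> \<T> \<Longrightarrow> z' \<notin> T"
proof -
  have "\<exists>z'. z' \<in> U \<and> z' \<in> W \<and> (\<forall>T\<in>\<T>. z' \<notin> T)"
    using \<open>finite \<T>\<close> \<T>
  proof (induction \<T>)
    case empty
    thus ?case using assms by blast
  next
    case (insert T \<T>)
    then obtain z' where z': "z' \<in> U" "z' \<in> W" "\<forall>T\<in>\<T>. z' \<notin> T" by auto
    show ?case
    proof (cases "z' \<in> T")
      case False
      thus ?thesis using z' by auto
    next
      case True
      obtain u where u: "u \<in> U" "u \<notin> T" using insert.prems by blast
      have sT: "Real_Vector_Spaces.subspace T" using insert.prems by blast
      have cl: "closed (\<Union>\<T>)" using insert by (intro closed_Union) (auto intro: closed_subspace)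
      have "open (W - \<Union>\<T>)" using \<open>open W\<close> cl by blast
      moreover have "z' \<in> W - \<Union>\<T>" using z' by blast
      ultimately obtain \<epsilon> where \<epsilon>: "\<epsilon> > 0" "ball z' \<epsilon> \<subseteq> W - \<Union>\<T>"
        by (meson open_contains_ball)
      have "u \<noteq> 0" using u sT subspace_0 by blast
      define k where "k = \<epsilon> / (2 * norm u)"
      have k: "k > 0" "k * norm u < \<epsilon>" using \<epsilon> \<open>u \<noteq> 0\<close> by (auto simp: k_def field_simps)
      let ?z = "z' + k *\<^sub>R u"
      have "?z \<in> ball z' \<epsilon>" using k by (simp add: dist_norm)
      moreover have "?z \<in> U" using z' u U by (simp add: subspace_add subspace_scale)
      moreover have "?z \<notin> T"
      proof
        assume "?z \<in> T"
        hence "k *\<^sub>R u \<in> T" using True sT subspace_diff[OF sT, of ?z z'] by simp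
        hence "u \<in> T" using k subspace_scale[OF sT, of "k *\<^sub>R u" "1 / k"] by simp
        with u show False by blast
      qed
      ultimately show ?thesis using \<epsilon> by blast
    qed
  qed
  with that show ?thesis by blast
qed

lemma sum_nonpos_zero_iff:
  fixes f :: "'b \<Rightarrow> real"
  assumes "finite A" "\<And>x. x \<in> A \<Longrightarrow> f x \<le> 0"
  shows "sum f A = 0 \<longleftrightarrow> (\<forall>x\<in>A. f x = 0)"
  using sum_nonneg_eq_0_iff[of A "\<lambda>x. - f x"] assms by (simp add: sum_negf)

locale sign_pattern =
  fixes R :: "('i::finite \<times> 'j::finite) set" and n :: "'i \<Rightarrow> 'a::euclidean_space" and v :: "'j \<Rightarrow> 'a"
  assumes nonpos: "n i \<bullet> v j \<le> 0" and zero_iff: "n i \<bullet> v j = 0 \<longleftrightarrow> (i, j) \<in> R"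
begin

text \<open>Linear hull, relative interior point and cone of the face \<open>p\<close>. The sum
  \<open>w p\<close> is a canonical interior point: for a face \<open>p\<close>, a row vanishes on
  it exactly when it vanishes on all generators of \<open>p\<close>. The dimension
  \<open>rk p\<close> is the geometric candidate for the lattice rank.\<close>

definition U :: "'i set \<times> 'j set \<Rightarrow> 'a set" where "U p = span (v ` snd p)"
definition w :: "'i set \<times> 'j set \<Rightarrow> 'a" where "w p = (\<Sum>j\<in>snd p. v j)"
definition rk :: "'i set \<times> 'j set \<Rightarrow> nat" where "rk p = dim (U p)"
definition V :: "'i set \<times> 'j set \<Rightarrow> 'a set" where
  "V p = {\<Sum>j\<in>snd p. c j *\<^sub>R v j | c. \<forall>j. (0::real) \<le> c j}"

lemma U_subspace: "Real_Vector_Spaces.subspace (U p)"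
  unfolding U_def by simp

lemma v_in_U: "j \<in> snd p \<Longrightarrow> v j \<in> U p"
  unfolding U_def by (simp add: span_base)

lemma w_in_U: "w p \<in> U p"
  unfolding w_def by (intro subspace_sum[OF U_subspace] v_in_U)

lemma U_mono: "below p q \<Longrightarrow> U p \<subseteq> U q"
  unfolding U_def by (intro span_mono image_mono)

lemma w_in_U': "below p q \<Longrightarrow> w p \<in> U q"
  using U_mono w_in_U by blast

lemma VI: "(\<And>j. 0 \<le> c j) \<Longrightarrow> (\<Sum>j\<in>snd p. c j *\<^sub>R v j) \<in> V p"
  unfolding V_def by blast

lemma VE:
  assumes "x \<in> V p"
  obtains c where "\<And>j. 0 \<le> c j" "x = (\<Sum>j\<in>snd p. c j *\<^sub>R v j)"
  using assms unfolding V_def by blast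

lemma V_add: "x \<in> V p \<Longrightarrow> y \<in> V p \<Longrightarrow> x + y \<in> V p"
  by (elim VE) (auto simp: sum.distrib[symmetric] scaleR_add_left[symmetric] intro!: VI)

lemma V_scale: "x \<in> V p \<Longrightarrow> 0 \<le> a \<Longrightarrow> a *\<^sub>R x \<in> V p"
  by (elim VE) (auto simp: scaleR_sum_right intro!: VI)

lemma V_U: "V p \<subseteq> U p"
  by (auto elim!: VE intro!: subspace_sum[OF U_subspace] subspace_scale[OF U_subspace] v_in_U)

lemma V_mono: assumes "below p q" shows "V p \<subseteq> V q"
proof
  fix x assume "x \<in> V p"
  then obtain c where c: "\<And>j. 0 \<le> c j" "x = (\<Sum>j\<in>snd p. c j *\<^sub>R v j)" by (elim VE) blast
  have "x = (\<Sum>j\<in>snd q. (if j \<in> snd p then c j else 0) *\<^sub>R v j)"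
    unfolding c(2) using assms by (intro sum.mono_neutral_cong_left) auto
  also have "\<dots> \<in> V q" using c(1) by (intro VI) auto
  finally show "x \<in> V q" .
qed

lemma v_in_V: assumes "j \<in> snd p" shows "v j \<in> V p"
proof -
  have "v j = (\<Sum>j'\<in>snd p. (if j' = j then 1 else 0) *\<^sub>R v j')"
    using assms by (simp add: if_distrib[of "\<lambda>c. c *\<^sub>R _"] cong: if_cong)
  also have "\<dots> \<in> V p" by (intro VI) auto
  finally show ?thesis .
qed

lemma w_in_V: "w p \<in> V p"
proof -
  have "w p = (\<Sum>j\<in>snd p. 1 *\<^sub>R v j)" by (simp add: w_def)
  also have "\<dots> \<in> V p" by (intro VI) auto
  finally show ?thesis .
qed

lemma inner_V: "x \<in> V p \<Longrightarrow> n i \<bullet> x \<le> 0"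
  by (elim VE) (auto simp: inner_sum_right nonpos intro!: sum_nonpos mult_nonneg_nonpos)

lemma inner_U:
  assumes "p \<in> maxbicliques R" "i \<in> fst p" "x \<in> U p"
  shows "n i \<bullet> x = 0"
proof -
  have "v ` snd p \<subseteq> {x. n i \<bullet> x = 0}" using assms zero_iff face_fst[OF assms(1)] by blast
  hence "U p \<subseteq> {x. n i \<bullet> x = 0}" unfolding U_def by (intro span_minimal subspace_hyperplane)
  thus ?thesis using assms by blast
qed

lemma inner_w_nonpos: "n i \<bullet> w p \<le> 0"
  by (rule inner_V[OF w_in_V])

lemma inner_w_iff:
  assumes "p \<in> maxbicliques R"
  shows "n i \<bullet> w p = 0 \<longleftrightarrow> i \<in> fst p"
proof -
  have "n i \<bullet> w p = (\<Sum>j\<in>snd p. n i \<bullet> v j)" by (simp add: w_def inner_sum_right)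
  also have "\<dots> = 0 \<longleftrightarrow> (\<forall>j\<in>snd p. n i \<bullet> v j = 0)" by (rule sum_nonpos_zero_iff) (auto simp: nonpos)
  finally show ?thesis using face_fst[OF assms] zero_iff by blast
qed

lemma inner_w_neg: "p \<in> maxbicliques R \<Longrightarrow> i \<notin> fst p \<Longrightarrow> n i \<bullet> w p < 0"
  using inner_w_iff[of p i] inner_w_nonpos[of i p] by (simp add: order_le_less)

text \<open>Rows containing \<open>p\<close> vanish on \<open>U p\<close>, and rows vanishing at
  \<open>w q\<close> contain \<open>q\<close>. So the linear hulls recover the order of the faces,
  and strict growth of their dimensions follows.\<close>

lemma w_in_U_iff:
  assumes "p \<in> maxbicliques R" "q \<in> maxbicliques R"
  shows "w q \<in> U p \<longleftrightarrow> below q p"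
proof
  assume "w q \<in> U p"
  hence "fst p \<subseteq> fst q" using inner_U[OF assms(1)] inner_w_iff[OF assms(2)] by blast
  thus "below q p" using below_fst assms by blast
qed (rule w_in_U')

lemma rk_less:
  assumes "p \<in> maxbicliques R" "q \<in> maxbicliques R" "below p q" "p \<noteq> q"
  shows "rk p < rk q"
proof -
  have "\<not> below q p" using below_antisym assms by blast
  hence "U p \<subset> U q" using w_in_U_iff[OF assms(1,2)] w_in_U[of q] U_mono[OF assms(3)] by blast
  thus ?thesis unfolding rk_def U_def by (simp add: dim_psubset)
qed

text \<open>The multiple of \<open>w b\<close> that takes \<open>x\<close> to the hyperplane of row
  \<open>i\<close>: if \<open>i\<close> does not contain the face \<open>b\<close>, then adding
  \<open>\<mu>\<close> times \<open>w b\<close> to \<open>x\<close> satisfies inequality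
  \<open>i\<close> iff \<open>\<mu> \<ge> g b i x\<close>. The largest of these values projects
  \<open>x\<close> from \<open>w b\<close> onto the boundary.\<close>

definition g :: "'i set \<times> 'j set \<Rightarrow> 'i \<Rightarrow> 'a \<Rightarrow> real" where "g b i x = (n i \<bullet> x) / - (n i \<bullet> w b)"

text \<open>The terms of \<open>n i \<bullet> y\<close> are all nonpositive, so it vanishes iff row
  \<open>i\<close> contains every column with a nonzero coefficient. The closure of these columns is
  the face carrying \<open>y\<close>.\<close>

lemma face_of_point:
  assumes q: "q \<in> maxbicliques R" and y: "y \<in> V q"
  obtains p where "p \<in> maxbicliques R" "below p q" "fst p = {i. n i \<bullet> y = 0}" "y \<in> V p"
proof -
  obtain c where c: "\<And>j. 0 \<le> c j" "y = (\<Sum>j\<in>snd q. c j *\<^sub>R v j)" using y by (elim VE) blast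
  define B where "B = {j\<in>snd q. c j \<noteq> 0}"
  let ?p = "column_face R B"
  have "n i \<bullet> y = 0 \<longleftrightarrow> (\<forall>j\<in>B. (i, j) \<in> R)" for i
  proof -
    have "n i \<bullet> y = (\<Sum>j\<in>snd q. c j * (n i \<bullet> v j))" by (simp add: c(2) inner_sum_right)
    also have "\<dots> = 0 \<longleftrightarrow> (\<forall>j\<in>snd q. c j * (n i \<bullet> v j) = 0)"
      by (rule sum_nonpos_zero_iff) (auto simp: nonpos c mult_nonneg_nonpos)
    finally show ?thesis using zero_iff[of i] by (auto simp: B_def)
  qed
  hence 1: "fst ?p = {i. n i \<bullet> y = 0}" unfolding column_face_def by auto
  have B: "B \<subseteq> snd ?p" unfolding column_face_def by auto
  have "y = (\<Sum>j\<in>B. c j *\<^sub>R v j)"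
    unfolding c(2) by (intro sum.mono_neutral_cong_right) (auto simp: B_def)
  also have "\<dots> = (\<Sum>j\<in>snd ?p. (if j \<in> B then c j else 0) *\<^sub>R v j)"
    using B by (intro sum.mono_neutral_cong_left) auto
  also have "\<dots> \<in> V ?p" using c(1) by (intro VI) auto
  finally have "y \<in> V ?p" .
  moreover have "below ?p q" using below_column_face[OF q, of B] B_def by blast
  ultimately show ?thesis using that[OF column_face_in _ 1] by blast
qed

end

text \<open>The input of the path argument: dimensions of hulls form an exact rank, and intervals of
  rank 2 have a second middle element. For a given matrix the lattice supplies this; for a cone it
  is derived and then yields the connectivity of flags.\<close>

locale ranked_sign_pattern = sign_pattern +
  assumes bot: "snd (face_bot R) = {}"
    and exact: "exact_rank (maxbicliques R) below rk"
    and diamond: "\<And>e c b. e \<in> maxbicliques R \<Longrightarrow> c \<in> maxbicliques R \<Longrightarrow> b \<in> maxbicliques R \<Longrightarrow>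
      below e c \<Longrightarrow> below c b \<Longrightarrow> rk c = rk e + 1 \<Longrightarrow> rk b = rk c + 1 \<Longrightarrow>
      \<exists>c'\<in>maxbicliques R. below e c' \<and> below c' b \<and> c' \<noteq> c \<and> rk c' = rk c"
begin

lemma cover_decomp:
  assumes c: "c \<in> maxbicliques R" "b \<in> maxbicliques R" "below c b" "rk c + 1 = rk b" and x: "x \<in> U b"
    and y: "y \<in> U b" "y \<notin> U c"
  obtains a where "x - a *\<^sub>R y \<in> U c"
  using one_dim_extension[OF U_subspace U_subspace U_mono[OF c(3)] _ y x] c(4) unfolding rk_def by auto

text \<open>Row \<open>i\<close> vanishes on the hyperplane \<open>U c\<close> of \<open>U b\<close>
  but not at \<open>w b\<close>, so its kernel in \<open>U b\<close> is no larger than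
  \<open>U c\<close>.\<close>

lemma coatom_kernel:
  assumes c: "c \<in> maxbicliques R" "b \<in> maxbicliques R" "below c b" "rk c + 1 = rk b"
    and i: "i \<in> fst c" "i \<notin> fst b" and x: "x \<in> U b" "n i \<bullet> x = 0"
  shows "x \<in> U c"
proof -
  have "w b \<notin> U c" using inner_U[OF c(1) i(1)] inner_w_neg[OF c(2) i(2)] by force
  then obtain a where a: "x - a *\<^sub>R w b \<in> U c" using cover_decomp[OF c x(1) w_in_U] by blast
  have "a * (n i \<bullet> w b) = 0" using inner_U[OF c(1) i(1) a] x(2) by (simp add: inner_diff_right)
  hence "a = 0" using inner_w_neg[OF c(2) i(2)] by simp
  with a show ?thesis by simp
qed

lemma rank_two_decomp:
  assumes e: "e \<in> maxbicliques R" "c \<in> maxbicliques R" "c' \<in> maxbicliques R" "b \<in> maxbicliques R"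
    and le: "below e c" "below e c'" "below c b" "below c' b"
    and rk: "rk e + 1 = rk c" "rk c + 1 = rk b" "rk c' = rk c" "c \<noteq> c'"
    and x: "x \<in> U b"
  obtains a a' where "x - a *\<^sub>R w c - a' *\<^sub>R w c' \<in> U e"
proof -
  have "\<not> below c' c" "\<not> below c e"
    using exact_rank_less[OF exact e(3,2)] exact_rank_less[OF exact e(2,1)] rk below_antisym[OF e(2,3)] by force+
  hence "w c' \<notin> U c" "w c \<notin> U e" using w_in_U_iff e by blast+
  then obtain a' where a': "x - a' *\<^sub>R w c' \<in> U c" using cover_decomp[OF e(2,4) le(3) rk(2) x w_in_U'[OF le(4)]] by blast
  obtain a where "x - a' *\<^sub>R w c' - a *\<^sub>R w c \<in> U e"
    using cover_decomp[OF e(1,2) le(1) rk(1) a' w_in_U] \<open>w c \<notin> U e\<close> by blast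
  with that[of a a'] show ?thesis by (simp add: algebra_simps)
qed

text \<open>In the plane \<open>U b\<close> modulo \<open>U e\<close> the two coatoms are boundary
  rays with \<open>w b\<close> between them. The coefficient of one coatom is read off by a row
  containing the other coatom but not this one: that row is negative both at \<open>w b\<close> and
  at the interior point of this coatom.\<close>

lemma rank_two_top:
  assumes e: "e \<in> maxbicliques R" "c \<in> maxbicliques R" "c' \<in> maxbicliques R" "b \<in> maxbicliques R"
    and le: "below e c" "below e c'" "below c b" "below c' b"
    and rk: "rk e + 1 = rk c" "rk c + 1 = rk b" "rk c' = rk c" "c \<noteq> c'"
  obtains a a' where "a > 0" "a' > 0" "w b - a *\<^sub>R w c - a' *\<^sub>R w c' \<in> U e"
proof -
  obtain a a' where a: "w b - a *\<^sub>R w c - a' *\<^sub>R w c' \<in> U e" using rank_two_decomp[OF e le rk w_in_U] .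
  have pos: "t > 0" if cs: "{c1, c2} = {c, c'}" and t: "w b - s *\<^sub>R w c1 - t *\<^sub>R w c2 \<in> U e" for c1 c2 s t
  proof -
    have c: "c1 \<in> maxbicliques R" "c2 \<in> maxbicliques R" "below e c1" "below c2 b" "rk c1 = rk c2" "c1 \<noteq> c2"
      using cs e le rk by (auto simp: doubleton_eq_iff)
    have "\<not> below c2 c1" using exact_rank_less[OF exact c(2,1)] c by force
    then obtain i where i: "i \<in> fst c1" "i \<notin> fst c2" using below_fst[OF c(2,1)] by blast
    have ie: "i \<in> fst e" using i below_fst[OF e(1) c(1)] c by blast
    have ib: "i \<notin> fst b" using i below_fst[OF c(2) e(4)] c by blast
    have "n i \<bullet> w b = t * (n i \<bullet> w c2)"
      using inner_U[OF e(1) ie t] inner_w_iff[OF c(1), of i] i by (simp add: inner_diff_right)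
    thus "t > 0" using inner_w_neg[OF e(4) ib] inner_w_neg[OF c(2) i(2)] by (simp add: mult_less_0_iff)
  qed
  have "w b - a' *\<^sub>R w c' - a *\<^sub>R w c \<in> U e" using a by (simp add: algebra_simps)
  from pos[OF _ this] pos[OF _ a] a that show ?thesis by (auto simp: insert_commute)
qed

text \<open>Near a face of codimension 2 the two coatoms above it suffice: in the quotient plane
  every inequality through \<open>e\<close> is a nonnegative combination of those of the two
  boundary rays, which makes \<open>g b i\<close> a convex combination of \<open>g b k\<close> and
  \<open>g b k'\<close>.\<close>

lemma g_bound:
  assumes e: "e \<in> maxbicliques R" "c \<in> maxbicliques R" "c' \<in> maxbicliques R" "b \<in> maxbicliques R"
    and le: "below e c" "below e c'" "below c b" "below c' b"
    and rk: "rk e + 1 = rk c" "rk c + 1 = rk b" "rk c' = rk c" "c \<noteq> c'"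
    and i: "i \<in> fst e" "i \<notin> fst b" and k: "k \<in> fst c" "k \<notin> fst b" and k': "k' \<in> fst c'" "k' \<notin> fst b"
    and x: "x \<in> U b"
  shows "g b i x \<le> max (g b k x) (g b k' x)"
proof -
  obtain \<alpha> \<beta> where ab: "\<alpha> > 0" "\<beta> > 0" and wb: "w b - \<alpha> *\<^sub>R w c - \<beta> *\<^sub>R w c' \<in> U e"
    using rank_two_top[OF e le rk] .
  obtain a a' where xa: "x - a *\<^sub>R w c - a' *\<^sub>R w c' \<in> U e" using rank_two_decomp[OF e le rk x] .
  have ev: "n l \<bullet> w b = \<alpha> * (n l \<bullet> w c) + \<beta> * (n l \<bullet> w c')"
    "n l \<bullet> x = a * (n l \<bullet> w c) + a' * (n l \<bullet> w c')" if "l \<in> fst e" for l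
    using inner_U[OF e(1) that wb] inner_U[OF e(1) that xa] by (simp_all add: inner_diff_right)
  have ke: "k \<in> fst e" "k' \<in> fst e" using k k' below_fst e le by blast+
  have z: "n k \<bullet> w c = 0" "n k' \<bullet> w c' = 0" using inner_w_iff e k k' by blast+
  have nb: "n k \<bullet> w b < 0" "n k' \<bullet> w b < 0" "n i \<bullet> w b < 0" using inner_w_neg[OF e(4)] k k' i by blast+
  have gk: "g b k x = - a' / \<beta>"
    using ev[OF ke(1)] z nb(1) ab unfolding g_def by (auto simp: field_simps)
  have gk': "g b k' x = - a / \<alpha>"
    using ev[OF ke(2)] z nb(2) ab unfolding g_def by (auto simp: field_simps)
  \<comment> \<open>The weights of the convex combination before normalisation; their sum is
    \<open>- (n i \<bullet> w b)\<close>, the denominator in \<open>g b i\<close>.\<close>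
  define P Q where "P = - \<alpha> * (n i \<bullet> w c)" and "Q = - \<beta> * (n i \<bullet> w c')"
  have PQ: "P \<ge> 0" "Q \<ge> 0" "P + Q > 0"
    using ab inner_w_nonpos[of i c] inner_w_nonpos[of i c'] nb(3) ev(1)[OF i(1)]
    by (auto simp: P_def Q_def mult_nonneg_nonpos)
  have "g b i x = (a * (n i \<bullet> w c) + a' * (n i \<bullet> w c')) / (P + Q)"
    unfolding g_def using ev[OF i(1)] by (simp add: P_def Q_def)
  also have "a * (n i \<bullet> w c) + a' * (n i \<bullet> w c') = P * g b k' x + Q * g b k x"
    unfolding gk gk' P_def Q_def using ab by simp
  also have "\<dots> \<le> (P + Q) * max (g b k x) (g b k' x)"
    using PQ by (simp add: distrib_right add_mono mult_left_mono)
  hence "(P * g b k' x + Q * g b k x) / (P + Q) \<le> max (g b k x) (g b k' x)"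
    using PQ by (simp add: pos_divide_le_eq mult.commute)
  finally show ?thesis .
qed

lemma g_same_coatom:
  assumes c: "c \<in> maxbicliques R" "b \<in> maxbicliques R" "below c b" "rk c + 1 = rk b"
    and i: "i \<in> fst c" "i \<notin> fst b" and k: "k \<in> fst c" "k \<notin> fst b" and x: "x \<in> U b"
  shows "g b i x = g b k x"
proof -
  have nb: "n i \<bullet> w b < 0" "n k \<bullet> w b < 0" using inner_w_neg[OF c(2)] i k by blast+
  have "w b \<notin> U c" using inner_U[OF c(1) i(1)] nb by force
  then obtain a where a: "x - a *\<^sub>R w b \<in> U c" using cover_decomp[OF c x w_in_U] by blast
  have "n i \<bullet> x = a * (n i \<bullet> w b)" "n k \<bullet> x = a * (n k \<bullet> w b)"
    using inner_U[OF c(1) i(1) a] inner_U[OF c(1) k(1) a] by (simp_all add: inner_diff_right)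
  with nb show ?thesis by (simp add: g_def)
qed

lemma g_nonpos: "b \<in> maxbicliques R \<Longrightarrow> i \<notin> fst b \<Longrightarrow> n i \<bullet> x \<le> 0 \<Longrightarrow> g b i x \<le> 0"
  unfolding g_def using inner_w_neg[of b i] by (intro divide_nonpos_pos) auto

lemma continuous_g: "continuous_on UNIV (g b i)"
  unfolding g_def divide_inverse by (intro continuous_intros)

text \<open>The radial projection from \<open>w b\<close> maps a generic segment in \<open>U b\<close> to a path in the boundary
  of the cone that only crosses faces of rank at least \<open>rk b - 2\<close>. There the coatoms in \<open>S\<close> describe
  the cone locally, so a path starting in \<open>S\<close> never leaves \<open>S\<close>.\<close>

lemma coatoms_dominate:
  assumes b: "b \<in> maxbicliques R"
    and IH: "\<And>c x. c \<in> coatoms (maxbicliques R) below rk b \<Longrightarrow> x \<in> U c \<Longrightarrow> (\<And>i. n i \<bullet> x \<le> 0) \<Longrightarrow> x \<in> V c"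
    and S: "adjacency_closed (maxbicliques R) below rk b S" "S \<noteq> {}"
    and \<iota>: "\<And>c. c \<in> S \<Longrightarrow> \<iota> c \<in> fst c \<and> \<iota> c \<notin> fst b"
    and z: "z \<in> U b" and i: "i \<notin> fst b"
  shows "\<exists>c\<in>S. g b i z \<le> g b (\<iota> c) z"
proof (rule ccontr)
  assume neg: "\<not> (\<exists>c\<in>S. g b i z \<le> g b (\<iota> c) z)"
  \<comment> \<open>\<open>D x\<close> says that the rows chosen for \<open>S\<close> dominate at
    \<open>x\<close>, so that the projection of \<open>x\<close> to the boundary is governed by
    coatoms in \<open>S\<close>. By assumption it fails at \<open>z\<close>.\<close>
  define D where "D x \<longleftrightarrow> (\<forall>i. i \<notin> fst b \<longrightarrow> (\<exists>c\<in>S. g b i x \<le> g b (\<iota> c) x))" for x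
  have coat: "c \<in> maxbicliques R" "below c b" "rk c + 1 = rk b" if "c \<in> S" for c
    using S that unfolding adjacency_closed_def coatoms_def by blast+
  have Scoat: "S \<subseteq> coatoms (maxbicliques R) below rk b" using S unfolding adjacency_closed_def by blast
  have finS: "finite S" by simp
  obtain c0 where c0: "c0 \<in> S" using S by blast
  \<comment> \<open>A starting point where domination is clear: for rows not containing
    \<open>b\<close> the values of \<open>g\<close> are at most 0 there, and the row of
    \<open>c0\<close> attains 0.\<close>
  let ?base = "w c0"
  have x0b: "?base \<in> U b" using w_in_U' coat c0 by blast
  \<comment> \<open>The end points for which the projected segment could meet a face of codimension
    at least 3. Each span gains at most two dimensions over \<open>U p\<close>, hence does not
    contain \<open>U b\<close>.\<close>
  define \<T> where "\<T> = (\<lambda>p. span (insert ?base (insert (w b) (U p)))) ` {p \<in> maxbicliques R. rk p + 3 \<le> rk b}"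
  have \<T>: "Real_Vector_Spaces.subspace T \<and> \<not> U b \<subseteq> T" if "T \<in> \<T>" for T
  proof -
    obtain p where p: "rk p + 3 \<le> rk b" "T = span (insert ?base (insert (w b) (U p)))"
      using \<open>T \<in> \<T>\<close> unfolding \<T>_def by blast
    have "dim T \<le> dim (U p) + 2" unfolding p(2) by (simp add: dim_insert)
    hence "dim T < dim (U b)" using p(1) unfolding rk_def by simp
    thus ?thesis using p(2) dim_subset[of "U b" T] by auto
  qed
  \<comment> \<open>Strict failure of domination is an open condition, so it survives the
    perturbation of \<open>z\<close> to a generic \<open>z'\<close>.\<close>
  define W where "W = (\<Inter>c\<in>S. {x. g b (\<iota> c) x < g b i x})"
  have "open W" unfolding W_def
    by (intro open_INT finS ballI open_Collect_less continuous_g)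
  moreover have "z \<in> W" using neg unfolding W_def by force
  moreover have "finite \<T>" unfolding \<T>_def by simp
  ultimately obtain z' where z': "z' \<in> U b" "z' \<in> W" "\<And>T. T \<in> \<T> \<Longrightarrow> z' \<notin> T"
    using generic_point[OF _ U_subspace \<T> z] by metis
  have nD: "\<not> D z'" 
  proof
    assume "D z'"
    then obtain c where "c \<in> S" "g b i z' \<le> g b (\<iota> c) z'" using i unfolding D_def by blast
    with z'(2) show False unfolding W_def by force
  qed
  define f where "f t = ?base + t *\<^sub>R (z' - ?base)" for t :: real
  have fU: "f t \<in> U b" for t
    unfolding f_def by (intro subspace_add[OF U_subspace] subspace_scale[OF U_subspace] subspace_diff[OF U_subspace] x0b z')
  have cf: "continuous_on UNIV (\<lambda>t. g b k (f t))" for k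
    unfolding g_def f_def divide_inverse by (intro continuous_intros)
  define E where "E = {0..1} \<inter> {t. D (f t)}"
  have "{t. D (f t)} = (\<Inter>i\<in>-fst b. \<Union>c\<in>S. {t. g b i (f t) \<le> g b (\<iota> c) (f t)})"
    unfolding D_def by auto
  hence "closed {t. D (f t)}"
    by (auto intro!: closed_INT closed_UN closed_Collect_le cf)
  hence "closed E" unfolding E_def by (intro closed_Int closed_atLeastAtMost)
  have x0g: "g b k ?base \<le> 0" if "k \<notin> fst b" for k
    by (rule g_nonpos[OF b that inner_w_nonpos])
  have x0c0: "g b (\<iota> c0) ?base = 0" using \<iota>[OF c0] inner_w_iff[OF coat(1)[OF c0]] unfolding g_def by simp
  have "D (f 0)" unfolding D_def f_def using x0g x0c0 c0 by (auto intro!: bexI[of _ c0])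
  hence "0 \<in> E" unfolding E_def by simp
  have bdd: "bdd_above E" unfolding E_def by (rule bdd_above_Int1) simp
  \<comment> \<open>The last parameter at which \<open>S\<close> dominates. The contradiction will
    be a slightly larger one.\<close>
  define s where "s = Sup E"
  have sE: "s \<in> E" unfolding s_def using \<open>closed E\<close> \<open>0 \<in> E\<close> bdd by (intro closed_contains_Sup) auto
  have smax: "t \<le> s" if "t \<in> E" for t unfolding s_def using that bdd by (rule cSup_upper)
  have "f 1 = z'" unfolding f_def by simp
  hence "s \<noteq> 1" using sE nD unfolding E_def by auto
  hence s: "0 \<le> s" "s < 1" using sE unfolding E_def by auto
  let ?x = "f s"
  have Dx: "D ?x" using sE unfolding E_def by simp
  obtain c where c: "c \<in> S" "\<And>c'. c' \<in> S \<Longrightarrow> g b (\<iota> c') ?x \<le> g b (\<iota> c) ?x"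
    using finite_arg_max[OF finS S(2), of "\<lambda>c. g b (\<iota> c) ?x"] by blast
  define m where "m = g b (\<iota> c) ?x"
  have gm: "g b k ?x \<le> m" if "k \<notin> fst b" for k
    using Dx that c unfolding D_def m_def by (meson order_trans)
  \<comment> \<open>The radial projection of \<open>?x\<close>. The row of \<open>c\<close> is
    active there, so the induction hypothesis places it in the cone of the coatom \<open>c\<close>,
    on some face \<open>p\<close> below \<open>c\<close>.\<close>
  let ?y = "?x + m *\<^sub>R w b"
  have yU: "?y \<in> U b" by (intro subspace_add[OF U_subspace] subspace_scale[OF U_subspace] fU w_in_U)
  have ny: "n k \<bullet> ?y = - (n k \<bullet> w b) * (g b k ?x - m)" if "k \<notin> fst b" for k
    using inner_w_neg[OF b that] unfolding g_def by (simp add: inner_add_right field_simps)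
  have ny0: "n k \<bullet> ?y = 0" if "k \<in> fst b" for k using inner_U[OF b that yU] .
  have nyle: "n k \<bullet> ?y \<le> 0" for k
  proof (cases "k \<in> fst b")
    case False
    thus ?thesis using ny[OF False] gm[OF False] inner_w_neg[OF b False] by (simp add: mult_nonneg_nonpos mult_nonpos_nonneg mult_nonpos_nonpos)
  qed (simp add: ny0)
  have \<iota>c: "\<iota> c \<in> fst c" "\<iota> c \<notin> fst b" using \<iota>[OF c(1)] by blast+
  have "n (\<iota> c) \<bullet> ?y = 0" using ny[OF \<iota>c(2)] unfolding m_def by simp
  hence "?y \<in> U c" using coatom_kernel[OF coat(1)[OF c(1)] b coat(2,3)[OF c(1)] \<iota>c yU] by blast
  hence "?y \<in> V c" using IH[of c ?y] Scoat c(1) nyle by blast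
  then obtain p where p: "p \<in> maxbicliques R" "below p c" "fst p = {i. n i \<bullet> ?y = 0}" "?y \<in> V p"
    using face_of_point[OF coat(1)[OF c(1)]] by blast
  have rkp: "rk p \<le> rk c" using exact_rank_less[OF exact p(1) coat(1)[OF c(1)] p(2)] by (cases "p = c") auto
  \<comment> \<open>Rows active at \<open>?y\<close> are controlled by \<open>c\<close> and at most
    one further coatom, which is in \<open>S\<close> by adjacency: \<open>p\<close> is
    \<open>c\<close> itself or has codimension 2 in \<open>b\<close>, anything smaller being
    excluded by genericity.\<close>
  have "\<exists>c'\<in>S. \<forall>k x. k \<in> fst p \<longrightarrow> k \<notin> fst b \<longrightarrow> x \<in> U b \<longrightarrow> g b k x \<le> max (g b (\<iota> c) x) (g b (\<iota> c') x)"
  proof -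
    consider "rk p = rk c" | "rk p + 1 = rk c" | "rk p + 3 \<le> rk b" using rkp coat(3)[OF c(1)] by linarith
    thus ?thesis
    proof cases
      case 1
      hence "p = c" using exact_rank_less[OF exact p(1) coat(1)[OF c(1)] p(2)] by auto
      hence "\<forall>k x. k \<in> fst p \<longrightarrow> k \<notin> fst b \<longrightarrow> x \<in> U b \<longrightarrow> g b k x \<le> max (g b (\<iota> c) x) (g b (\<iota> c) x)"
        using g_same_coatom[OF coat(1)[OF c(1)] b coat(2,3)[OF c(1)] _ _ \<iota>c] by auto
      thus ?thesis using c(1) by blast
    next
      case 2
      obtain c' where c': "c' \<in> maxbicliques R" "below p c'" "below c' b" "c' \<noteq> c" "rk c' = rk c"
        using diamond[OF p(1) coat(1)[OF c(1)] b p(2) coat(2)[OF c(1)]] 2 coat(3)[OF c(1)] by auto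
      have "c' \<in> coatoms (maxbicliques R) below rk b" using c' coat(3)[OF c(1)] unfolding coatoms_def by auto
      moreover have "rk p + 2 = rk b" using 2 coat(3)[OF c(1)] by simp
      ultimately have c'S: "c' \<in> S" using S(1) c(1) p(1,2) c'(2) unfolding adjacency_closed_def by blast
      have "g b k x \<le> max (g b (\<iota> c) x) (g b (\<iota> c') x)" if "k \<in> fst p" "k \<notin> fst b" "x \<in> U b" for k x
        using g_bound[OF p(1) coat(1)[OF c(1)] c'(1) b p(2) c'(2) coat(2)[OF c(1)] c'(3) 2 coat(3)[OF c(1)] c'(5) c'(4)[symmetric] that(1,2) \<iota>c _ _ that(3)]
          \<iota>[OF c'S] by blast
      thus ?thesis using c'S by blast
    next
      case 3
      let ?T = "span (insert ?base (insert (w b) (U p)))"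
      have TT: "?T \<in> \<T>" using 3 p(1) unfolding \<T>_def by blast
      have "?y \<in> ?T" using p(4) V_U by (intro span_base) blast
      moreover have "m *\<^sub>R w b \<in> ?T" by (intro span_scale span_base) simp
      ultimately have xT: "?x \<in> ?T" using span_diff[of ?y _ "m *\<^sub>R w b"] by simp
      \<comment> \<open>The excluded span contains \<open>?base\<close>. Past the start of the
        segment it would therefore also contain \<open>z'\<close>; at the start the projection is
        \<open>w c0\<close>, whose face has codimension 1 and not 3.\<close>
      show ?thesis
      proof (cases "s = 0")
        case True
        hence "?x = ?base" unfolding f_def by simp
        hence "m \<le> 0" "0 \<le> m" using x0g[OF \<iota>c(2)] c(2)[OF c0] x0c0 unfolding m_def by auto
        hence "?y = ?base" using \<open>?x = ?base\<close> by simp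
        hence "fst p = fst c0" using p(3) inner_w_iff[OF coat(1)[OF c0]] by auto
        hence "p = c0" using face_eqI_fst p(1) coat(1)[OF c0] by blast
        thus ?thesis using 3 coat(3)[OF c0] by simp
      next
        case False
        have "?base \<in> ?T" by (intro span_base) simp
        hence "?base + (1/s) *\<^sub>R (?x - ?base) \<in> ?T" using xT by (intro span_add span_scale span_diff)
        also have "?base + (1/s) *\<^sub>R (?x - ?base) = z'" using False unfolding f_def by simp
        finally show ?thesis using z'(3)[OF TT] by blast
      qed
    qed
  qed
  then obtain c' where c'S: "c' \<in> S"
    and bound: "\<And>k x. k \<in> fst p \<Longrightarrow> k \<notin> fst b \<Longrightarrow> x \<in> U b \<Longrightarrow> g b k x \<le> max (g b (\<iota> c) x) (g b (\<iota> c') x)"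
    by blast
  \<comment> \<open>Rows not containing \<open>p\<close> are strictly dominated by \<open>c\<close>
    at \<open>s\<close>, hence also nearby. Rows containing \<open>b\<close> are exempt, as in
    \<open>D\<close>.\<close>
  define N where "N = (\<Inter>k\<in>- fst p. {t. g b k (f t) < g b (\<iota> c) (f t)} \<union> (if k \<in> fst b then UNIV else {}))"
  have "open N" unfolding N_def
    by (intro open_INT ballI open_Un) (auto intro!: open_Collect_less cf)
  moreover have "s \<in> N"
  proof -
    have "g b k ?x < m" if "k \<notin> fst p" "k \<notin> fst b" for k
      using gm[OF that(2)] ny[OF that(2)] that(1) p(3) by (auto simp: order_le_less)
    thus ?thesis unfolding N_def m_def by auto
  qed
  ultimately obtain \<delta> where \<delta>: "\<delta> > 0" "ball s \<delta> \<subseteq> N" by (meson open_contains_ball)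
  define t where "t = min 1 (s + \<delta> / 2)"
  have t: "s < t" "t \<le> 1" "t \<in> ball s \<delta>" using \<delta> s unfolding t_def by (auto simp: dist_real_def)
  have "\<exists>c\<in>S. g b k (f t) \<le> g b (\<iota> c) (f t)" if k: "k \<notin> fst b" for k
  proof (cases "k \<in> fst p")
    case True
    thus ?thesis using bound[OF True k fU[of t]] c(1) c'S by (auto simp: max_def split: if_splits)
  next
    case False
    hence "g b k (f t) < g b (\<iota> c) (f t)" using t(3) \<delta>(2) k unfolding N_def by (auto dest!: subsetD)
    thus ?thesis using c(1) by (meson less_imp_le)
  qed
  hence "t \<in> E" using t s unfolding E_def D_def by auto
  thus False using smax t by force
qed

lemma coatom_row:
  assumes "c \<in> maxbicliques R" "b \<in> maxbicliques R" "below c b" "rk c + 1 = rk b"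
  shows "\<exists>i. i \<in> fst c \<and> i \<notin> fst b"
  using assms below_fst[of b R c] below_antisym[of c R b] by (metis add_cancel_right_right one_neq_zero subsetI)

lemma coatom_rows:
  assumes "b \<in> maxbicliques R"
  shows "\<exists>\<iota>. \<forall>c\<in>coatoms (maxbicliques R) below rk b. \<iota> c \<in> fst c \<and> \<iota> c \<notin> fst b"
  by (rule bchoice) (use coatom_row[OF _ assms] in \<open>auto simp: coatoms_def\<close>)

text \<open>Induction on rank: the projection of \<open>x\<close> from \<open>w b\<close> satisfies
  all inequalities and lies on a coatom, hence in its cone, and \<open>x\<close> differs from it by
  a nonnegative multiple of \<open>w b\<close>.\<close>

lemma V_eq:
  assumes "b \<in> maxbicliques R" "x \<in> U b" "\<And>i. n i \<bullet> x \<le> 0"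
  shows "x \<in> V b"
  using assms
proof (induction "rk b" arbitrary: b x rule: less_induct)
  case less
  note b = less.prems(1)
  show ?case
  proof (cases "fst b = UNIV")
    case True
    hence "b = face_bot R" using face_eqI_fst[OF b row_face_in] by simp
    hence "x = 0" using less.prems(2) bot unfolding U_def by simp
    thus ?thesis using V_scale[OF w_in_V, of 0 b] by simp
  next
    case False
    then obtain i where i: "i \<notin> fst b" by blast
    \<comment> \<open>The set of all coatoms is trivially closed under adjacency, so the largest
      value of \<open>g\<close> at \<open>x\<close> is attained by a row of a coatom.\<close>
    define S where "S = coatoms (maxbicliques R) below rk b"
    have "face_bot R \<noteq> b" using i by auto
    then obtain c1 where "c1 \<in> maxbicliques R" "below c1 b" "rk c1 + 1 = rk b"
      using faces.exact_rank_cover_down[OF exact row_face_in b face_bot_below[OF b]] by metis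
    hence S: "adjacency_closed (maxbicliques R) below rk b S" "S \<noteq> {}"
      unfolding adjacency_closed_def S_def coatoms_def by blast+
    obtain \<iota> where \<iota>: "\<And>c. c \<in> S \<Longrightarrow> \<iota> c \<in> fst c \<and> \<iota> c \<notin> fst b" 
      using coatom_rows[OF b] unfolding S_def by blast
    have IH: "y \<in> V c" if "c \<in> S" "y \<in> U c" "\<And>i. n i \<bullet> y \<le> 0" for c y
      using less.hyps[of c y] that unfolding S_def coatoms_def by auto
    have dom: "\<exists>c\<in>S. g b k x \<le> g b (\<iota> c) x" if "k \<notin> fst b" for k
      using coatoms_dominate[OF b IH[unfolded S_def] S \<iota> less.prems(2) that] .
    obtain c where c: "c \<in> S" "\<And>c'. c' \<in> S \<Longrightarrow> g b (\<iota> c') x \<le> g b (\<iota> c) x"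
      using finite_arg_max[OF _ S(2), of "\<lambda>c. g b (\<iota> c) x"] by auto
    have cc: "c \<in> maxbicliques R" "below c b" "rk c + 1 = rk b" using c(1) unfolding S_def coatoms_def by blast+
    define m where "m = g b (\<iota> c) x"
    have gm: "g b k x \<le> m" if "k \<notin> fst b" for k
      using dom[OF that] c(2) unfolding m_def by (meson order_trans)
    let ?y = "x + m *\<^sub>R w b"
    have yU: "?y \<in> U b" by (intro subspace_add[OF U_subspace] subspace_scale[OF U_subspace] less.prems w_in_U)
    have ny: "n k \<bullet> ?y = - (n k \<bullet> w b) * (g b k x - m)" if "k \<notin> fst b" for k
      using inner_w_neg[OF b that] unfolding g_def by (simp add: inner_add_right field_simps)
    have nyle: "n k \<bullet> ?y \<le> 0" for k
    proof (cases "k \<in> fst b")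
      case False
      thus ?thesis using ny[OF False] gm[OF False] inner_w_neg[OF b False] by (simp add: mult_nonneg_nonpos mult_nonpos_nonneg mult_nonpos_nonpos)
    qed (simp add: inner_U[OF b _ yU])
    have "n (\<iota> c) \<bullet> ?y = 0" using ny \<iota>[OF c(1)] unfolding m_def by simp
    hence "?y \<in> U c" using coatom_kernel[OF cc(1) b cc(2,3) _ _ yU] \<iota>[OF c(1)] by blast
    hence yV: "?y \<in> V b" using IH[OF c(1) _ nyle] V_mono[OF cc(2)] by blast
    have "m \<le> 0" unfolding m_def using g_nonpos[OF b _ less.prems(3)] \<iota>[OF c(1)] by blast
    hence "- m *\<^sub>R w b \<in> V b" by (intro V_scale w_in_V) simp
    from V_add[OF yV this] show ?thesis by simp
  qed
qed

text \<open>Test domination at \<open>w c'\<close> for a coatom \<open>c'\<close> of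
  \<open>b\<close>: its own row gives the value 0, so the row of some \<open>c\<close> in
  \<open>S\<close> is active there as well. This forces \<open>w c'\<close> into \<open>U c\<close>,
  and then \<open>c' = c\<close>.\<close>

lemma coatoms_connected:
  assumes b: "b \<in> maxbicliques R" and S: "adjacency_closed (maxbicliques R) below rk b S" "S \<noteq> {}"
  shows "S = coatoms (maxbicliques R) below rk b"
proof (rule equalityI)
  show Sc: "S \<subseteq> coatoms (maxbicliques R) below rk b" using S unfolding adjacency_closed_def by blast
  obtain \<iota> where \<iota>: "\<And>c. c \<in> coatoms (maxbicliques R) below rk b \<Longrightarrow> \<iota> c \<in> fst c \<and> \<iota> c \<notin> fst b"
    using coatom_rows[OF b] by blast
  show "coatoms (maxbicliques R) below rk b \<subseteq> S"
  proof
    fix c' assume c': "c' \<in> coatoms (maxbicliques R) below rk b"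
    hence cc': "c' \<in> maxbicliques R" "below c' b" "rk c' + 1 = rk b" unfolding coatoms_def by blast+
    have IH: "y \<in> V c" if "c \<in> coatoms (maxbicliques R) below rk b" "y \<in> U c" "\<And>i. n i \<bullet> y \<le> 0" for c y
      using V_eq that unfolding coatoms_def by blast
    have "\<exists>c\<in>S. g b (\<iota> c') (w c') \<le> g b (\<iota> c) (w c')"
      using coatoms_dominate[OF b IH S _ w_in_U'[OF cc'(2)], of \<iota> "\<iota> c'"] \<iota> c' Sc by blast
    then obtain c where c: "c \<in> S" "g b (\<iota> c') (w c') \<le> g b (\<iota> c) (w c')" by blast
    have cc: "c \<in> maxbicliques R" "below c b" "rk c + 1 = rk b" using c(1) Sc unfolding coatoms_def by blast+
    have ic: "\<iota> c \<in> fst c" "\<iota> c \<notin> fst b" using \<iota> c(1) Sc by blast+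
    have "g b (\<iota> c') (w c') = 0" using \<iota>[OF c'] inner_w_iff[OF cc'(1)] unfolding g_def by simp
    hence "0 \<le> g b (\<iota> c) (w c')" using c(2) by simp
    hence "0 \<le> n (\<iota> c) \<bullet> w c'" using inner_w_neg[OF b ic(2)] unfolding g_def by (simp add: divide_le_0_iff)
    hence "n (\<iota> c) \<bullet> w c' = 0" using inner_w_nonpos by (metis order_antisym)
    hence "w c' \<in> U c" using coatom_kernel[OF cc(1) b cc(2,3) ic w_in_U'[OF cc'(2)]] by blast
    hence "below c' c" using w_in_U_iff[OF cc(1) cc'(1)] by blast
    hence "c' = c" using exact_rank_less[OF exact cc'(1) cc(1)] cc cc' by auto
    thus "c' \<in> S" using c(1) by simp
  qed
qed

end

section \<open>Dual descriptions of a cone\<close>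

lemma push:
  fixes n :: "'i::finite \<Rightarrow> 'a::euclidean_space"
  assumes "\<And>i. i \<notin> A \<Longrightarrow> n i \<bullet> y < 0"
  obtains N where "N > 1" "\<And>i. i \<notin> A \<Longrightarrow> n i \<bullet> (x + N *\<^sub>R y) < 0"
proof -
  \<comment> \<open>The sum bounds every ratio at once, giving one multiple for all rows; the
    summand 2 leaves a strict inequality and makes \<open>N > 1\<close>.\<close>
  define N where "N = 2 + (\<Sum>i\<in>-A. \<bar>n i \<bullet> x\<bar> / - (n i \<bullet> y))"
  have pos: "0 \<le> \<bar>n i \<bullet> x\<bar> / - (n i \<bullet> y)" if "i \<in> -A" for i
    by (rule divide_nonneg_nonneg) (use assms[of i] that in auto)
  have "n i \<bullet> (x + N *\<^sub>R y) < 0" if i: "i \<notin> A" for i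
  proof -
    have neg: "n i \<bullet> y < 0" using assms i by blast
    have "\<bar>n i \<bullet> x\<bar> / - (n i \<bullet> y) \<le> (\<Sum>i\<in>-A. \<bar>n i \<bullet> x\<bar> / - (n i \<bullet> y))"
      using i pos by (intro member_le_sum) auto
    hence "2 + \<bar>n i \<bullet> x\<bar> / - (n i \<bullet> y) \<le> N" unfolding N_def by simp
    hence "N * (n i \<bullet> y) \<le> (2 + \<bar>n i \<bullet> x\<bar> / - (n i \<bullet> y)) * (n i \<bullet> y)"
      using neg by (intro mult_right_mono_neg) auto
    also have "\<dots> = 2 * (n i \<bullet> y) - \<bar>n i \<bullet> x\<bar>" using neg by (simp add: field_simps)
    finally show ?thesis using neg by (simp add: inner_add_right)
  qed
  moreover have "0 \<le> (\<Sum>i\<in>-A. \<bar>n i \<bullet> x\<bar> / - (n i \<bullet> y))" by (rule sum_nonneg) (rule pos)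
  hence "N > 1" unfolding N_def by linarith
  ultimately show ?thesis using that by blast
qed

text \<open>The cone cut out by the normals and the cone generated by the \<open>v j\<close>
  coincide: \<open>nonpos\<close> gives one inclusion and \<open>cone\<close> the other. The other
  assumptions make it pointed and full-dimensional, with nonzero generators.\<close>

locale dual_pair = sign_pattern R n v
  for R :: "('i::finite \<times> 'j::finite) set" and n :: "'i \<Rightarrow> 'a::euclidean_space" and v :: "'j \<Rightarrow> 'a" +
  assumes cone: "\<And>x. (\<And>i. n i \<bullet> x \<le> 0) \<Longrightarrow> x \<in> V (face_top R)"
    and pointed: "\<And>x. (\<And>i. n i \<bullet> x = 0) \<Longrightarrow> x = 0"
    and full: "span (range v) = UNIV"
    and v_nonzero: "v j \<noteq> 0"
begin

lemma cone_iff: "x \<in> V (face_top R) \<longleftrightarrow> (\<forall>i. n i \<bullet> x \<le> 0)"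
  using cone inner_V by blast

lemma snd_bot: "snd (face_bot R) = {}"
proof -
  have "v j = 0" if "j \<in> snd (face_bot R)" for j
    using that zero_iff pointed[of "v j"] by (simp add: row_face_def)
  thus ?thesis using v_nonzero by blast
qed

lemma U_top: "U (face_top R) = UNIV"
  unfolding U_def using full by simp

lemma rk_bot: "rk (face_bot R) = 0"
  unfolding rk_def U_def using snd_bot by simp

lemma rk_top: "rk (face_top R) = DIM('a)"
  unfolding rk_def U_top by (rule dim_UNIV)

lemma face_of_cone_point:
  assumes "\<And>i. n i \<bullet> y \<le> 0"
  obtains p where "p \<in> maxbicliques R" "fst p = {i. n i \<bullet> y = 0}" "y \<in> V p"
  using face_of_point[OF row_face_in cone[OF assms]] by metis

text \<open>A large multiple of \<open>w a\<close> makes all rows outside \<open>fst a\<close>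
  negative without disturbing those that vanish. The sum is then a point of the cone whose face is
  \<open>a\<close>, hence lies in \<open>U a\<close>.\<close>

lemma kernel_face:
  assumes a: "a \<in> maxbicliques R" and x: "\<And>i. i \<in> fst a \<Longrightarrow> n i \<bullet> x = 0"
  shows "x \<in> U a"
proof -
  obtain N where N: "N > 1" "\<And>i. i \<notin> fst a \<Longrightarrow> n i \<bullet> (x + N *\<^sub>R w a) < 0"
    using push[of "fst a" n "w a" x] inner_w_neg[OF a] by blast
  let ?y = "x + N *\<^sub>R w a"
  have z: "n i \<bullet> ?y = 0" if "i \<in> fst a" for i
    using x[OF that] inner_w_iff[OF a] that by (simp add: inner_add_right)
  have "n i \<bullet> ?y \<le> 0" for i using z[of i] N(2)[of i] by (cases "i \<in> fst a") auto
  then obtain p where p: "p \<in> maxbicliques R" "fst p = {i. n i \<bullet> ?y = 0}" "?y \<in> V p"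
    using face_of_cone_point by blast
  have "fst p = fst a" using p(2) z N(2) by force
  hence "p = a" using face_eqI_fst p(1) a by blast
  hence "?y \<in> U a" using p(3) V_U by blast
  from subspace_diff[OF U_subspace this subspace_scale[OF U_subspace w_in_U, of N]] show ?thesis by simp
qed

lemma V_kernel:
  assumes a: "a \<in> maxbicliques R"
  shows "V a = {x \<in> V (face_top R). \<forall>i\<in>fst a. n i \<bullet> x = 0}"
proof (intro equalityI subsetI)
  fix x assume x: "x \<in> V a"
  hence "x \<in> U a" using V_U by blast
  moreover have "x \<in> V (face_top R)" using V_mono[of a "face_top R"] x by auto
  ultimately show "x \<in> {x \<in> V (face_top R). \<forall>i\<in>fst a. n i \<bullet> x = 0}"
    using inner_U[OF a] by simp
next
  fix x assume "x \<in> {x \<in> V (face_top R). \<forall>i\<in>fst a. n i \<bullet> x = 0}"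
  hence x: "\<And>i. n i \<bullet> x \<le> 0" "\<And>i. i \<in> fst a \<Longrightarrow> n i \<bullet> x = 0" using inner_V by blast+
  obtain p where p: "p \<in> maxbicliques R" "fst p = {i. n i \<bullet> x = 0}" "x \<in> V p"
    using face_of_cone_point[OF x(1)] by blast
  hence "below p a" using below_fst[OF p(1) a] x(2) by blast
  thus "x \<in> V a" using V_mono p(3) by blast
qed

text \<open>The faces between \<open>a\<close> and \<open>b\<close> seen in the quotient by \<open>U a\<close>: there the functionals \<open>g b i\<close>
  with \<open>i \<in> fst a - fst b\<close> bound the cone, and the rays leaving \<open>w b\<close> in direction \<open>u\<close> hit the
  boundary where \<open>g b i u\<close> is maximal.\<close>

lemma face_in_direction:
  assumes ab: "a \<in> maxbicliques R" "b \<in> maxbicliques R" "below a b" "a \<noteq> b"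
    and u: "u \<in> U b" "u \<notin> span (insert (w b) (U a))"
  obtains p where "p \<in> maxbicliques R" "below a p" "below p b" "p \<noteq> a" "p \<noteq> b"
    "fst p = fst b \<union> {i \<in> fst a - fst b. \<forall>k\<in>fst a - fst b. g b k u \<le> g b i u}"
proof -
  let ?D = "fst a - fst b"
  have fab: "fst b \<subseteq> fst a" using below_fst ab by blast
  have D: "?D \<noteq> {}" using fab face_eqI_fst[OF ab(1,2)] ab(4) by blast
  obtain i0 where i0: "i0 \<in> ?D" "\<forall>k\<in>?D. g b k u \<le> g b i0 u"
    using finite_arg_max[OF _ D, of "\<lambda>i. g b i u"] by auto
  define \<mu> where "\<mu> = g b i0 u"
  \<comment> \<open>The projection of \<open>u\<close> from \<open>w b\<close>, which makes the
    largest rows in \<open>?D\<close> active. Adding a multiple of \<open>w a\<close> below repairs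
    the rows outside \<open>fst a\<close> and leaves those in \<open>fst a\<close>
    unchanged.\<close>
  define y0 where "y0 = u + \<mu> *\<^sub>R w b"
  obtain N where N: "N > 1" "\<And>i. i \<notin> fst a \<Longrightarrow> n i \<bullet> (y0 + N *\<^sub>R w a) < 0"
    using push[of "fst a" n "w a" y0] inner_w_neg[OF ab(1)] by blast
  let ?y = "y0 + N *\<^sub>R w a"
  have y0U: "y0 \<in> U b" unfolding y0_def
    by (intro subspace_add[OF U_subspace] subspace_scale[OF U_subspace] u w_in_U)
  have yi: "n i \<bullet> ?y = n i \<bullet> y0" if "i \<in> fst a" for i
    using inner_w_iff[OF ab(1), of i] that by (simp add: inner_add_right)
  have y0D: "n i \<bullet> y0 = - (n i \<bullet> w b) * (g b i u - \<mu>)" if "i \<in> ?D" for i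
    using inner_w_neg[OF ab(2), of i] that unfolding g_def y0_def by (simp add: inner_add_right field_simps)
  have y0b: "n i \<bullet> y0 = 0" if "i \<in> fst b" for i using inner_U[OF ab(2) that y0U] .
  have y0le: "n i \<bullet> y0 \<le> 0" if "i \<in> ?D" for i
  proof -
    have "g b i u - \<mu> \<le> 0" using i0 that unfolding \<mu>_def by simp
    moreover have "- (n i \<bullet> w b) \<ge> 0" using inner_w_nonpos by simp
    ultimately show ?thesis unfolding y0D[OF that] by (intro mult_nonneg_nonpos)
  qed
  have "n i \<bullet> ?y \<le> 0" for i
    using N(2)[of i] yi[of i] y0b[of i] y0le[of i] by (cases "i \<in> fst a"; cases "i \<in> fst b") auto
  then obtain p where p: "p \<in> maxbicliques R" "fst p = {i. n i \<bullet> ?y = 0}" "?y \<in> V p"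
    using face_of_cone_point by blast
  have "n i \<bullet> ?y = 0 \<longleftrightarrow> i \<in> fst b \<or> (i \<in> ?D \<and> (\<forall>k\<in>?D. g b k u \<le> g b i u))" for i
  proof -
    consider "i \<in> fst b" | "i \<in> ?D" | "i \<notin> fst a" by blast
    thus ?thesis
    proof cases
      case 1
      thus ?thesis using yi[of i] y0b[of i] fab by auto
    next
      case 2
      have "n i \<bullet> w b \<noteq> 0" using inner_w_neg[OF ab(2), of i] 2 by auto
      hence "n i \<bullet> ?y = 0 \<longleftrightarrow> g b i u = \<mu>" using yi[of i] y0D[OF 2] 2 by auto
      also have "\<dots> \<longleftrightarrow> (\<forall>k\<in>?D. g b k u \<le> g b i u)"
        using i0 2 unfolding \<mu>_def by (metis order_antisym)
      finally show ?thesis using 2 by blast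
    next
      case 3
      thus ?thesis using N(2)[OF 3] fab by auto
    qed
  qed
  hence fp: "fst p = fst b \<union> {i \<in> ?D. \<forall>k\<in>?D. g b k u \<le> g b i u}" unfolding p(2) by blast
  have "below p b" using fp below_fst[OF p(1) ab(2)] by blast
  moreover have "below a p" using fp below_fst[OF ab(1) p(1)] fab by blast
  moreover have "p \<noteq> b" using fp i0 by blast
  \<comment> \<open>If the carrier were \<open>a\<close>, then \<open>y0\<close> would lie in
    \<open>U a\<close> and \<open>u\<close> in the excluded span.\<close>
  moreover have "p \<noteq> a"
  proof
    assume "p = a"
    hence "n i \<bullet> y0 = 0" if "i \<in> fst a" for i using p(2) yi[OF that] that by auto
    hence "y0 \<in> U a" by (rule kernel_face[OF ab(1)])
    hence "y0 \<in> span (insert (w b) (U a))" by (simp add: span_base)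
    moreover have "\<mu> *\<^sub>R w b \<in> span (insert (w b) (U a))" by (simp add: span_base span_scale)
    ultimately have "u \<in> span (insert (w b) (U a))" using span_diff[of y0 _ "\<mu> *\<^sub>R w b"] unfolding y0_def by simp
    with u show False by blast
  qed
  ultimately show ?thesis using that p(1) fp by blast
qed

lemma direction_exists:
  assumes "rk a + 1 < rk b"
  obtains u where "u \<in> U b" "u \<notin> span (insert (w b) (U a))"
proof -
  have "dim (span (insert (w b) (U a))) < dim (U b)"
    using assms unfolding rk_def by (simp add: dim_insert)
  hence "\<not> U b \<subseteq> span (insert (w b) (U a))" using dim_subset[of "U b"] by (metis not_le)
  with that show ?thesis by blast
qed

lemma exact_rk: "exact_rank (maxbicliques R) below rk"
  unfolding exact_rank_def
proof (intro ballI impI conjI)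
  fix a b assume ab: "a \<in> maxbicliques R" "b \<in> maxbicliques R" "below a b \<and> a \<noteq> b"
  thus "rk a < rk b" using rk_less by blast
  assume "rk a + 1 < rk b"
  then obtain u where "u \<in> U b" "u \<notin> span (insert (w b) (U a))" by (rule direction_exists)
  then obtain p where "p \<in> maxbicliques R" "below a p" "below p b" "p \<noteq> a" "p \<noteq> b"
    by (rule face_in_direction[OF ab(1,2) conjunct1[OF ab(3)] conjunct2[OF ab(3)]]) (rule that)
  thus "\<exists>c\<in>maxbicliques R. below a c \<and> c \<noteq> a \<and> below c b \<and> c \<noteq> b" by blast
qed

text \<open>The directions \<open>u\<close> and \<open>- u\<close> give the two boundary rays of a
  plane cone. For any other face \<open>c\<close>, write \<open>w c\<close> modulo
  \<open>U a\<close> as \<open>t\<close> times \<open>u\<close> plus \<open>s\<close> times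
  \<open>w b\<close>: the sign of \<open>t\<close> decides whether its rows maximise or minimise
  \<open>g b i u\<close>, which identifies \<open>c\<close> with one of the two rays;
  \<open>t = 0\<close> would put \<open>c\<close> below \<open>a\<close>.\<close>

lemma interval_card:
  assumes ab: "a \<in> maxbicliques R" "b \<in> maxbicliques R" "below a b" and rk: "rk b = rk a + 2"
  shows "card (faces_between R a b) = 4"
proof -
  have neq: "a \<noteq> b" using rk by auto
  let ?D = "fst a - fst b"
  let ?S = "span (insert (w b) (U a))"
  obtain u where u: "u \<in> U b" "u \<notin> ?S" using direction_exists[of a b] rk by auto
  hence mu: "- u \<in> U b" "- u \<notin> ?S" using subspace_neg[OF U_subspace] span_neg[of "- u" "insert (w b) (U a)"] by auto
  obtain p where p: "p \<in> maxbicliques R" "below a p" "below p b" "p \<noteq> a" "p \<noteq> b"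
    "fst p = fst b \<union> {i \<in> ?D. \<forall>k\<in>?D. g b k u \<le> g b i u}" using face_in_direction[OF ab neq u] .
  obtain q where q: "q \<in> maxbicliques R" "below a q" "below q b" "q \<noteq> a" "q \<noteq> b"
    "fst q = fst b \<union> {i \<in> ?D. \<forall>k\<in>?D. g b k (- u) \<le> g b i (- u)}" using face_in_direction[OF ab neq mu] .
  have gm: "g b k (- u) = - g b k u" for k unfolding g_def by simp
  have fab: "fst b \<subseteq> fst a" using below_fst ab by blast
  have "p \<noteq> q"
  proof
    assume "p = q"
    have "fst p \<noteq> fst b" using face_eqI_fst p(1,5) ab(2) by blast
    then obtain i where i: "i \<in> ?D" "i \<in> fst p" using p(6) by blast
    hence i2: "\<forall>k\<in>?D. g b k u \<le> g b i u" "\<forall>k\<in>?D. g b i u \<le> g b k u"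
      using p(6) q(6) \<open>p = q\<close> gm by auto
    hence "\<forall>k\<in>?D. g b k u = g b i u" by (meson order_antisym)
    hence "fst p = fst a" using p(6) fab by auto
    thus False using face_eqI_fst p(1,4) ab(1) by blast
  qed
  have "c \<in> {a, b, p, q}" if c: "c \<in> faces_between R a b" for c
  proof (rule ccontr)
    assume nc: "c \<notin> {a, b, p, q}"
    have cX: "c \<in> maxbicliques R" "below a c" "below c b" using c by blast+
    have Sb: "?S \<subseteq> U b" using w_in_U[of b] U_mono[OF ab(3)] by (intro span_minimal[OF _ U_subspace]) blast
    have wbS: "w b \<notin> U a" using w_in_U_iff[OF ab(1,2)] below_antisym ab neq by blast
    have spU: "span (U a) = U a" using U_subspace by (simp add: span_eq_iff)
    hence "w b \<notin> span (U a)" using wbS by metis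
    hence "dim ?S = rk a + 1" unfolding rk_def by (simp add: dim_insert)
    hence "dim (U b) \<le> dim ?S + 1" using rk unfolding rk_def by simp
    then obtain t where t: "w c - t *\<^sub>R u \<in> ?S"
      using one_dim_extension[OF _ U_subspace Sb _ u w_in_U'[OF cX(3)]] by (metis subspace_span)
    then obtain s where s: "w c - t *\<^sub>R u - s *\<^sub>R w b \<in> U a"
      using span_breakdown_eq[of "w c - t *\<^sub>R u" "w b" "U a"] spU by auto
    have ev: "n i \<bullet> w c = t * (n i \<bullet> u) + s * (n i \<bullet> w b)" if "i \<in> fst a" for i
      using inner_U[OF ab(1) that s] by (simp add: inner_diff_right)
    have ev': "n i \<bullet> w c = - (n i \<bullet> w b) * (t * g b i u - s)" if "i \<in> ?D" for i
      using ev[of i] that inner_w_neg[OF ab(2), of i] unfolding g_def by (simp add: field_simps)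
    have le: "t * g b i u \<le> s" if "i \<in> ?D" for i
    proof -
      have "n i \<bullet> w b < 0" using inner_w_neg[OF ab(2), of i] that by blast
      thus ?thesis using ev'[OF that] inner_w_nonpos[of i c] by (simp add: mult_le_0_iff zero_le_mult_iff)
    qed
    have eq: "i \<in> fst c \<longleftrightarrow> t * g b i u = s" if "i \<in> ?D" for i
    proof -
      have "n i \<bullet> w b < 0" using inner_w_neg[OF ab(2), of i] that by blast
      thus ?thesis using ev'[OF that] inner_w_iff[OF cX(1), of i] by auto
    qed
    have fc: "fst b \<subseteq> fst c" "fst c \<subseteq> fst a" using below_fst cX ab by blast+
    have "fst c \<noteq> fst b" using face_eqI_fst cX(1) ab(2) nc by blast
    then obtain i0 where i0: "i0 \<in> ?D" "i0 \<in> fst c" using fc by blast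
    have ti0: "t * g b i0 u = s" using eq i0 by blast
    have fceq: "fst c = fst b \<union> {i \<in> ?D. t * g b i u = s}" using eq fc by blast
    consider "t = 0" | "t > 0" | "t < 0" by linarith
    thus False
    proof cases
      case 1
      hence "s = 0" using ti0 by simp
      hence "w c \<in> U a" using s 1 by simp
      hence "below c a" using w_in_U_iff[OF ab(1) cX(1)] by blast
      thus False using below_antisym[OF cX(1) ab(1)] cX nc by blast
    next
      case 2
      have "t * g b i u = s \<longleftrightarrow> (\<forall>k\<in>?D. g b k u \<le> g b i u)" if "i \<in> ?D" for i
      proof
        assume "t * g b i u = s"
        thus "\<forall>k\<in>?D. g b k u \<le> g b i u" using le 2 by (metis mult_le_cancel_left_pos)
      next
        assume "\<forall>k\<in>?D. g b k u \<le> g b i u"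
        hence "t * g b i0 u \<le> t * g b i u" using i0 2 by simp
        thus "t * g b i u = s" using ti0 le[OF that] by simp
      qed
      hence "fst c = fst p" unfolding fceq p(6) by blast
      thus False using face_eqI_fst cX(1) p(1) nc by blast
    next
      case 3
      have "t * g b i u = s \<longleftrightarrow> (\<forall>k\<in>?D. g b k (- u) \<le> g b i (- u))" if "i \<in> ?D" for i
      proof
        assume "t * g b i u = s"
        thus "\<forall>k\<in>?D. g b k (- u) \<le> g b i (- u)" using le 3 unfolding gm by (metis mult_le_cancel_left_neg neg_le_iff_le)
      next
        assume "\<forall>k\<in>?D. g b k (- u) \<le> g b i (- u)"
        hence "t * g b i0 u \<le> t * g b i u" using i0 3 unfolding gm by simp
        thus "t * g b i u = s" using ti0 le[OF that] by simp
      qed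
      hence "fst c = fst q" unfolding fceq q(6) by blast
      thus False using face_eqI_fst cX(1) q(1) nc by blast
    qed
  qed
  hence "faces_between R a b = {a, b, p, q}" using ab p(1-3) q(1-3) by blast
  thus ?thesis using neq p(4,5) q(4,5) \<open>p \<noteq> q\<close> by (simp add: card_insert_if)
qed

sublocale ranked_faces R rk
  by unfold_locales (rule exact_rk | rule rk_bot | rule row_face_in | erule face_bot_below | simp)+

lemma diamond_rank: "diamond_rank R rk"
  unfolding diamond_rank_def using interval_card by blast

sublocale ranked_sign_pattern R n v
proof
  show "snd (face_bot R) = {}" by (rule snd_bot)
  show "exact_rank (maxbicliques R) below rk" by (rule exact_rk)
  show "\<exists>c'\<in>maxbicliques R. below e c' \<and> below c' b \<and> c' \<noteq> c \<and> rk c' = rk c"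
    if "e \<in> maxbicliques R" "c \<in> maxbicliques R" "b \<in> maxbicliques R"
      "below e c" "below c b" "rk c = rk e + 1" "rk b = rk c + 1" for e c b
    using diamond_other[OF diamond_rank that] by metis
qed

text \<open>Connectivity as an induction principle over flags. It serves both for walks in the flag
  graph and for comparing an arbitrary bipartition with signs of determinants.\<close>

lemma flag_graph_closed:
  assumes "T \<subseteq> flags (maxbiclique_lattice R)" "T \<noteq> {}"
    and "\<And>F F'. F \<in> T \<Longrightarrow> F' \<in> flags (maxbiclique_lattice R) \<Longrightarrow> card (F - F') = 1 \<Longrightarrow> card (F' - F) = 1 \<Longrightarrow> F' \<in> T"
  shows "T = flags (maxbiclique_lattice R)"
proof -
  obtain F where F: "F \<in> T" using assms by blast
  have "F' \<in> T" if F': "F' \<in> flags (maxbiclique_lattice R)" for F'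
  proof (rule flags_connected[of T F F'])
    show "flag F'" using F' unfolding flags_iff .
    show "flag F" if "F \<in> T" for F using that assms(1) flags_iff by blast
    show "F2 \<in> T" if "F1 \<in> T" "flag F2" "card (F1 - F2) = 1" "card (F2 - F1) = 1" for F1 F2
      using assms(3)[OF that(1) _ that(3,4)] that(2) flags_iff by blast
  qed (rule coatoms_connected, assumption+, rule F)
  with assms show ?thesis by blast
qed

lemma connected_flag_graph: "Digraph_Component.connected (with_proj (flag_graph (maxbiclique_lattice R)))"
proof -
  let ?F = "flags (maxbiclique_lattice R)"
  let ?G = "mk_symmetric (with_proj (flag_graph (maxbiclique_lattice R)))"
  have vG: "pverts ?G = ?F" by (simp add: flag_graph_def)
  have ne: "?F \<noteq> {}" using faces.maxchain_exists flags_iff by blast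
  have "x \<rightarrow>\<^sup>*\<^bsub>with_proj ?G\<^esub> y" if x: "x \<in> ?F" and y: "y \<in> ?F" for x y
  proof -
    let ?T = "{y \<in> ?F. x \<rightarrow>\<^sup>*\<^bsub>with_proj ?G\<^esub> y}"
    have "x \<in> ?T" using x vG unfolding reachable_def by simp
    moreover have "F' \<in> ?T" if F: "F \<in> ?T" "F' \<in> ?F" "card (F - F') = 1" "card (F' - F) = 1" for F F'
    proof -
      have "(F, F') \<in> parcs ?G" using F unfolding parcs_mk_symmetric by (force simp: flag_graph_def)
      thus ?thesis using F vG unfolding reachable_def by (auto intro: rtrancl_on_into_rtrancl_on)
    qed
    ultimately have "?T = ?F" by (intro flag_graph_closed) blast+
    thus ?thesis using y by blast
  qed
  thus ?thesis unfolding connected_def strongly_connected_def using vG ne by simp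
qed

lemma lattice_facts:
  shows "diamond_lattice (maxbiclique_lattice R)" "rank_of (maxbiclique_lattice R) = DIM('a)"
  using diamond_lattice_iff diamond_rank rank_of_lattice rk_top by auto

lemma meet_irr: "meet_irreducibles (maxbiclique_lattice R) = {a\<in>maxbicliques R. rk a + 1 = DIM('a)}"
  and join_irr: "join_irreducibles (maxbiclique_lattice R) = {a\<in>maxbicliques R. rk a = 1}"
  using meet_irreducibles_eq[OF diamond_rank] join_irreducibles_eq[OF diamond_rank] rk_top by auto

section \<open>Faces of the cone in the sense of convex geometry\<close>

lemma convex_V: "convex (V p)"
  by (rule convexI) (intro V_add V_scale)

lemma zero_in_V: "0 \<in> V p"
  using V_scale[OF w_in_V, of 0 p] by simp

lemma span_V: "span (V p) = U p"
proof
  show "span (V p) \<subseteq> U p" by (rule span_minimal[OF V_U U_subspace])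
  show "U p \<subseteq> span (V p)" unfolding U_def by (intro span_mono) (auto intro: v_in_V)
qed

lemma aff_dim_V: "aff_dim (V p) = int (rk p)"
proof -
  have "aff_dim (V p) = int (dim (V p))" by (intro aff_dim_zero hull_inc zero_in_V)
  also have "dim (V p) = dim (U p)" using span_V[of p] dim_span[of "V p"] by simp
  finally show ?thesis by (simp add: rk_def)
qed

lemma V_subset_iff: "a \<in> maxbicliques R \<Longrightarrow> b \<in> maxbicliques R \<Longrightarrow> V a \<subseteq> V b \<longleftrightarrow> below a b"
  using V_mono[of a b] w_in_V[of a] V_U[of b] w_in_U_iff[of b a] by blast

lemma V_inj: "inj_on V (maxbicliques R)"
  by (rule inj_onI) (metis V_subset_iff below_antisym order_refl)

lemma V_face:
  assumes a: "a \<in> maxbicliques R"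
  shows "V a face_of V (face_top R)"
  unfolding face_of_def
proof (intro conjI ballI impI)
  show "V a \<subseteq> V (face_top R)" by (rule V_mono) simp
  show "convex (V a)" by (rule convex_V)
  fix x y p assume xy: "x \<in> V (face_top R)" "y \<in> V (face_top R)" "p \<in> V a" "p \<in> open_segment x y"
  then obtain t where t: "0 < t" "t < 1" "p = (1 - t) *\<^sub>R x + t *\<^sub>R y" by (auto simp: in_segment)
  have "n i \<bullet> x = 0 \<and> n i \<bullet> y = 0" if "i \<in> fst a" for i
  proof -
    have "(1 - t) * (n i \<bullet> x) + t * (n i \<bullet> y) = 0"
      using V_kernel[OF a] xy(3) that by (auto simp: t(3) inner_add_right)
    moreover have "(1 - t) * (n i \<bullet> x) \<le> 0" "t * (n i \<bullet> y) \<le> 0"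
      using t by (auto intro!: mult_nonneg_nonpos inner_V[OF xy(1)] inner_V[OF xy(2)])
    ultimately have "(1 - t) * (n i \<bullet> x) = 0" "t * (n i \<bullet> y) = 0" by linarith+
    thus ?thesis using t by simp
  qed
  thus "x \<in> V a" "y \<in> V a" using V_kernel[OF a] xy by blast+
qed

text \<open>A relative interior point \<open>x\<close> of \<open>F\<close> determines
  \<open>a\<close> by its active rows. A segment from any point of \<open>F\<close> extends beyond
  \<open>x\<close> within \<open>F\<close>, which makes the same rows active at that point.
  Conversely, each point of \<open>V a\<close> is one end of a segment of the cone with
  \<open>x\<close> inside, so the face property applies.\<close>

lemma face_V:
  assumes F: "F face_of V (face_top R)" "F \<noteq> {}"
  obtains a where "a \<in> maxbicliques R" "F = V a"
proof -
  have cF: "convex F" "F \<subseteq> V (face_top R)" using F face_of_imp_convex face_of_imp_subset by blast+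
  obtain x where x: "x \<in> rel_interior F" using rel_interior_eq_empty[OF cF(1)] F by blast
  hence xF: "x \<in> F" using rel_interior_subset by blast
  obtain a where a: "a \<in> maxbicliques R" "fst a = {i. n i \<bullet> x = 0}" "x \<in> V a"
    using face_of_cone_point[of x] inner_V xF cF by blast
  have "F \<subseteq> V a"
  proof
    fix y assume y: "y \<in> F"
    obtain e where e: "e > 1" "(1 - e) *\<^sub>R y + e *\<^sub>R x \<in> F"
      using x y convex_rel_interior_iff[OF cF(1) F(2)] by blast
    have "n i \<bullet> y = 0" if "i \<in> fst a" for i
    proof -
      have "(1 - e) * (n i \<bullet> y) \<le> 0"
        using inner_V[of "(1 - e) *\<^sub>R y + e *\<^sub>R x" "face_top R" i] e cF that a(2) by (auto simp: inner_add_right)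
      hence "0 \<le> n i \<bullet> y" using e by (simp add: mult_le_0_iff)
      thus ?thesis using inner_V[of y "face_top R" i] y cF by force
    qed
    thus "y \<in> V a" using V_kernel[OF a(1)] y cF by blast
  qed
  moreover have "V a \<subseteq> F"
  proof
    fix y assume y: "y \<in> V a"
    have "n i \<bullet> x < 0" if "i \<notin> fst a" for i
      using that a(2) inner_V[OF a(3), of i] by (simp add: order_le_less)
    then obtain N where N: "N > 1" "\<And>i. i \<notin> fst a \<Longrightarrow> n i \<bullet> (- y + N *\<^sub>R x) < 0"
      using push[of "fst a" n x "- y"] by blast
    \<comment> \<open>A point beyond \<open>x\<close> on the line from \<open>y\<close>, placed so
      that \<open>x\<close> has weights \<open>1 - 1/N\<close> at \<open>z\<close> and
      \<open>1/N\<close> at \<open>y\<close>.\<close>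
    define z where "z = (1 / (N - 1)) *\<^sub>R (- y + N *\<^sub>R x)"
    have "n i \<bullet> (- y + N *\<^sub>R x) \<le> 0" for i
      using N(2)[of i] a(2) V_kernel[OF a(1)] y by (cases "i \<in> fst a") (auto simp: inner_diff_right)
    hence z: "z \<in> V (face_top R)" unfolding z_def using N by (intro V_scale cone) auto
    have xz: "x = (1 - 1/N) *\<^sub>R z + (1/N) *\<^sub>R y"
      unfolding z_def using N by (simp add: algebra_simps divide_simps)
    show "y \<in> F"
    proof (cases "z = y")
      case True
      hence "x = y" using xz by (simp add: scaleR_add_left[symmetric])
      thus ?thesis using xF by simp
    next
      case False
      hence "x \<in> open_segment z y" unfolding in_segment using xz N by (auto intro!: exI[of _ "1/N"])
      moreover have "y \<in> V (face_top R)" using V_mono[of a "face_top R"] y by auto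
      ultimately show ?thesis using F(1) z xF unfolding face_of_def by blast
    qed
  qed
  ultimately show ?thesis using that a by blast
qed

lemma facets_eq: "{F. F facet_of V (face_top R)} = V ` {a\<in>maxbicliques R. rk a + 1 = DIM('a)}"
proof -
  have "F facet_of V (face_top R) \<longleftrightarrow> (\<exists>a\<in>maxbicliques R. F = V a \<and> rk a + 1 = DIM('a))" for F
  proof
    assume "F facet_of V (face_top R)"
    hence F: "F face_of V (face_top R)" "F \<noteq> {}" "aff_dim F = aff_dim (V (face_top R)) - 1" unfolding facet_of_def by auto
    obtain a where "a \<in> maxbicliques R" "F = V a" using face_V[OF F(1,2)] .
    with F(3) show "\<exists>a\<in>maxbicliques R. F = V a \<and> rk a + 1 = DIM('a)" by (auto simp: aff_dim_V rk_top)
  next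
    assume "\<exists>a\<in>maxbicliques R. F = V a \<and> rk a + 1 = DIM('a)"
    then obtain a where a: "a \<in> maxbicliques R" "F = V a" "rk a + 1 = DIM('a)" by blast
    have "V a \<noteq> {}" using zero_in_V[of a] by blast
    thus "F facet_of V (face_top R)" unfolding facet_of_def
      using V_face[OF a(1)] a by (simp add: aff_dim_V rk_top)
  qed
  thus ?thesis by auto
qed

lemma edges_eq: "{F. F edge_of V (face_top R)} = V ` {a\<in>maxbicliques R. rk a = 1}"
proof -
  have "F edge_of V (face_top R) \<longleftrightarrow> (\<exists>a\<in>maxbicliques R. F = V a \<and> rk a = 1)" for F
  proof
    assume "F edge_of V (face_top R)"
    hence F: "F face_of V (face_top R)" "aff_dim F = 1" unfolding edge_of_def by auto
    have "F \<noteq> {}" using F(2) by auto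
    then obtain a where "a \<in> maxbicliques R" "F = V a" using face_V[OF F(1)] by blast
    with F(2) show "\<exists>a\<in>maxbicliques R. F = V a \<and> rk a = 1" by (auto simp: aff_dim_V)
  next
    assume "\<exists>a\<in>maxbicliques R. F = V a \<and> rk a = 1"
    thus "F edge_of V (face_top R)" unfolding edge_of_def
      using V_face by (auto simp: aff_dim_V)
  qed
  thus ?thesis by auto
qed

lemma facets_bij: "bij_betw V (meet_irreducibles (maxbiclique_lattice R)) {F. F facet_of V (face_top R)}"
  and edges_bij: "bij_betw V (join_irreducibles (maxbiclique_lattice R)) {F. F edge_of V (face_top R)}"
  unfolding facets_eq edges_eq meet_irr join_irr bij_betw_def
  using inj_on_subset[OF V_inj] by auto

end

section \<open>Symmetric matrices and their signature\<close>

lemma symmetric_inner: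
  fixes A :: "real^'n^'n"
  assumes "Finite_Cartesian_Product.transpose A = A"
  shows "x \<bullet> (A *v y) = (A *v x) \<bullet> y"
  using dot_lmul_matrix[of x A y] transpose_matrix_vector[of A x] assms by simp

lemma quadratic_nonpos_imp_zero:
  assumes "\<And>t::real. 2 * t * a + t\<^sup>2 * b \<le> 0"
  shows "a = 0"
proof (rule ccontr)
  assume "a \<noteq> 0"
  define c where "c = \<bar>b\<bar> + 1"
  have c: "c > 0" "2 * c + b > 0" unfolding c_def by auto
  \<comment> \<open>At \<open>t = a / c\<close> the linear term outweighs the quadratic one, because
    \<open>2 * c + b\<close> is positive.\<close>
  have "2 * (a / c) * a + (a / c)\<^sup>2 * b = a\<^sup>2 * (2 * c + b) / c\<^sup>2"
    using c by (simp add: field_simps power2_eq_square)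
  also have "\<dots> > 0" using c \<open>a \<noteq> 0\<close> by simp
  finally show False using assms[of "a / c"] by simp
qed

text \<open>A maximiser \<open>x\<close> of the Rayleigh quotient on the unit sphere of
  \<open>S\<close> works: moving it along the defect \<open>d\<close>, which lies in
  \<open>S\<close> by invariance, would otherwise increase the quotient to first order.\<close>

lemma symmetric_eigenvector:
  fixes A :: "real^'n^'n"
  assumes A: "Finite_Cartesian_Product.transpose A = A" and S: "Real_Vector_Spaces.subspace S"
    and inv: "\<And>x. x \<in> S \<Longrightarrow> A *v x \<in> S" and "S \<noteq> {0}"
  obtains x l where "x \<in> S" "norm x = 1" "A *v x = l *\<^sub>R x"
proof -
  let ?K = "S \<inter> sphere 0 1"
  have "compact ?K" using S by (intro closed_Int_compact closed_subspace compact_sphere)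
  moreover have "?K \<noteq> {}"
  proof -
    obtain y where "y \<in> S" "y \<noteq> 0" using \<open>S \<noteq> {0}\<close> subspace_0[OF S] by blast
    hence "(1 / norm y) *\<^sub>R y \<in> ?K" using S by (auto simp: subspace_scale)
    thus ?thesis by blast
  qed
  moreover have "continuous_on ?K (\<lambda>x. x \<bullet> (A *v x))"
    by (intro continuous_intros linear_continuous_on matrix_vector_mul_bounded_linear)
  ultimately obtain x where x: "x \<in> ?K" "\<And>y. y \<in> ?K \<Longrightarrow> y \<bullet> (A *v y) \<le> x \<bullet> (A *v x)"
    using continuous_attains_sup[of ?K "\<lambda>x. x \<bullet> (A *v x)"] by blast
  define l where "l = x \<bullet> (A *v x)"
  have xx: "x \<in> S" "norm x = 1" "x \<bullet> x = 1" using x(1) by (auto simp: norm_eq_1)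
  have le: "y \<bullet> (A *v y) \<le> l * (y \<bullet> y)" if "y \<in> S" for y
  proof (cases "y = 0")
    case False
    let ?y = "(1 / norm y) *\<^sub>R y"
    have "?y \<in> ?K" using that False S by (auto simp: subspace_scale)
    hence "?y \<bullet> (A *v ?y) \<le> l" unfolding l_def by (rule x(2))
    also have "?y \<bullet> (A *v ?y) = (y \<bullet> (A *v y)) / (y \<bullet> y)"
      by (simp add: matrix_vector_mult_scaleR dot_square_norm power2_eq_square)
    finally show ?thesis using False by (simp add: divide_le_eq)
  qed simp
  define d where "d = A *v x - l *\<^sub>R x"
  have dS: "d \<in> S" unfolding d_def using xx inv S by (intro subspace_diff subspace_scale) auto
  have "2 * t * (d \<bullet> d) + t\<^sup>2 * (d \<bullet> (A *v d) - l * (d \<bullet> d)) \<le> 0" for t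
  proof -
    have "x + t *\<^sub>R d \<in> S" using xx dS S by (intro subspace_add subspace_scale)
    from le[OF this]
    have "l + t * (x \<bullet> (A *v d) + d \<bullet> (A *v x)) + t\<^sup>2 * (d \<bullet> (A *v d)) \<le> l * (1 + 2 * t * (d \<bullet> x) + t\<^sup>2 * (d \<bullet> d))"
      using xx(3) by (simp add: matrix_vector_right_distrib matrix_vector_mult_scaleR inner_add_left inner_add_right
        l_def[symmetric] power2_eq_square algebra_simps inner_commute)
    moreover have "x \<bullet> (A *v d) = d \<bullet> (A *v x)" using symmetric_inner[OF A] by (simp add: inner_commute)
    moreover have "d \<bullet> (A *v x) = d \<bullet> d + l * (d \<bullet> x)"
      by (simp add: d_def inner_diff_right inner_diff_left inner_commute algebra_simps)
    ultimately show ?thesis by (simp add: algebra_simps)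
  qed
  from quadratic_nonpos_imp_zero[OF this] have "d = 0" by simp
  hence "A *v x = l *\<^sub>R x" unfolding d_def by simp
  with that xx show ?thesis by blast
qed

section \<open>Orthonormal eigenbases and the law of inertia\<close>

definition eigenbasis :: "real^'n^'n \<Rightarrow> (real^'n) set \<Rightarrow> (real^'n \<Rightarrow> real) \<Rightarrow> bool" where
  "eigenbasis A B lam \<longleftrightarrow> finite B \<and> span B = UNIV \<and> (\<forall>b\<in>B. b \<bullet> b = 1) \<and>
     (\<forall>b\<in>B. \<forall>c\<in>B. b \<noteq> c \<longrightarrow> b \<bullet> c = 0) \<and> (\<forall>b\<in>B. A *v b = lam b *\<^sub>R b)"

text \<open>Split off one eigenvector; symmetry keeps its orthogonal complement in \<open>S\<close>
  invariant.\<close>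

lemma symmetric_invariant_eigenbasis:
  fixes A :: "real^'n^'n"
  assumes A: "Finite_Cartesian_Product.transpose A = A" and S: "Real_Vector_Spaces.subspace S"
    and inv: "\<And>x. x \<in> S \<Longrightarrow> A *v x \<in> S"
  shows "\<exists>B. finite B \<and> B \<subseteq> S \<and> S \<subseteq> span B \<and> (\<forall>b\<in>B. b \<bullet> b = 1) \<and>
     (\<forall>b\<in>B. \<forall>c\<in>B. b \<noteq> c \<longrightarrow> b \<bullet> c = 0) \<and> (\<forall>b\<in>B. \<exists>l. A *v b = l *\<^sub>R b)"
  using S inv
proof (induction "dim S" arbitrary: S rule: less_induct)
  case less
  show ?case
  proof (cases "S = {0}")
    case True
    thus ?thesis by (intro exI[of _ "{}"]) auto
  next
    case False
    obtain x l where x: "x \<in> S" "norm x = 1" "A *v x = l *\<^sub>R x"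
      using symmetric_eigenvector[OF A less.prems False] by blast
    have xx: "x \<bullet> x = 1" using x(2) by (simp add: norm_eq_1)
    define S' where "S' = S \<inter> {y. x \<bullet> y = 0}"
    have sS': "Real_Vector_Spaces.subspace S'" unfolding S'_def by (intro subspace_inter less.prems subspace_hyperplane)
    have "x \<notin> S'" unfolding S'_def using xx by simp
    hence "S' \<subset> S" using x(1) unfolding S'_def by blast
    hence "dim S' < dim S" using dim_psubset[of S' S] sS' less.prems(1) by (simp add: span_eq_iff[THEN iffD2])
    moreover have "A *v y \<in> S'" if "y \<in> S'" for y
      using that less.prems(2) symmetric_inner[OF A, of x y] x(3) unfolding S'_def by simp
    ultimately obtain B where B: "finite B" "B \<subseteq> S'" "S' \<subseteq> span B" "\<forall>b\<in>B. b \<bullet> b = 1"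
      "\<forall>b\<in>B. \<forall>c\<in>B. b \<noteq> c \<longrightarrow> b \<bullet> c = 0" "\<forall>b\<in>B. \<exists>l. A *v b = l *\<^sub>R b"
      using less.hyps[OF _ sS'] by blast
    have "S \<subseteq> span (insert x B)"
    proof
      fix y assume y: "y \<in> S"
      have "y - (x \<bullet> y) *\<^sub>R x \<in> S'" unfolding S'_def using y x(1) xx less.prems(1)
        by (auto simp: inner_diff_right intro!: subspace_diff subspace_scale)
      hence "y - (x \<bullet> y) *\<^sub>R x \<in> span B" using B(3) by blast
      thus "y \<in> span (insert x B)" using span_breakdown_eq by blast
    qed
    moreover have "\<forall>b\<in>B. x \<bullet> b = 0" using B(2) unfolding S'_def by blast
    moreover have "insert x B \<subseteq> S" using B(2) x(1) unfolding S'_def by blast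
    ultimately show ?thesis using B x xx
      by (intro exI[of _ "insert x B"]) (auto simp: inner_commute)
  qed
qed

lemma eigenbasis_exists:
  fixes A :: "real^'n^'n"
  assumes "Finite_Cartesian_Product.transpose A = A"
  obtains B lam where "eigenbasis A B lam"
proof -
  have "\<exists>B. finite B \<and> B \<subseteq> UNIV \<and> UNIV \<subseteq> span B \<and> (\<forall>b\<in>B. b \<bullet> b = 1) \<and>
     (\<forall>b\<in>B. \<forall>c\<in>B. b \<noteq> c \<longrightarrow> b \<bullet> c = 0) \<and> (\<forall>b\<in>B. \<exists>l. A *v b = l *\<^sub>R b)"
    by (rule symmetric_invariant_eigenbasis[OF assms subspace_UNIV]) simp
  then obtain B where B: "finite B" "UNIV \<subseteq> span B" "\<forall>b\<in>B. b \<bullet> b = 1"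
      "\<forall>b\<in>B. \<forall>c\<in>B. b \<noteq> c \<longrightarrow> b \<bullet> c = 0" "\<forall>b\<in>B. \<exists>l. A *v b = l *\<^sub>R b"
    by (elim exE conjE)
  from B(5) obtain lam where "\<forall>b\<in>B. A *v b = lam b *\<^sub>R b" by metis
  with B that[of B lam] show ?thesis unfolding eigenbasis_def by blast
qed

context
  fixes A :: "real^'n^'n" and B lam
  assumes eb: "eigenbasis A B lam"
begin

lemma eb_finite: "finite B" using eb unfolding eigenbasis_def by blast
lemma eb_span: "span B = UNIV" using eb unfolding eigenbasis_def by blast
lemma eb_inner: "b \<in> B \<Longrightarrow> c \<in> B \<Longrightarrow> b \<bullet> c = (if b = c then 1 else 0)" using eb unfolding eigenbasis_def by auto
lemma eb_eig: "b \<in> B \<Longrightarrow> A *v b = lam b *\<^sub>R b" using eb unfolding eigenbasis_def by blast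

lemma eb_independent: "C \<subseteq> B \<Longrightarrow> independent C"
proof (rule pairwise_orthogonal_independent)
  assume C: "C \<subseteq> B"
  thus "pairwise Linear_Algebra.orthogonal C" unfolding pairwise_def Linear_Algebra.orthogonal_def using eb_inner by (auto simp: subset_iff)
  show "0 \<notin> C"
  proof
    assume "0 \<in> C"
    hence "(0::real^'n) \<bullet> 0 = 1" using C eb_inner[of 0 0] by auto
    thus False by simp
  qed
qed

lemma eb_card: "card B = CARD('n)"
  using dim_span_eq_card_independent[OF eb_independent[OF order_refl]] eb_span by simp

lemma eb_expand: "x = (\<Sum>b\<in>B. (x \<bullet> b) *\<^sub>R b)"
proof -
  let ?y = "x - (\<Sum>b\<in>B. (x \<bullet> b) *\<^sub>R b)"
  have "Linear_Algebra.orthogonal ?y c" if "c \<in> B" for c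
  proof -
    have "(\<Sum>b\<in>B. (x \<bullet> b) * (b \<bullet> c)) = (\<Sum>b\<in>B. if b = c then x \<bullet> b else 0)"
      using that eb_inner by (intro sum.cong) auto
    also have "\<dots> = x \<bullet> c" using that eb_finite by simp
    finally show ?thesis by (simp add: Linear_Algebra.orthogonal_def inner_diff_left inner_sum_left)
  qed
  hence "Linear_Algebra.orthogonal ?y ?y" using orthogonal_to_span[of ?y B ?y] eb_span by blast
  thus ?thesis by (simp add: orthogonal_self)
qed

lemma eb_mult: "A *v x = (\<Sum>b\<in>B. (lam b * (x \<bullet> b)) *\<^sub>R b)"
proof -
  have "A *v x = A *v (\<Sum>b\<in>B. (x \<bullet> b) *\<^sub>R b)" using eb_expand by metis
  also have "\<dots> = (\<Sum>b\<in>B. A *v ((x \<bullet> b) *\<^sub>R b))"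
    by (rule linear_sum[OF matrix_vector_mul_linear])
  also have "\<dots> = (\<Sum>b\<in>B. (lam b * (x \<bullet> b)) *\<^sub>R b)"
    by (rule sum.cong) (auto simp: matrix_vector_mult_scaleR eb_eig)
  finally show ?thesis .
qed

lemma eb_form: "x \<bullet> (A *v y) = (\<Sum>b\<in>B. lam b * (x \<bullet> b) * (y \<bullet> b))"
  unfolding eb_mult[of y] by (simp add: inner_sum_right algebra_simps)

lemma eb_in_span:
  assumes "\<And>b. b \<in> B \<Longrightarrow> b \<notin> C \<Longrightarrow> x \<bullet> b = 0"
  shows "x \<in> span (B \<inter> C)"
proof -
  have "x = (\<Sum>b\<in>B. (x \<bullet> b) *\<^sub>R b)" by (rule eb_expand)
  also have "\<dots> = (\<Sum>b\<in>B\<inter>C. (x \<bullet> b) *\<^sub>R b)"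
    using eb_finite assms by (intro sum.mono_neutral_right) auto
  also have "\<dots> \<in> span (B \<inter> C)" by (intro span_sum span_scale span_base)
  finally show ?thesis .
qed

lemma eb_span_inner:
  assumes "x \<in> span (B \<inter> C)" "b \<in> B" "b \<notin> C"
  shows "x \<bullet> b = 0"
proof -
  have "Linear_Algebra.orthogonal b x"
    by (rule orthogonal_to_span[OF assms(1)]) (use eb_inner assms in \<open>auto simp: Linear_Algebra.orthogonal_def\<close>)
  thus ?thesis by (simp add: Linear_Algebra.orthogonal_def inner_commute)
qed

lemma eb_eigenspace: "eigenspace A l = span (B \<inter> {b. lam b = l})"
proof (intro equalityI subsetI)
  fix x assume "x \<in> eigenspace A l"
  hence e: "A *v x = l *\<^sub>R x" unfolding eigenspace_def by simp
  show "x \<in> span (B \<inter> {b. lam b = l})"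
  proof (rule eb_in_span)
    fix b assume b: "b \<in> B" "b \<notin> {b. lam b = l}"
    have "(A *v x) \<bullet> b = lam b * (x \<bullet> b)"
      unfolding eb_mult using b(1) eb_finite
      by (simp add: inner_sum_left eb_inner if_distrib cong: if_cong)
    hence "lam b * (x \<bullet> b) = l * (x \<bullet> b)" using e by auto
    thus "x \<bullet> b = 0" using b by auto
  qed
next
  fix x assume x: "x \<in> span (B \<inter> {b. lam b = l})"
  have "A *v x = (\<Sum>b\<in>B. (lam b * (x \<bullet> b)) *\<^sub>R b)" by (rule eb_mult)
  also have "\<dots> = (\<Sum>b\<in>B. l *\<^sub>R ((x \<bullet> b) *\<^sub>R b))"
    using eb_span_inner[OF x] by (intro sum.cong) auto
  also have "\<dots> = l *\<^sub>R x" unfolding scaleR_sum_right[symmetric] using eb_expand by metis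
  finally show "x \<in> eigenspace A l" unfolding eigenspace_def by simp
qed

lemma eb_dim_eigenspace: "dim (eigenspace A l) = card (B \<inter> {b. lam b = l})"
  unfolding eb_eigenspace by (intro dim_span_eq_card_independent eb_independent) blast

lemma eb_signature_aux:
  "(\<Sum>l | P l \<and> eigenspace A l \<noteq> {0}. dim (eigenspace A l)) = card {b\<in>B. P (lam b)}"
proof -
  let ?C = "{b\<in>B. P (lam b)}"
  have ne: "eigenspace A l \<noteq> {0} \<longleftrightarrow> (\<exists>b\<in>B. lam b = l)" for l
  proof
    assume "eigenspace A l \<noteq> {0}"
    hence "B \<inter> {b. lam b = l} \<noteq> {}" unfolding eb_eigenspace by (metis span_empty)
    thus "\<exists>b\<in>B. lam b = l" by blast
  next
    assume "\<exists>b\<in>B. lam b = l"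
    then obtain b where b: "b \<in> B" "lam b = l" by blast
    hence "b \<in> eigenspace A l" unfolding eigenspace_def using eb_eig by simp
    moreover have "b \<noteq> 0" using eb_inner[OF b(1) b(1)] by auto
    ultimately show "eigenspace A l \<noteq> {0}" by blast
  qed
  have "{l. P l \<and> eigenspace A l \<noteq> {0}} = lam ` ?C" unfolding ne by auto
  hence "(\<Sum>l | P l \<and> eigenspace A l \<noteq> {0}. dim (eigenspace A l)) = (\<Sum>l\<in>lam ` ?C. card (B \<inter> {b. lam b = l}))"
    by (simp add: eb_dim_eigenspace)
  also have "\<dots> = (\<Sum>l\<in>lam ` ?C. sum (\<lambda>_. 1) {b\<in>?C. lam b = l})"
    by (intro sum.cong refl) (auto intro!: arg_cong[where f=card])
  also have "\<dots> = sum (\<lambda>_. 1) ?C" using eb_finite by (intro sum.image_gen[symmetric]) simp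
  finally show ?thesis by simp
qed

lemma eb_signature: "signature A = (card {b\<in>B. 0 < lam b}, card {b\<in>B. lam b < 0})"
  unfolding signature_def using eb_signature_aux[of "\<lambda>l. l > 0"] eb_signature_aux[of "\<lambda>l. l < 0"] by simp

text \<open>The sign \<open>s\<close> is 1 or -1, so as to treat both halves of the signature at once.\<close>

lemma definite_subspace_exists:
  obtains W where "Real_Vector_Spaces.subspace W" "dim W = card {b\<in>B. 0 < s * lam b}"
    "\<And>x. x \<in> W \<Longrightarrow> x \<noteq> 0 \<Longrightarrow> 0 < s * (x \<bullet> (A *v x))"
proof -
  let ?C = "{b. 0 < s * lam b}"
  let ?W = "span (B \<inter> ?C)"
  have se: "B \<inter> ?C = {b\<in>B. 0 < s * lam b}" by blast
  have d: "dim ?W = card {b\<in>B. 0 < s * lam b}"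
    unfolding se[symmetric] by (intro dim_span_eq_card_independent eb_independent) blast
  have "0 < s * (x \<bullet> (A *v x))" if x: "x \<in> ?W" "x \<noteq> 0" for x
  proof -
    have e: "s * (x \<bullet> (A *v x)) = (\<Sum>b\<in>B. s * lam b * (x \<bullet> b)\<^sup>2)"
      unfolding eb_form by (simp add: sum_distrib_left power2_eq_square mult.assoc)
    have nn: "0 \<le> s * lam b * (x \<bullet> b)\<^sup>2" if "b \<in> B" for b
      using eb_span_inner[OF x(1) that] by (cases "b \<in> ?C") auto
    have "\<exists>b\<in>B. x \<bullet> b \<noteq> 0"
    proof (rule ccontr)
      assume "\<not> (\<exists>b\<in>B. x \<bullet> b \<noteq> 0)"
      hence "(\<Sum>b\<in>B. (x \<bullet> b) *\<^sub>R b) = 0" by (intro sum.neutral) auto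
      with eb_expand[of x] x(2) show False by simp
    qed
    then obtain b where b: "b \<in> B" "x \<bullet> b \<noteq> 0" by blast
    hence "b \<in> ?C" using eb_span_inner[OF x(1)] by blast
    hence "0 < s * lam b * (x \<bullet> b)\<^sup>2" using b by simp
    thus ?thesis unfolding e using b(1) nn eb_finite by (intro sum_pos2[of B b]) auto
  qed
  with that[OF _ d] show ?thesis by (metis subspace_span)
qed

text \<open>\<open>W\<close> meets the span of the remaining eigenvectors, on which the form is
  nonpositive after multiplication by \<open>s\<close>, only in 0. Comparing dimensions bounds
  \<open>dim W\<close>.\<close>

lemma definite_subspace_le:
  assumes W: "Real_Vector_Spaces.subspace W" "\<And>x. x \<in> W \<Longrightarrow> x \<noteq> 0 \<Longrightarrow> 0 < s * (x \<bullet> (A *v x))"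
  shows "dim W \<le> card {b\<in>B. 0 < s * lam b}"
proof -
  let ?C = "{b. \<not> 0 < s * lam b}"
  let ?N = "span (B \<inter> ?C)"
  have "s * (x \<bullet> (A *v x)) \<le> 0" if x: "x \<in> ?N" for x
  proof -
    have e: "s * (x \<bullet> (A *v x)) = (\<Sum>b\<in>B. s * lam b * (x \<bullet> b)\<^sup>2)"
      unfolding eb_form by (simp add: sum_distrib_left power2_eq_square mult.assoc)
    have "s * lam b * (x \<bullet> b)\<^sup>2 \<le> 0" if "b \<in> B" for b
      using eb_span_inner[OF x that] by (cases "b \<in> ?C") (auto simp: mult_nonpos_nonneg)
    thus ?thesis unfolding e by (rule sum_nonpos)
  qed
  hence "W \<inter> ?N \<subseteq> {0}" using W(2) by force
  hence "dim (W \<inter> ?N) = 0" by simp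
  moreover have "dim {x + y |x y. x \<in> W \<and> y \<in> ?N} + dim (W \<inter> ?N) = dim W + dim ?N"
    by (intro dim_sums_Int W subspace_span)
  moreover have "dim {x + y |x y. x \<in> W \<and> y \<in> ?N} \<le> CARD('n)"
    using dim_subset_UNIV[of "{x + y |x y. x \<in> W \<and> y \<in> ?N}"] by simp
  moreover have "dim ?N = card (B \<inter> ?C)" by (intro dim_span_eq_card_independent eb_independent) blast
  moreover have "card B = card (B \<inter> ?C) + card {b\<in>B. 0 < s * lam b}"
    using eb_finite by (subst card_Un_disjoint[symmetric]) (auto intro!: arg_cong[where f=card])
  ultimately show ?thesis using eb_card by linarith
qed

end

text \<open>Sylvester's law of inertia for a surjection that may have a kernel: definite subspaces
  embed under \<open>T\<close>, as they meet its kernel only in 0, and they lift back along a linear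
  right inverse.\<close>

lemma signature_pullback:
  fixes G :: "real^'i^'i" and \<Phi> :: "real^'n^'n" and T :: "real^'i \<Rightarrow> real^'n"
  assumes sym: "Finite_Cartesian_Product.transpose G = G" "Finite_Cartesian_Product.transpose \<Phi> = \<Phi>"
    and T: "linear T" "surj T" and q: "\<And>x. x \<bullet> (G *v x) = T x \<bullet> (\<Phi> *v T x)"
  shows "signature G = signature \<Phi>"
proof -
  obtain B lam where B: "eigenbasis G B lam" using eigenbasis_exists[OF sym(1)] .
  obtain C mu where C: "eigenbasis \<Phi> C mu" using eigenbasis_exists[OF sym(2)] .
  have eq: "card {b\<in>B. 0 < s * lam b} = card {b\<in>C. 0 < s * mu b}" for s :: real
  proof (rule antisym)
    obtain W where W: "Real_Vector_Spaces.subspace W" "dim W = card {b\<in>B. 0 < s * lam b}"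
      "\<And>x. x \<in> W \<Longrightarrow> x \<noteq> 0 \<Longrightarrow> 0 < s * (x \<bullet> (G *v x))"
      using definite_subspace_exists[OF B] by blast
    have n0: "T x \<noteq> 0" if "x \<in> W" "x \<noteq> 0" for x
      using W(3)[OF that] q[of x] by auto
    have "inj_on T W"
      using n0 by (subst linear_injective_on_subspace_0[OF T(1) W(1)]) blast
    hence "dim (T ` W) = dim W" using W(1) T(1) by (intro dim_image_eq) (auto simp: span_eq_iff[THEN iffD2])
    moreover have "dim (T ` W) \<le> card {b\<in>C. 0 < s * mu b}"
    proof (rule definite_subspace_le[OF C])
      show "Real_Vector_Spaces.subspace (T ` W)" using linear_subspace_image[OF T(1) W(1)] .
      fix y assume "y \<in> T ` W" "y \<noteq> 0"
      then obtain x where "x \<in> W" "y = T x" "x \<noteq> 0" using linear_0[OF T(1)] by auto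
      thus "0 < s * (y \<bullet> (\<Phi> *v y))" using W(3) q by simp
    qed
    ultimately show "card {b\<in>B. 0 < s * lam b} \<le> card {b\<in>C. 0 < s * mu b}" using W(2) by simp
    obtain g where g: "linear g" "T \<circ> g = id" using linear_surjective_right_inverse[OF T] by blast
    have Tg: "T (g x) = x" for x using g(2) by (metis comp_apply id_apply)
    obtain W where W: "Real_Vector_Spaces.subspace W" "dim W = card {b\<in>C. 0 < s * mu b}"
      "\<And>x. x \<in> W \<Longrightarrow> x \<noteq> 0 \<Longrightarrow> 0 < s * (x \<bullet> (\<Phi> *v x))"
      using definite_subspace_exists[OF C] by blast
    have "inj g" using Tg by (metis injI)
    hence "dim (g ` W) = dim W" using g(1) by (intro dim_image_eq) (auto intro: inj_on_subset)
    moreover have "dim (g ` W) \<le> card {b\<in>B. 0 < s * lam b}"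
    proof (rule definite_subspace_le[OF B])
      show "Real_Vector_Spaces.subspace (g ` W)" using linear_subspace_image[OF g(1) W(1)] .
      fix y assume "y \<in> g ` W" "y \<noteq> 0"
      then obtain x where "x \<in> W" "y = g x" "x \<noteq> 0" using linear_0[OF g(1)] by auto
      thus "0 < s * (y \<bullet> (G *v y))" using W(3) q Tg by simp
    qed
    ultimately show "card {b\<in>C. 0 < s * mu b} \<le> card {b\<in>B. 0 < s * lam b}" using W(2) by simp
  qed
  show ?thesis unfolding eb_signature[OF B] eb_signature[OF C] using eq[of 1] eq[of "-1"] by simp
qed

text \<open>Nondegeneracy excludes the eigenvalue 0 of \<open>\<Phi>\<close>, so equal signatures
  pair its eigenvectors with those of \<open>G\<close> for nonzero eigenvalues of the same sign.
  Rescaling each pair turns the spectral decomposition of \<open>G\<close> into a factorization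
  through \<open>\<Phi>\<close>.\<close>

lemma gram_vectors_exist:
  fixes G :: "real^'i^'i" and \<Phi> :: "real^'n^'n"
  assumes sym: "Finite_Cartesian_Product.transpose G = G" "Finite_Cartesian_Product.transpose \<Phi> = \<Phi>"
    and nd: "\<And>x. (\<And>y. form \<Phi> x y = 0) \<Longrightarrow> x = 0" and sig: "signature G = signature \<Phi>"
  obtains h :: "'i \<Rightarrow> real^'n" where "\<And>i k. form \<Phi> (h i) (h k) = G $ i $ k" "span (range h) = UNIV"
proof -
  obtain B lam where B: "eigenbasis G B lam" using eigenbasis_exists[OF sym(1)] .
  obtain C mu where C: "eigenbasis \<Phi> C mu" using eigenbasis_exists[OF sym(2)] .
  have fin: "finite B" "finite C" using eb_finite B C by blast+
  have nz: "mu c \<noteq> 0" if "c \<in> C" for c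
  proof
    assume "mu c = 0"
    hence "\<Phi> *v c = 0" using eb_eig[OF C that] by simp
    hence "form \<Phi> c y = 0" for y using symmetric_inner[OF sym(2)] unfolding form_def by simp
    hence "c = 0" using nd by blast
    thus False using eb_inner[OF C that that] by simp
  qed
  have card: "card {b\<in>C. 0 < mu b} = card {b\<in>B. 0 < lam b}" "card {b\<in>C. mu b < 0} = card {b\<in>B. lam b < 0}"
    using sig unfolding eb_signature[OF B] eb_signature[OF C] by simp_all
  obtain \<sigma>1 where s1: "bij_betw \<sigma>1 {b\<in>C. 0 < mu b} {b\<in>B. 0 < lam b}"
    using card(1) fin finite_same_card_bij[of "{b\<in>C. 0 < mu b}" "{b\<in>B. 0 < lam b}"] by auto
  obtain \<sigma>2 where s2: "bij_betw \<sigma>2 {b\<in>C. mu b < 0} {b\<in>B. lam b < 0}"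
    using card(2) fin finite_same_card_bij[of "{b\<in>C. mu b < 0}" "{b\<in>B. lam b < 0}"] by auto
  define \<sigma> where "\<sigma> c = (if 0 < mu c then \<sigma>1 c else \<sigma>2 c)" for c
  have "bij_betw \<sigma> ({b\<in>C. 0 < mu b} \<union> {b\<in>C. mu b < 0}) ({b\<in>B. 0 < lam b} \<union> {b\<in>B. lam b < 0})"
  proof (rule bij_betw_combine)
    show "bij_betw \<sigma> {b\<in>C. 0 < mu b} {b\<in>B. 0 < lam b}"
      using s1 by (rule bij_betw_cong[THEN iffD1, rotated]) (simp add: \<sigma>_def)
    show "bij_betw \<sigma> {b\<in>C. mu b < 0} {b\<in>B. lam b < 0}"
      using s2 by (rule bij_betw_cong[THEN iffD1, rotated]) (simp add: \<sigma>_def)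
  qed auto
  moreover have "{b\<in>C. 0 < mu b} \<union> {b\<in>C. mu b < 0} = C" using nz by force
  moreover have "{b\<in>B. 0 < lam b} \<union> {b\<in>B. lam b < 0} = {b\<in>B. lam b \<noteq> 0}" by auto
  ultimately have \<sigma>: "bij_betw \<sigma> C {b\<in>B. lam b \<noteq> 0}" by simp
  have pos: "0 < lam (\<sigma> c) / mu c" if "c \<in> C" for c
  proof (cases "0 < mu c")
    case True
    hence "0 < lam (\<sigma> c)" using bij_betwE[OF s1] that by (auto simp: \<sigma>_def)
    thus ?thesis using True by simp
  next
    case False
    hence "mu c < 0" using nz[OF that] by simp
    moreover from this have "lam (\<sigma> c) < 0" using bij_betwE[OF s2] that False by (auto simp: \<sigma>_def)
    ultimately show ?thesis by (simp add: divide_neg_neg)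
  qed
  \<comment> \<open>The scale that turns the eigenvalue \<open>mu c\<close> into
    \<open>lam (\<sigma> c)\<close>; the quotient is positive because the signs match.\<close>
  define k where "k c = sqrt (lam (\<sigma> c) / mu c)" for c
  have k: "k c * k c * mu c = lam (\<sigma> c)" "k c \<noteq> 0" if "c \<in> C" for c
  proof -
    have "k c * k c = lam (\<sigma> c) / mu c" using pos[OF that] by (simp only: k_def real_sqrt_mult_self abs_of_pos)
    thus "k c * k c * mu c = lam (\<sigma> c)" using nz[OF that] by simp
    show "k c \<noteq> 0" using pos[OF that] unfolding k_def by auto
  qed
  define h where "h i = (\<Sum>c\<in>C. (k c * (\<sigma> c $ i)) *\<^sub>R c)" for i :: 'i
  have hc: "h i \<bullet> c = k c * (\<sigma> c $ i)" if "c \<in> C" for i c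
  proof -
    have "h i \<bullet> c = (\<Sum>c'\<in>C. k c' * (\<sigma> c' $ i) * (c' \<bullet> c))" unfolding h_def by (simp add: inner_sum_left)
    also have "\<dots> = (\<Sum>c'\<in>C. if c' = c then k c' * (\<sigma> c' $ i) else 0)"
      using that eb_inner[OF C] by (intro sum.cong) auto
    finally show ?thesis using that fin by simp
  qed
  have "form \<Phi> (h i) (h l) = G $ i $ l" for i l
  proof -
    have "form \<Phi> (h i) (h l) = (\<Sum>c\<in>C. mu c * (h i \<bullet> c) * (h l \<bullet> c))"
      unfolding form_def by (rule eb_form[OF C])
    also have "\<dots> = (\<Sum>c\<in>C. lam (\<sigma> c) * (\<sigma> c $ i) * (\<sigma> c $ l))"
    proof (rule sum.cong[OF refl])
      fix c assume c: "c \<in> C"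
      have "mu c * (h i \<bullet> c) * (h l \<bullet> c) = (k c * k c * mu c) * (\<sigma> c $ i) * (\<sigma> c $ l)"
        unfolding hc[OF c] by (simp add: algebra_simps)
      thus "mu c * (h i \<bullet> c) * (h l \<bullet> c) = lam (\<sigma> c) * (\<sigma> c $ i) * (\<sigma> c $ l)" unfolding k(1)[OF c] .
    qed
    also have "\<dots> = (\<Sum>b | b \<in> B \<and> lam b \<noteq> 0. lam b * (b $ i) * (b $ l))"
      by (rule sum.reindex_bij_betw[OF \<sigma>])
    also have "\<dots> = (\<Sum>b\<in>B. lam b * (b $ i) * (b $ l))"
      using fin by (intro sum.mono_neutral_left) auto
    also have "\<dots> = axis i 1 \<bullet> (G *v axis l 1)"
      unfolding eb_form[OF B] by (simp add: inner_axis inner_commute[of "axis _ _"])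
    also have "\<dots> = G $ i $ l" by (simp add: matrix_vector_mul_component inner_axis inner_commute[of "axis _ _"])
    finally show ?thesis .
  qed
  \<comment> \<open>Weighting the \<open>h i\<close> with the coordinates of
    \<open>\<sigma> c\<close> isolates a multiple of \<open>c\<close>, by orthonormality of the
    eigenvectors of \<open>G\<close>.\<close>
  moreover have "c \<in> span (range h)" if "c \<in> C" for c
  proof -
    have "(\<Sum>i\<in>UNIV. (\<sigma> c $ i) *\<^sub>R h i) = (\<Sum>i\<in>UNIV. \<Sum>c'\<in>C. ((\<sigma> c $ i) * (k c' * (\<sigma> c' $ i))) *\<^sub>R c')"
      unfolding h_def by (simp add: scaleR_sum_right)
    also have "\<dots> = (\<Sum>c'\<in>C. \<Sum>i\<in>UNIV. ((\<sigma> c $ i) * (k c' * (\<sigma> c' $ i))) *\<^sub>R c')" by (rule sum.swap)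
    also have "\<dots> = (\<Sum>c'\<in>C. (k c' * (\<sigma> c \<bullet> \<sigma> c')) *\<^sub>R c')"
      by (simp add: inner_vec_def sum_distrib_left scaleR_sum_left[symmetric] algebra_simps)
    also have "\<dots> = (\<Sum>c'\<in>C. if c' = c then k c' *\<^sub>R c' else 0)"
    proof (rule sum.cong[OF refl])
      fix c' assume c': "c' \<in> C"
      have "\<sigma> c \<in> B" "\<sigma> c' \<in> B" using bij_betwE[OF \<sigma>] c' that by blast+
      moreover have "\<sigma> c = \<sigma> c' \<longleftrightarrow> c = c'" using \<sigma> c' that unfolding bij_betw_def inj_on_def by blast
      ultimately show "(k c' * (\<sigma> c \<bullet> \<sigma> c')) *\<^sub>R c' = (if c' = c then k c' *\<^sub>R c' else 0)"
        using eb_inner[OF B] by auto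
    qed
    also have "\<dots> = k c *\<^sub>R c" using that fin by simp
    finally have "k c *\<^sub>R c \<in> span (range h)"
      by (metis (no_types, lifting) span_sum span_scale span_base rangeI)
    from span_scale[OF this, of "1 / k c"] k(2)[OF that] show ?thesis by simp
  qed
  hence "span C \<subseteq> span (range h)" by (intro span_minimal) auto
  hence "span (range h) = UNIV" using eb_span[OF C] by blast
  ultimately show ?thesis using that by blast
qed

section \<open>Submatrices\<close>

text \<open>The two determinants sum over permutations of an initial segment and of the index type;
  conjugation by \<open>en\<close> matches the permutations and keeps their signs. Any enumeration
  serves, since rows and columns are permuted alike.\<close>

lemma det_bridge:
  fixes M :: "real^'n^'n"
  assumes en: "bij_betw en {0..<CARD('n)} (UNIV :: 'n set)"
  shows "Determinant.det (Matrix.mat CARD('n) CARD('n) (\<lambda>(a, b). M $ en a $ en b)) = Determinants.det M"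
proof -
  let ?N = "{0..<CARD('n)}"
  let ?iv = "inv_into ?N en"
  have inj: "inj_on en ?N" and im: "en ` ?N = UNIV" using en unfolding bij_betw_def by blast+
  let ?m = "\<lambda>p x. if x \<in> (UNIV::'n set) then en (p (?iv x)) else x"
  have bp: "bij_betw ?m {p. p permutes ?N} {p. p permutes UNIV}" by (rule bij_betw_permutations[OF en])
  have "Determinants.det M = (\<Sum>p | p permutes UNIV. of_int (sign p) * (\<Prod>i\<in>UNIV. M $ i $ p i))"
    unfolding Determinants.det_def by simp
  also have "\<dots> = (\<Sum>p | p permutes ?N. of_int (sign (?m p)) * (\<Prod>i\<in>UNIV. M $ i $ ?m p i))"
    by (rule sum.reindex_bij_betw[OF bp, symmetric])
  also have "\<dots> = (\<Sum>p | p permutes ?N. of_int (sign p) * (\<Prod>a = 0..<CARD('n). M $ en a $ en (p a)))"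
  proof (rule sum.cong[OF refl])
    fix p assume p: "p \<in> {p. p permutes ?N}"
    have "map_permutation ?N en p = ?m p"
      unfolding map_permutation_def restrict_id_def using im by (auto simp: fun_eq_iff)
    hence s: "sign (?m p) = sign p" using sign_map_permutation[OF inj, of p] p by simp
    have "(\<Prod>i\<in>UNIV. M $ i $ ?m p i) = (\<Prod>a\<in>?N. M $ en a $ ?m p (en a))"
      by (rule prod.reindex_bij_betw[OF en, symmetric])
    also have "\<dots> = (\<Prod>a\<in>?N. M $ en a $ en (p a))"
      by (rule prod.cong) (auto simp: inv_into_f_f[OF inj])
    finally show "of_int (sign (?m p)) * (\<Prod>i\<in>UNIV. M $ i $ ?m p i) = of_int (sign p) * (\<Prod>a = 0..<CARD('n). M $ en a $ en (p a))"
      using s by simp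
  qed
  also have "\<dots> = Determinant.det (Matrix.mat CARD('n) CARD('n) (\<lambda>(a, b). M $ en a $ en b))"
    unfolding Determinant.det_def
    by (auto intro!: sum.cong prod.cong simp: permutes_in_image[of _ ?N] dest: permutes_in_image)
  finally show ?thesis by simp
qed

text \<open>Padding with zeros outside \<open>is\<close> moves the columns, whose length varies with
  the list, into a fixed Euclidean space where dimension arguments apply. It preserves independence,
  and the rank is the size of a maximal independent set of columns.\<close>

lemma rank_submatrix:
  fixes G :: "real^'i^'i" and "is" :: "'i list"
  assumes d: "distinct is"
  shows "vec_space.rank (length is) (submatrix_of G is is) =
    dim ((\<lambda>k. \<chi> i. if i \<in> set is then G $ i $ k else 0) ` set is)"
proof -
  let ?n = "length is"
  let ?A = "submatrix_of G is is"
  interpret vs: vec_space "TYPE(real)" ?n .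
  have A: "?A \<in> carrier_mat ?n ?n" unfolding submatrix_of_def by simp
  define \<psi> :: "real Matrix.vec \<Rightarrow> real^'i" where
    "\<psi> x = (\<chi> i. if i \<in> set is then vec_index x (THE a. a < ?n \<and> is ! a = i) else 0)" for x
  have the: "(THE a. a < ?n \<and> is ! a = is ! b) = b" if "b < ?n" for b
    using d that by (intro the_equality) (auto simp: nth_eq_iff_index_eq)
  have \<psi>n: "\<psi> x $ (is ! b) = vec_index x b" if "b < ?n" for x b
    using that the unfolding \<psi>_def by simp
  have \<psi>0: "\<psi> x $ i = 0" if "i \<notin> set is" for x i using that unfolding \<psi>_def by simp
  have \<psi>eq: "y = z \<longleftrightarrow> (\<forall>b<?n. y $ (is ! b) = z $ (is ! b))" if "\<And>i. i \<notin> set is \<Longrightarrow> y $ i = z $ i" for y z :: "real^'i"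
  proof
    assume e: "\<forall>b<?n. y $ (is ! b) = z $ (is ! b)"
    have "y $ i = z $ i" for i
    proof (cases "i \<in> set is")
      case True
      then obtain b where "b < ?n" "is ! b = i" by (auto simp: in_set_conv_nth)
      thus ?thesis using e by blast
    qed (rule that)
    thus "y = z" by (simp add: Finite_Cartesian_Product.vec_eq_iff)
  qed simp
  have inj: "inj_on \<psi> (carrier_vec ?n)"
    by (rule inj_onI, rule eq_vecI) (use \<psi>n in \<open>auto, metis\<close>)
  have comb: "(\<Sum>x\<in>S. u x *\<^sub>R \<psi> x) = 0 \<longleftrightarrow> vs.lincomb u S = 0\<^sub>v ?n" if S: "S \<subseteq> carrier_vec ?n" for u S
  proof -
    have "(\<Sum>x\<in>S. u x *\<^sub>R \<psi> x) = 0 \<longleftrightarrow> (\<forall>b<?n. (\<Sum>x\<in>S. u x * vec_index x b) = 0)"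
      by (subst \<psi>eq) (auto simp: \<psi>0 \<psi>n)
    also have "\<dots> \<longleftrightarrow> (\<forall>b<?n. vec_index (vs.lincomb u S) b = 0)"
      using vs.lincomb_index[OF _ S] by simp
    also have "\<dots> \<longleftrightarrow> vs.lincomb u S = 0\<^sub>v ?n"
      using vs.lincomb_dim[of S u] S by (auto intro!: eq_vecI)
    finally show ?thesis .
  qed
  have indep: "vs.lin_indpt S \<longleftrightarrow> independent (\<psi> ` S)" if S: "S \<subseteq> carrier_vec ?n" "finite S" for S
  proof -
    have i: "inj_on \<psi> S" using inj S inj_on_subset by blast
    have "independent (\<psi> ` S) \<longleftrightarrow> (\<forall>u. (\<Sum>x\<in>S. u (\<psi> x) *\<^sub>R \<psi> x) = 0 \<longrightarrow> (\<forall>x\<in>S. u (\<psi> x) = 0))"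
      unfolding independent_explicit using S i by (simp add: sum.reindex)
    also have "\<dots> \<longleftrightarrow> (\<forall>u. (\<Sum>x\<in>S. u x *\<^sub>R \<psi> x) = 0 \<longrightarrow> (\<forall>x\<in>S. u x = 0))"
    proof (intro iffI allI impI)
      fix u :: "real Matrix.vec \<Rightarrow> real"
      assume h: "\<forall>u. (\<Sum>x\<in>S. u (\<psi> x) *\<^sub>R \<psi> x) = 0 \<longrightarrow> (\<forall>x\<in>S. u (\<psi> x) = 0)" and z: "(\<Sum>x\<in>S. u x *\<^sub>R \<psi> x) = 0"
      have e: "u (inv_into S \<psi> (\<psi> x)) = u x" if "x \<in> S" for x using i that by simp
      have "(\<Sum>x\<in>S. (u \<circ> inv_into S \<psi>) (\<psi> x) *\<^sub>R \<psi> x) = 0"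
        using z e by (simp cong: sum.cong)
      with h have "\<forall>x\<in>S. (u \<circ> inv_into S \<psi>) (\<psi> x) = 0" by blast
      thus "\<forall>x\<in>S. u x = 0" using e by simp
    next
      fix u assume h: "\<forall>u. (\<Sum>x\<in>S. u x *\<^sub>R \<psi> x) = 0 \<longrightarrow> (\<forall>x\<in>S. u x = 0)" "(\<Sum>x\<in>S. u (\<psi> x) *\<^sub>R \<psi> x) = 0"
      thus "\<forall>x\<in>S. u (\<psi> x) = 0" using h(1)[rule_format, of "u \<circ> \<psi>"] by simp
    qed
    also have "\<dots> \<longleftrightarrow> (\<forall>u. vs.lincomb u S = 0\<^sub>v ?n \<longrightarrow> (\<forall>x\<in>S. u x = 0))"
      using comb[OF S(1)] by simp
    also have "\<dots> \<longleftrightarrow> vs.lin_indpt S"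
    proof
      assume "\<forall>u. vs.lincomb u S = 0\<^sub>v ?n \<longrightarrow> (\<forall>x\<in>S. u x = 0)"
      thus "vs.lin_indpt S" using S by (intro vs.finite_lin_indpt2) auto
    next
      assume l: "vs.lin_indpt S"
      show "\<forall>u. vs.lincomb u S = 0\<^sub>v ?n \<longrightarrow> (\<forall>x\<in>S. u x = 0)"
        using vs.not_lindepD[OF l S(2) order_refl] by (auto simp: Pi_def)
    qed
    finally show ?thesis by simp
  qed
  have colset: "set (cols ?A) = (\<lambda>b. col ?A b) ` {0..<?n}" using A by (auto simp: cols_def)
  have cols: "set (cols ?A) \<subseteq> carrier_vec ?n" using cols_dim[of ?A] by (simp add: submatrix_of_def)
  obtain S where S: "maximal S (\<lambda>T. T \<subseteq> set (cols ?A) \<and> vs.lin_indpt T)"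
    using maximal_exists_superset[of "set (cols ?A)" "\<lambda>T. T \<subseteq> set (cols ?A) \<and> vs.lin_indpt T" "{}"]
      indep[of "{}"] independent_empty by auto
  have Ssub: "S \<subseteq> set (cols ?A)" "vs.lin_indpt S" using S unfolding maximal_def by blast+
  have finS: "finite S" using Ssub(1) finite_subset by blast
  have ind: "independent (\<psi> ` S)" using indep[of S] Ssub cols finS by blast
  have "\<psi> x \<in> span (\<psi> ` S)" if x: "x \<in> set (cols ?A)" for x
  proof (cases "x \<in> S")
    case False
    have "\<not> vs.lin_indpt (insert x S)" using S False x Ssub unfolding maximal_def by blast
    hence "\<not> independent (insert (\<psi> x) (\<psi> ` S))"
      using indep[of "insert x S"] x Ssub cols finS by auto
    thus ?thesis using ind independent_insert[of "\<psi> x" "\<psi> ` S"] by (auto split: if_splits intro: span_base)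
  qed (simp add: span_base)
  hence "span (\<psi> ` S) = span (\<psi> ` set (cols ?A))"
    using Ssub(1) by (intro span_eq[THEN iffD2] conjI) (auto intro: span_base)
  hence "dim (\<psi> ` set (cols ?A)) = card (\<psi> ` S)" using ind by (rule dim_eq_card)
  also have "\<dots> = card S" using inj Ssub cols by (intro card_image) (meson inj_on_subset order_trans)
  also have "\<dots> = vs.rank ?A" using vs.rank_card_indpt[OF A S] by simp
  finally have "vs.rank ?A = dim (\<psi> ` set (cols ?A))" by simp
  also have "\<psi> ` set (cols ?A) = (\<lambda>b. \<psi> (col ?A b)) ` {0..<?n}" unfolding colset image_image ..
  also have "\<dots> = (\<lambda>b. \<chi> i. if i \<in> set is then G $ i $ (is ! b) else 0) ` {0..<?n}"
  proof (rule image_cong[OF refl])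
    fix b assume b: "b \<in> {0..<?n}"
    show "\<psi> (col ?A b) = (\<chi> i. if i \<in> set is then G $ i $ (is ! b) else 0)"
      by (subst \<psi>eq) (use b in \<open>auto simp: \<psi>0 \<psi>n submatrix_of_def\<close>)
  qed
  also have "\<dots> = (\<lambda>k. \<chi> i. if i \<in> set is then G $ i $ k else 0) ` ((\<lambda>b. is ! b) ` {0..<?n})"
    unfolding image_image ..
  also have "(\<lambda>b. is ! b) ` {0..<?n} = set is" by (auto simp: set_conv_nth)
  finally show ?thesis .
qed

section \<open>Pointed cones\<close>

lemma pointed_cone_convex_cone:
  assumes "pointed_cone C"
  obtains V where "finite V" "C = convex_cone hull V"
proof -
  obtain V where V: "finite V" "C = {\<Sum>v\<in>V. c v *\<^sub>R v | c. \<forall>v\<in>V. (0::real) \<le> c v}"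
    using assms unfolding pointed_cone_def by blast
  have mem: "(\<Sum>v\<in>V. c v *\<^sub>R v) \<in> C" if "\<And>v. v \<in> V \<Longrightarrow> 0 \<le> c v" for c
    using that unfolding V(2) by blast
  have cc: "convex_cone C"
    unfolding convex_cone_iff
  proof (intro conjI ballI allI impI)
    show "0 \<in> C" using mem[of "\<lambda>_. 0"] by simp
    fix x assume "x \<in> C"
    then obtain c where c: "x = (\<Sum>v\<in>V. c v *\<^sub>R v)" "\<forall>v\<in>V. 0 \<le> c v" unfolding V(2) by blast
    show "k *\<^sub>R x \<in> C" if "k \<ge> 0" for k
      using mem[of "\<lambda>v. k * c v"] c that by (simp add: scaleR_sum_right)
    fix y assume "y \<in> C"
    then obtain e where e: "y = (\<Sum>v\<in>V. e v *\<^sub>R v)" "\<forall>v\<in>V. 0 \<le> e v" unfolding V(2) by blast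
    show "x + y \<in> C"
      using mem[of "\<lambda>v. c v + e v"] c e by (simp add: scaleR_add_left sum.distrib)
  qed
  have "x \<in> C" if x: "x \<in> V" for x
  proof -
    have "(\<Sum>v\<in>V. (if v = x then 1 else 0) *\<^sub>R v) = (\<Sum>v\<in>V. if v = x then v else 0)" by (rule sum.cong) auto
    also have "\<dots> = x" using x V(1) by simp
    finally show ?thesis using mem[of "\<lambda>v. if v = x then 1 else 0"] by simp
  qed
  hence "convex_cone hull V \<subseteq> C" using cc by (intro hull_minimal) auto
  moreover have "C \<subseteq> convex_cone hull V"
  proof
    fix x assume "x \<in> C"
    then obtain c where c: "x = (\<Sum>v\<in>V. c v *\<^sub>R v)" "\<forall>v\<in>V. 0 \<le> c v" unfolding V(2) by blast
    have "(\<Sum>v\<in>W. c v *\<^sub>R v) \<in> convex_cone hull V" if "finite W" "W \<subseteq> V" for W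
      using that
    proof (induction W rule: finite_induct)
      case (insert w W)
      have "c w *\<^sub>R w \<in> convex_cone hull V"
        using insert.prems c(2) by (intro convex_cone_hull_mul hull_inc) auto
      thus ?case using insert by (simp add: convex_cone_hull_add)
    qed (simp add: convex_cone_hull_contains_0)
    thus "x \<in> convex_cone hull V" using V(1) c(1) by blast
  qed
  ultimately show ?thesis using that V(1) by blast
qed

definition facet_normals :: "'a::euclidean_space set \<Rightarrow> ('i \<Rightarrow> 'a set) \<Rightarrow> ('i \<Rightarrow> 'a) \<Rightarrow> bool" where
  "facet_normals C f n \<longleftrightarrow> (\<forall>i. n i \<noteq> 0 \<and> C \<subseteq> {x. n i \<bullet> x \<le> 0} \<and> f i = C \<inter> {x. n i \<bullet> x = 0})"

locale polyhedral_cone =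
  fixes C :: "'a::euclidean_space set" and f :: "'i::finite \<Rightarrow> 'a set"
  assumes pc: "pointed_cone C" and int: "interior C \<noteq> {}"
    and f: "bij_betw f UNIV {F. F facet_of C}"
begin

lemma polyhedron_C: "polyhedron C"
  using pointed_cone_convex_cone[OF pc] polyhedron_convex_cone_hull by metis

lemma convex_cone_C: "convex_cone C"
  using pointed_cone_convex_cone[OF pc] convex_cone_convex_cone_hull by metis

lemma zero_C: "0 \<in> C" using convex_cone_C unfolding convex_cone_iff by blast
lemma scale_C: "x \<in> C \<Longrightarrow> 0 \<le> k \<Longrightarrow> k *\<^sub>R x \<in> C" using convex_cone_C unfolding convex_cone_iff by blast
lemma convex_C: "convex C" using polyhedron_C by (rule polyhedron_imp_convex)
lemma closed_C: "closed C" using polyhedron_C by (rule polyhedron_imp_closed)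
lemma no_line: "u \<noteq> 0 \<Longrightarrow> \<not> range (\<lambda>t::real. a + t *\<^sub>R u) \<subseteq> C" using pc unfolding pointed_cone_def by blast

lemma aff_dim_C: "aff_dim C = int DIM('a)"
  using aff_dim_eq_full affine_hull_nonempty_interior[OF int] by blast

lemma facet_f: "f i facet_of C"
  using bij_betwE[OF f] by blast

text \<open>A nonzero \<open>y\<close> of the face lies inside the segment from 0 to twice
  \<open>y\<close>, so both ends belong to the face.\<close>

lemma zero_face: assumes "F face_of C" "F \<noteq> {}" shows "0 \<in> F"
proof -
  obtain y where y: "y \<in> F" using assms by blast
  hence yC: "y \<in> C" using face_of_imp_subset[OF assms(1)] by blast
  show ?thesis
  proof (cases "y = 0")
    case False
    have "y \<in> open_segment 0 (2 *\<^sub>R y)"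
      unfolding in_segment using False by (auto intro!: exI[of _ "1/2"])
    moreover have "2 *\<^sub>R y \<in> C" using scale_C[OF yC] by simp
    ultimately show ?thesis using assms(1) y zero_C unfolding face_of_def by blast
  qed (use y in simp)
qed

lemma facet_normals_exist: "\<exists>n. facet_normals C f n"
proof -
  have "\<exists>n. n \<noteq> 0 \<and> C \<subseteq> {x. n \<bullet> x \<le> 0} \<and> f i = C \<inter> {x. n \<bullet> x = 0}" for i
  proof -
    obtain a b where ab: "a \<noteq> 0" "C \<subseteq> {x. a \<bullet> x \<le> b}" "f i = C \<inter> {x. a \<bullet> x = b}"
      using facet_of_polyhedron[OF polyhedron_C facet_f] by metis
    have "0 \<in> f i" using zero_face facet_f[of i] unfolding facet_of_def by blast
    hence "b = 0" using ab(3) by simp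
    with ab show ?thesis by blast
  qed
  thus ?thesis unfolding facet_normals_def by metis
qed

context
  fixes n assumes n: "facet_normals C f n"
begin

lemma n0: "n i \<noteq> 0" and n_le: "x \<in> C \<Longrightarrow> n i \<bullet> x \<le> 0" and f_eq: "f i = C \<inter> {x. n i \<bullet> x = 0}"
  using n unfolding facet_normals_def by blast+

lemma interior_neg: assumes "w \<in> interior C" shows "n i \<bullet> w < 0"
proof -
  obtain e where e: "e > 0" "ball w e \<subseteq> C" using assms unfolding mem_interior by blast
  define k where "k = e / (2 * norm (n i))"
  have k: "k > 0" "k * norm (n i) < e" using e n0[of i] by (auto simp: k_def field_simps)
  have "w + k *\<^sub>R n i \<in> ball w e" using k by (simp add: dist_norm)
  hence "n i \<bullet> (w + k *\<^sub>R n i) \<le> 0" using e(2) n_le by blast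
  moreover have "0 < k * (n i \<bullet> n i)" using k n0 by simp
  ultimately show ?thesis by (simp add: inner_add_right)
qed

text \<open>The segment from an interior point to a point outside leaves the cone through a facet.
  If the normal of that facet is nonpositive at the far end, being negative at the start, it cannot
  vanish in between.\<close>

lemma mem_iff: "x \<in> C \<longleftrightarrow> (\<forall>i. n i \<bullet> x \<le> 0)"
proof
  assume x: "\<forall>i. n i \<bullet> x \<le> 0"
  show "x \<in> C"
  proof (rule ccontr)
    assume nx: "x \<notin> C"
    obtain w where w: "w \<in> interior C" using int by blast
    have wC: "w \<in> C" using w interior_subset by blast
    have "closed_segment w x \<inter> frontier C \<noteq> {}"
      by (rule connected_Int_frontier) (use wC nx in auto)
    then obtain y where y: "y \<in> closed_segment w x" "y \<in> frontier C" by blast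
    have "y \<in> C - interior C" using y(2) closed_C by (simp add: frontier_def)
    hence "y \<in> C - rel_interior C" using rel_interior_nonempty_interior[OF int] by simp
    then obtain F where F: "F facet_of C" "y \<in> F" using rel_boundary_of_polyhedron[OF polyhedron_C] by blast
    then obtain i where i: "F = f i" using f unfolding bij_betw_def by (metis (mono_tags) imageE mem_Collect_eq)
    obtain t where t: "0 \<le> t" "t \<le> 1" "y = (1 - t) *\<^sub>R w + t *\<^sub>R x" using y(1) by (auto simp: in_segment)
    have e: "(1 - t) * (n i \<bullet> w) + t * (n i \<bullet> x) = 0"
      using F(2) i f_eq t(3) by (simp add: inner_add_right)
    have "t \<noteq> 1" using t(3) nx \<open>y \<in> C - interior C\<close> by auto
    hence "(1 - t) * (n i \<bullet> w) < 0" using t interior_neg[OF w] by (simp add: mult_pos_neg)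
    moreover have "t * (n i \<bullet> x) \<le> 0" using t x by (simp add: mult_nonneg_nonpos)
    ultimately show False using e by linarith
  qed
qed (use n_le in blast)

lemma kernel_zero: assumes "\<And>i. n i \<bullet> x = 0" shows "x = 0"
proof (rule ccontr)
  assume "x \<noteq> 0"
  have "range (\<lambda>t::real. 0 + t *\<^sub>R x) \<subseteq> C" using assms by (auto simp: mem_iff)
  with no_line[OF \<open>x \<noteq> 0\<close>] show False by blast
qed

lemma span_facet: "span (f i) = {x. n i \<bullet> x = 0}"
proof -
  have "0 \<in> f i" using f_eq zero_C by simp
  hence "aff_dim (f i) = int (dim (f i))" by (intro aff_dim_zero hull_inc)
  hence "int (dim (f i)) = int DIM('a) - 1" using facet_f[of i] aff_dim_C unfolding facet_of_def by simp
  hence d: "dim (f i) = DIM('a) - 1" by linarith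
  have "span (f i) \<subseteq> {x. n i \<bullet> x = 0}" using f_eq by (intro span_minimal subspace_hyperplane) blast
  moreover have "dim {x. n i \<bullet> x = 0} \<le> dim (span (f i))" using d dim_hyperplane[OF n0] by simp
  ultimately show ?thesis by (intro subspace_dim_equal subspace_span subspace_hyperplane)
qed

text \<open>Decomposing a point of the cone into points on smaller faces: in the plane spanned by \<open>x\<close> and a
  direction \<open>u\<close> tangent to the face of \<open>x\<close>, the two boundary rays are \<open>u + \<mu> x\<close> and \<open>- u - \<nu> x\<close>.\<close>

lemma edges_generate:
  assumes K: "0 \<in> K" "\<And>x y. x \<in> K \<Longrightarrow> y \<in> K \<Longrightarrow> x + y \<in> K" "\<And>x k. x \<in> K \<Longrightarrow> 0 \<le> k \<Longrightarrow> k *\<^sub>R x \<in> K"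
    and e: "\<And>e. e edge_of C \<Longrightarrow> e \<subseteq> K" and x: "x \<in> C"
  shows "x \<in> K"
  using x
\<comment> \<open>The number of strictly negative rows drops at each boundary ray reached, where a
  further row becomes active.\<close>
proof (induction "card {i. n i \<bullet> x < 0}" arbitrary: x rule: less_induct)
  case less
  let ?I = "{i. n i \<bullet> x < 0}"
  let ?N = "{y. \<forall>i. n i \<bullet> x = 0 \<longrightarrow> n i \<bullet> y = 0}"
  show ?case
  proof (cases "x = 0")
    case True
    thus ?thesis using K by simp
  next
    case False
    have "\<not> (\<forall>i. n i \<bullet> x = 0)" using kernel_zero False by blast
    hence I: "?I \<noteq> {}" using less.prems n_le by (auto simp: order_le_less)
    show ?thesis
    proof (cases "?N \<subseteq> span {x}")
      \<comment> \<open>The rows active at \<open>x\<close> cut out only multiples of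
        \<open>x\<close>, so the face they define is one-dimensional, an edge.\<close>
      case True
      let ?F = "C \<inter> ?N"
      have F: "?F face_of C" unfolding face_of_def
      proof (intro conjI ballI impI)
        have "?N = (\<Inter>i\<in>{i. n i \<bullet> x = 0}. {y. n i \<bullet> y = 0})" by blast
        thus "convex ?F" using convex_C by (auto intro!: convex_Int convex_INT convex_hyperplane)
        fix a b p assume ab: "a \<in> C" "b \<in> C" "p \<in> ?F" "p \<in> open_segment a b"
        then obtain t where t: "0 < t" "t < 1" "p = (1 - t) *\<^sub>R a + t *\<^sub>R b" by (auto simp: in_segment)
        have "n i \<bullet> a = 0 \<and> n i \<bullet> b = 0" if "n i \<bullet> x = 0" for i
        proof -
          have "(1 - t) * (n i \<bullet> a) + t * (n i \<bullet> b) = 0"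
            using ab(3) that by (auto simp: t(3) inner_add_right)
          moreover have "(1 - t) * (n i \<bullet> a) \<le> 0" "t * (n i \<bullet> b) \<le> 0"
            using t n_le ab by (auto intro!: mult_nonneg_nonpos)
          ultimately have "(1 - t) * (n i \<bullet> a) = 0" "t * (n i \<bullet> b) = 0" by linarith+
          thus ?thesis using t by simp
        qed
        thus "a \<in> ?F" "b \<in> ?F" using ab by blast+
      qed blast
      have "span ?F = span {x}"
        using True less.prems by (intro span_eq[THEN iffD2] conjI) (auto intro: span_base)
      hence "dim (span ?F) = dim (span {x})" by (rule arg_cong)
      hence "dim ?F = dim {x}" by (simp only: dim_span)
      hence "aff_dim ?F = 1" using aff_dim_zero[of ?F] zero_C False by (simp add: hull_inc)
      hence "?F edge_of C" unfolding edge_of_def using F by blast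
      moreover have "x \<in> ?F" using less.prems by blast
      ultimately show ?thesis using e by blast
    next
      case False
      then obtain u where u: "u \<in> ?N" "u \<notin> span {x}" by blast
      \<comment> \<open>The multiple of \<open>x\<close> that moves \<open>u\<close> onto the
        hyperplane of row \<open>i\<close>. Its extremes over the strictly negative rows give the
        two boundary rays.\<close>
      define \<rho> where "\<rho> i = (n i \<bullet> u) / - (n i \<bullet> x)" for i
      have nu: "n i \<bullet> u = - (n i \<bullet> x) * \<rho> i" if "i \<in> ?I" for i using that unfolding \<rho>_def by simp
      have n0x: "n i \<bullet> x = 0" if "i \<notin> ?I" for i using that n_le[OF less.prems, of i] by simp
      have n0u: "n i \<bullet> u = 0" if "i \<notin> ?I" for i using n0x[OF that] u by blast
      obtain p where p: "p \<in> ?I" "\<forall>i\<in>?I. \<rho> i \<le> \<rho> p" using finite_arg_max[OF _ I, of \<rho>] by auto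
      obtain q where q: "q \<in> ?I" "\<forall>i\<in>?I. \<rho> q \<le> \<rho> i" using finite_arg_min[OF _ I, of \<rho>] by auto
      have inK: "y \<in> K" if y: "\<And>i. i \<in> ?I \<Longrightarrow> n i \<bullet> y \<le> 0" "\<And>i. i \<notin> ?I \<Longrightarrow> n i \<bullet> y = 0"
        and l: "l \<in> ?I" "n l \<bullet> y = 0" for y l
      proof -
        have "n i \<bullet> y \<le> 0" for i using y[of i] by (cases "i \<in> ?I") auto
        hence "y \<in> C" using mem_iff by blast
        moreover have "{i. n i \<bullet> y < 0} \<subset> ?I" using y l by force
        hence "card {i. n i \<bullet> y < 0} < card ?I" by (intro psubset_card_mono) auto
        ultimately show ?thesis using less.hyps by blast
      qed
      have ev: "n i \<bullet> (u + \<rho> p *\<^sub>R x) = - (n i \<bullet> x) * (\<rho> i - \<rho> p)"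
        "n i \<bullet> (- u - \<rho> q *\<^sub>R x) = - (n i \<bullet> x) * (\<rho> q - \<rho> i)" if "i \<in> ?I" for i
        using nu[OF that] by (simp_all add: inner_add_right inner_diff_right algebra_simps)
      have 1: "u + \<rho> p *\<^sub>R x \<in> K"
      proof (rule inK[OF _ _ p(1)])
        fix i assume "i \<in> ?I"
        thus "n i \<bullet> (u + \<rho> p *\<^sub>R x) \<le> 0" using ev(1)[of i] p(2) by (auto intro!: mult_nonpos_nonpos)
      next
        fix i assume i: "i \<notin> ?I"
        show "n i \<bullet> (u + \<rho> p *\<^sub>R x) = 0" using n0x[OF i] n0u[OF i] by (simp add: inner_add_right)
      qed (simp add: ev(1)[OF p(1)])
      have 2: "- u - \<rho> q *\<^sub>R x \<in> K"
      proof (rule inK[OF _ _ q(1)])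
        fix i assume "i \<in> ?I"
        thus "n i \<bullet> (- u - \<rho> q *\<^sub>R x) \<le> 0" using ev(2)[of i] q(2) by (auto intro!: mult_nonpos_nonpos)
      next
        fix i assume i: "i \<notin> ?I"
        show "n i \<bullet> (- u - \<rho> q *\<^sub>R x) = 0" using n0x[OF i] n0u[OF i] by (simp add: inner_diff_right)
      qed (simp add: ev(2)[OF q(1)])
      have "\<rho> p \<noteq> \<rho> q"
      proof
        assume "\<rho> p = \<rho> q"
        hence "\<rho> i = \<rho> p" if "i \<in> ?I" for i using p(2) q(2) that by (metis order_antisym)
        hence "n i \<bullet> (u + \<rho> p *\<^sub>R x) = 0" for i
          using ev(1)[of i] n0x[of i] n0u[of i] by (cases "i \<in> ?I") (auto simp: inner_add_right)
        hence "u + \<rho> p *\<^sub>R x = 0" by (rule kernel_zero)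
        hence "u = (- \<rho> p) *\<^sub>R x" by (simp add: eq_neg_iff_add_eq_0)
        thus False using u(2) span_base[of x "{x}"] span_scale[of x "{x}" "- \<rho> p"] by simp
      qed
      hence lt: "\<rho> q < \<rho> p" using p(2) q(1) by force
      \<comment> \<open>The direction \<open>u\<close> cancels in the sum, and a positive multiple
        of \<open>x\<close> remains.\<close>
      have "(1 / (\<rho> p - \<rho> q)) *\<^sub>R ((u + \<rho> p *\<^sub>R x) + (- u - \<rho> q *\<^sub>R x)) \<in> K"
        using lt by (intro K 1 2) simp
      also have "(u + \<rho> p *\<^sub>R x) + (- u - \<rho> q *\<^sub>R x) = (\<rho> p - \<rho> q) *\<^sub>R x" by (simp add: algebra_simps)
      finally show ?thesis using lt by simp
    qed
  qed
qed

lemma edge_ray: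
  assumes "e edge_of C"
  obtains y where "y \<noteq> 0" "e = {t *\<^sub>R y | t. 0 \<le> t}"
proof -
  have e: "e face_of C" "aff_dim e = 1" using assms unfolding edge_of_def by blast+
  hence "e \<noteq> {}" by auto
  have z: "0 \<in> e" using zero_face[OF e(1) \<open>e \<noteq> {}\<close>] .
  have eC: "e \<subseteq> C" "convex e" using e face_of_imp_subset face_of_imp_convex by blast+
  have d: "dim e = 1" using aff_dim_zero[OF hull_inc[OF z]] e(2) by simp
  obtain y where y: "y \<in> e" "y \<noteq> 0"
  proof -
    have "\<not> e \<subseteq> {0}" using d dim_eq_0[of e] by auto
    thus ?thesis using that by blast
  qed
  have "span {y} = span e"
    using y d by (intro subspace_dim_equal subspace_span span_mono) auto
  hence sp: "x \<in> e \<Longrightarrow> \<exists>c. x = c *\<^sub>R y" for x using span_base[of x e] by (auto simp: span_singleton)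
  have "x \<in> {t *\<^sub>R y | t. 0 \<le> t}" if x: "x \<in> e" for x
  proof -
    obtain c where c: "x = c *\<^sub>R y" using sp[OF x] by blast
    have "0 \<le> c"
    proof (rule ccontr)
      assume "\<not> 0 \<le> c"
      have "n i \<bullet> y = 0" for i
      proof -
        have "n i \<bullet> y \<le> 0" "c * (n i \<bullet> y) \<le> 0" using n_le[of y i] n_le[of x i] x y eC c by auto
        thus ?thesis using \<open>\<not> 0 \<le> c\<close> by (simp add: mult_le_0_iff)
      qed
      hence "y = 0" by (rule kernel_zero)
      with y show False by blast
    qed
    thus ?thesis using c by blast
  qed
  moreover have "t *\<^sub>R y \<in> e" if t: "0 \<le> t" for t
  proof (cases "t \<le> 1")
    case True
    thus ?thesis using convexD[OF eC(2) z y(1), of "1 - t" t] t by simp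
  next
    case False
    hence "y \<in> open_segment 0 (t *\<^sub>R y)"
      unfolding in_segment using y by (auto intro!: exI[of _ "1/t"])
    moreover have "t *\<^sub>R y \<in> C" using scale_C t y eC by blast
    ultimately show ?thesis using e(1) y zero_C unfolding face_of_def by blast
  qed
  ultimately have "e = {t *\<^sub>R y | t. 0 \<le> t}" by blast
  with that y show ?thesis by blast
qed

end

end

lemma (in dual_pair) V_facet: "V (facet R i) = V (face_top R) \<inter> {x. n i \<bullet> x = 0}"
proof (intro equalityI subsetI)
  fix x assume x: "x \<in> V (facet R i)"
  have "i \<in> fst (facet R i)" unfolding facet_def by simp
  thus "x \<in> V (face_top R) \<inter> {x. n i \<bullet> x = 0}" using x V_kernel[OF facet_in] by blast
next
  fix x assume x: "x \<in> V (face_top R) \<inter> {x. n i \<bullet> x = 0}"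
  hence "\<And>i. n i \<bullet> x \<le> 0" using inner_V by blast
  then obtain p where p: "p \<in> maxbicliques R" "fst p = {i. n i \<bullet> x = 0}" "x \<in> V p"
    using face_of_cone_point by blast
  hence "below p (facet R i)" using below_facet[OF p(1)] x by blast
  thus "x \<in> V (facet R i)" using V_mono p(3) by blast
qed

lemma (in dual_pair) V_vertex: "V (vertex R j) = {x \<in> V (face_top R). \<forall>i. (i, j) \<in> R \<longrightarrow> n i \<bullet> x = 0}"
  using V_kernel[OF vertex_in, of j] unfolding vertex_def by auto

lemma (in dual_pair) indexedI:
  assumes "bij_betw (\<lambda>i. V (facet R i)) UNIV {F. F facet_of V (face_top R)}"
    and "bij_betw (\<lambda>j. V (vertex R j)) UNIV {F. F edge_of V (face_top R)}"
  shows "indexed_by_irreducibles R"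
proof -
  have *: "bij_betw g UNIV M" if b: "bij_betw (\<lambda>i. V (g i)) UNIV S" "bij_betw V M S" and M: "M \<subseteq> maxbicliques R"
    and g: "\<And>i. g i \<in> maxbicliques R" for g :: "'k \<Rightarrow> _" and M S
  proof -
    have gM: "g i \<in> M" for i
    proof -
      have "V (g i) \<in> V ` M" using b unfolding bij_betw_def by blast
      then obtain a where "a \<in> M" "V (g i) = V a" by blast
      thus ?thesis using inj_onD[OF V_inj _ g[of i], of a] M by (metis subsetD)
    qed
    have "inj g" using b(1) unfolding bij_betw_def inj_on_def by metis
    moreover have "a \<in> range g" if a: "a \<in> M" for a
    proof -
      have "V a \<in> range (\<lambda>i. V (g i))" using b a unfolding bij_betw_def by blast
      then obtain i where "V a = V (g i)" by blast
      hence "a = g i" using inj_onD[OF V_inj, of a "g i"] M g a by blast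
      thus ?thesis by blast
    qed
    ultimately show ?thesis using gM unfolding bij_betw_def by blast
  qed
  have M: "meet_irreducibles (maxbiclique_lattice R) \<subseteq> maxbicliques R"
    "join_irreducibles (maxbiclique_lattice R) \<subseteq> maxbicliques R" unfolding meet_irr join_irr by blast+
  show ?thesis unfolding indexed_by_irreducibles_def
    using *[OF assms(1) facets_bij M(1) facet_in] *[OF assms(2) edges_bij M(2) vertex_in] by blast
qed

text \<open>One nonzero vector on each extreme ray gives the generators: they generate
  \<open>C\<close> by \<open>edges_generate\<close>, they span because the interior is nonempty, and
  the labelling supplies the sign pattern.\<close>

lemma type_cone_dual_pair:
  fixes R :: "('i::finite \<times> 'j::finite) set" and C :: "(real^'n) set"
  assumes tc: "type_cone R (C, f, r)" and n: "facet_normals C f n"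
  obtains v where "dual_pair R n v" "sign_pattern.V v (face_top R) = C"
    "\<And>i. f i = sign_pattern.V v (facet R i)" "\<And>j. r j = sign_pattern.V v (vertex R j)"
    "\<And>j. r j = {t *\<^sub>R v j | t. 0 \<le> t}" "indexed_by_irreducibles R"
proof -
  have tc': "pointed_cone C" "interior C \<noteq> {}" "bij_betw f UNIV {F. F facet_of C}"
    "bij_betw r UNIV {e. e edge_of C}" "\<And>i j. r j \<subseteq> f i \<longleftrightarrow> (i, j) \<in> R"
    using tc unfolding type_cone_def by auto
  interpret pc: polyhedral_cone C f by unfold_locales (use tc' in auto)
  have edge: "r j edge_of C" for j using bij_betwE[OF tc'(4)] by blast
  have "\<exists>y. y \<noteq> 0 \<and> r j = {t *\<^sub>R y | t. 0 \<le> t}" for j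
    by (rule pc.edge_ray[OF n edge]) blast
  hence "\<exists>v. \<forall>j. v j \<noteq> 0 \<and> r j = {t *\<^sub>R v j | t. 0 \<le> t}" by (intro choice allI)
  then obtain v where v: "\<And>j. v j \<noteq> 0" "\<And>j. r j = {t *\<^sub>R v j | t. 0 \<le> t}" by blast
  have vr: "v j \<in> r j" for j unfolding v(2) by (auto intro!: exI[of _ 1])
  have vC: "v j \<in> C" for j using vr edge edge_of_imp_subset by blast
  interpret sp: sign_pattern R n v
  proof
    fix i j
    show "n i \<bullet> v j \<le> 0" using pc.n_le[OF n vC] .
    have "n i \<bullet> v j = 0 \<longleftrightarrow> v j \<in> f i" using pc.f_eq[OF n] vC by blast
    also have "\<dots> \<longleftrightarrow> r j \<subseteq> f i"
    proof
      assume "v j \<in> f i"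
      thus "r j \<subseteq> f i" unfolding v(2) pc.f_eq[OF n] using pc.scale_C by auto
    qed (use vr in blast)
    finally show "n i \<bullet> v j = 0 \<longleftrightarrow> (i, j) \<in> R" using tc'(5) by blast
  qed
  have CV: "x \<in> sp.V (face_top R)" if "x \<in> C" for x
  proof (rule pc.edges_generate[OF n _ _ _ _ that])
    show "0 \<in> sp.V (face_top R)" using sp.V_scale[OF sp.w_in_V, of 0] by simp
    fix e assume "e edge_of C"
    then obtain j where "e = r j" using tc'(4) unfolding bij_betw_def by (metis (mono_tags) imageE mem_Collect_eq)
    thus "e \<subseteq> sp.V (face_top R)" unfolding v(2) by (auto intro!: sp.V_scale sp.v_in_V)
  qed (rule sp.V_add sp.V_scale; assumption)+
  interpret dp: dual_pair R n v
  proof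
    show "x \<in> sp.V (face_top R)" if "\<And>i. n i \<bullet> x \<le> 0" for x
      using CV pc.mem_iff[OF n] that by blast
    show "x = 0" if "\<And>i. n i \<bullet> x = 0" for x using pc.kernel_zero[OF n] that .
    have "C \<subseteq> span (range v)" using CV sp.V_U[of "face_top R"] unfolding sp.U_def by auto
    hence "interior (span (range v)) \<noteq> {}" using tc'(2) interior_mono by blast
    hence "dim (range v) = DIM(real^'n)" using empty_interior_lowdim[of "span (range v)"] dim_subset_UNIV[of "range v"]
      by (metis dim_span le_neq_implies_less)
    thus "span (range v) = UNIV" using dim_eq_full by blast
    show "v j \<noteq> 0" for j by (rule v(1))
  qed
  have VC: "sp.V (face_top R) = C" using dp.cone_iff pc.mem_iff[OF n] by blast
  have fV: "f i = sp.V (facet R i)" for i unfolding dp.V_facet VC by (rule pc.f_eq[OF n])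
  \<comment> \<open>A priori the ray is the cone of some face \<open>a\<close> of rank 1; its
    incidences with the facets force \<open>a\<close> to be \<open>vertex R j\<close>.\<close>
  have rV: "r j = sp.V (vertex R j)" for j
  proof -
    obtain a where a: "a \<in> maxbicliques R" "r j = sp.V a"
    proof -
      have "r j \<in> sp.V ` {a \<in> maxbicliques R. sp.rk a = 1}" using edge[of j] dp.edges_eq unfolding VC by blast
      thus ?thesis using that by blast
    qed
    have "below a (vertex R j)"
    proof -
      have "i \<in> fst a" if "i \<in> fst (vertex R j)" for i
      proof -
        have "(i, j) \<in> R" using that unfolding vertex_def by simp
        hence "sp.V a \<subseteq> sp.V (facet R i)" using tc'(5) a(2) fV by auto
        hence "below a (facet R i)" using dp.V_subset_iff[OF a(1) facet_in] by blast
        thus ?thesis using below_facet[OF a(1)] by blast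
      qed
      thus ?thesis using below_fst[OF a(1) vertex_in] by blast
    qed
    moreover have "below (vertex R j) a"
    proof -
      have "(i, j) \<in> R" if "i \<in> fst a" for i
      proof -
        have "below a (facet R i)" using below_facet[OF a(1)] that by blast
        hence "r j \<subseteq> f i" using sp.V_mono a(2) fV by blast
        thus ?thesis using tc'(5) by blast
      qed
      hence "fst a \<subseteq> fst (vertex R j)" unfolding vertex_def by auto
      thus ?thesis using below_fst[OF vertex_in a(1)] by blast
    qed
    ultimately have "a = vertex R j" using below_antisym[OF a(1) vertex_in] by blast
    thus ?thesis using a(2) by simp
  qed
  have "f = (\<lambda>i. sp.V (facet R i))" "r = (\<lambda>j. sp.V (vertex R j))" using fV rV by blast+
  hence "indexed_by_irreducibles R" using dp.indexedI tc'(3,4) unfolding VC by simp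
  with that[of v] dp.dual_pair_axioms VC fV rV v(2) show ?thesis by blast
qed

section \<open>Gram matrices\<close>

lemma dim_kernel_image:
  fixes T :: "'a::euclidean_space \<Rightarrow> 'b::euclidean_space"
  assumes T: "linear T" and S: "Real_Vector_Spaces.subspace S"
  shows "dim (T ` S) + dim (S \<inter> {x. T x = 0}) = dim S"
proof -
  let ?K = "S \<inter> {x. T x = 0}"
  have sK: "Real_Vector_Spaces.subspace ?K"
    by (intro subspace_inter S) (rule linear_subspace_kernel[OF T])
  define S' where "S' = {y \<in> S. \<forall>x \<in> ?K. Linear_Algebra.orthogonal x y}"
  have sS': "Real_Vector_Spaces.subspace S'"
  proof -
    have "S' = S \<inter> {y. \<forall>x \<in> ?K. Linear_Algebra.orthogonal x y}" unfolding S'_def by blast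
    thus ?thesis by (simp only: subspace_inter[OF S subspace_orthogonal_to_vectors])
  qed
  have d: "dim S' + dim ?K = dim S" unfolding S'_def by (intro dim_subspace_orthogonal_to_vectors sK S) blast
  have "inj_on T S'"
  proof (subst linear_injective_on_subspace_0[OF T sS'], intro ballI impI)
    fix x assume x: "x \<in> S'" "T x = 0"
    hence "Linear_Algebra.orthogonal x x" unfolding S'_def by blast
    thus "x = 0" by (simp add: orthogonal_self)
  qed
  hence "dim (T ` S') = dim S'" using T sS' by (intro dim_image_eq) (auto simp: span_eq_iff[THEN iffD2])
  moreover have "T ` S = T ` S'"
  proof
    show "T ` S \<subseteq> T ` S'"
    proof
      fix y assume "y \<in> T ` S"
      then obtain x where x: "x \<in> S" "y = T x" by blast
      obtain k z where kz: "k \<in> span ?K" "\<And>w. w \<in> span ?K \<Longrightarrow> Linear_Algebra.orthogonal z w" "x = k + z"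
        using orthogonal_subspace_decomp_exists[of ?K x] by metis
      have spK: "span ?K = ?K" using sK by (simp add: span_eq_iff)
      have k: "k \<in> ?K" using kz(1) unfolding spK .
      have "z = x - k" using kz(3) by simp
      hence "z \<in> S" using subspace_diff[OF S x(1)] k by blast
      moreover have "\<forall>w\<in>?K. Linear_Algebra.orthogonal w z" using kz(2) unfolding spK by (simp add: orthogonal_commute)
      ultimately have "z \<in> S'" unfolding S'_def by blast
      moreover have "y = T z" using x(2) kz(3) k linear_add[OF T, of k z] by simp
      ultimately show "y \<in> T ` S'" by blast
    qed
    show "T ` S' \<subseteq> T ` S" unfolding S'_def by blast
  qed
  ultimately show ?thesis using d by simp
qed

section \<open>Determinants as functions of rows in a fixed order\<close>

definition rowdet :: "('n \<Rightarrow> real^'n) \<Rightarrow> 'n \<Rightarrow> real^'n \<Rightarrow> real" where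
  "rowdet c k y = Determinants.det (\<chi> i. if i = k then y else c i)"

lemma rowdet_self: "rowdet c k (c k) = Determinants.det (\<chi> i. c i)"
  unfolding rowdet_def by (intro arg_cong[where f=Determinants.det]) (simp add: Finite_Cartesian_Product.vec_eq_iff)

lemma linear_rowdet:
  fixes c :: "'n \<Rightarrow> real^'n"
  shows "linear (rowdet c k)"
proof
  fix x y :: "real^'n" and a :: real
  show "rowdet c k (x + y) = rowdet c k x + rowdet c k y"
    unfolding rowdet_def using Determinants.det_row_add[of k "\<lambda>_. x" "\<lambda>_. y" c] by simp
  show "rowdet c k (a *\<^sub>R x) = a *\<^sub>R rowdet c k x"
    unfolding rowdet_def using Determinants.det_row_mul[of k a "\<lambda>_. x" c, unfolded scalar_mult_eq_scaleR] by simp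
qed

lemma rowdet_span:
  fixes c :: "'n \<Rightarrow> real^'n"
  assumes "y \<in> span (c ` (- {k}))"
  shows "rowdet c k y = 0"
proof -
  have "rowdet c k (c j) = 0" if "j \<noteq> k" for j
    unfolding rowdet_def using that
    by (intro Determinants.det_identical_rows[of k j]) (auto simp: Finite_Cartesian_Product.row_def)
  hence "c ` (- {k}) \<subseteq> {y. rowdet c k y = 0}" by auto
  hence "span (c ` (- {k})) \<subseteq> {y. rowdet c k y = 0}"
    by (intro span_minimal linear_subspace_kernel[OF linear_rowdet])
  with assms show ?thesis by blast
qed

lemma rowdet_cong: "(\<And>j. j \<noteq> k \<Longrightarrow> c j = c' j) \<Longrightarrow> rowdet c k = rowdet c' k"
  unfolding rowdet_def by (intro ext arg_cong[where f=Determinants.det]) (simp add: Finite_Cartesian_Product.vec_eq_iff)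

lemma det_rows_nonzero:
  fixes c :: "'n \<Rightarrow> real^'n"
  shows "Determinants.det (\<chi> i. c i) \<noteq> 0 \<longleftrightarrow> span (range c) = (UNIV :: (real^'n) set)"
proof -
  have "Finite_Cartesian_Product.rows (\<chi> i. c i) = range c"
    unfolding Finite_Cartesian_Product.rows_def Finite_Cartesian_Product.row_def by auto
  thus ?thesis
    using matrix_left_invertible_span_rows[of "\<chi> i. c i"] invertible_left_inverse[of "\<chi> i. c i"]
      invertible_det_nz[of "\<chi> i. c i"] by metis
qed

text \<open>An arbitrary order of the coordinates, shared by all matrices built from lists. Changing
  it permutes the rows of every such matrix alike and so cancels in products of two
  determinants.\<close>

definition enum :: "nat \<Rightarrow> 'n::finite" where
  "enum = (SOME en. bij_betw en {0..<CARD('n)} UNIV)"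

definition index :: "'n::finite \<Rightarrow> nat" where
  "index = inv_into {0..<CARD('n)} enum"

lemma enum_bij: "bij_betw (enum :: nat \<Rightarrow> 'n::finite) {0..<CARD('n)} UNIV"
  unfolding enum_def using ex_bij_betw_nat_finite[of "UNIV :: 'n set"] by (metis finite_code someI)

lemma index_less: "index (x :: 'n::finite) < CARD('n)"
proof -
  have "x \<in> enum ` {0..<CARD('n)}" using enum_bij[where 'n='n] unfolding bij_betw_def by blast
  from inv_into_into[OF this] show ?thesis unfolding index_def by simp
qed

lemma enum_index [simp]: "enum (index x) = x"
  unfolding index_def using enum_bij by (intro f_inv_into_f) (auto simp: bij_betw_def)

lemma index_enum: "a < CARD('n) \<Longrightarrow> index (enum a :: 'n::finite) = a"
  unfolding index_def using enum_bij[where 'n='n] by (intro inv_into_f_f) (auto simp: bij_betw_def)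

lemma det_lower_triangular_sign:
  fixes M :: "real^'n^'n"
  assumes "\<And>x y. index x < index y \<Longrightarrow> M $ x $ y = 0" "\<And>x. M $ x $ x < 0"
  shows "0 < (- 1) ^ CARD('n) * Determinants.det M"
proof -
  let ?N = "CARD('n)"
  let ?A = "Matrix.mat ?N ?N (\<lambda>(a, b). M $ (enum a) $ (enum b))"
  have "Determinants.det M = Determinant.det ?A" using det_bridge[OF enum_bij, of M] by simp
  also have "\<dots> = prod_list (diag_mat ?A)"
    by (rule det_lower_triangular[of ?N]) (auto intro!: assms(1) simp: index_enum)
  also have "\<dots> = (\<Prod>a<?N. M $ (enum a) $ (enum a))"
    unfolding diag_mat_def by (simp add: prod.list_conv_set_nth atLeast0LessThan)
  finally have "(- 1) ^ ?N * Determinants.det M = (\<Prod>a<?N. - (M $ (enum a) $ (enum a)))"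
    by (simp add: prod_uminus)
  also have "\<dots> > 0" using assms(2) by (intro prod_pos) simp
  finally show ?thesis .
qed

definition list_matrix :: "('i \<Rightarrow> real^'n) \<Rightarrow> 'i list \<Rightarrow> real^'n^'n" where
  "list_matrix h is = (\<chi> x. h (is ! index x))"

locale nondegenerate_form =
  fixes \<Phi> :: "real^'n^'n"
  assumes sym: "Finite_Cartesian_Product.transpose \<Phi> = \<Phi>" and nd: "\<And>x. (\<And>y. form \<Phi> x y = 0) \<Longrightarrow> x = 0"
begin

lemma form_eq: "form \<Phi> x y = (\<Phi> *v x) \<bullet> y"
  unfolding form_def using symmetric_inner[OF sym] .

lemma form_sym: "form \<Phi> x y = form \<Phi> y x"
  unfolding form_eq[of x y] by (simp add: form_def inner_commute)

lemma form_scale: "form \<Phi> (a *\<^sub>R x) y = a * form \<Phi> x y" "form \<Phi> x (a *\<^sub>R y) = a * form \<Phi> x y"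
  unfolding form_eq by (simp_all add: matrix_vector_mult_scaleR)

lemma mult_eq_0: "\<Phi> *v x = 0 \<Longrightarrow> x = 0"
  using nd[of x] unfolding form_eq by simp

lemma inj_mult: "inj ((*v) \<Phi>)"
  using linear_injective_0[OF matrix_vector_mul_linear, of \<Phi>] mult_eq_0 by blast

lemma surj_mult: "surj ((*v) \<Phi>)"
  using inj_mult linear_injective_imp_surjective[OF matrix_vector_mul_linear] by blast

lemma triple_product: "(A ** \<Phi> ** Finite_Cartesian_Product.transpose B) $ x $ y = form \<Phi> (A $ x) (B $ y)"
proof -
  have "(A ** \<Phi> ** Finite_Cartesian_Product.transpose B) $ x $ y =
      (\<Sum>l\<in>UNIV. \<Sum>k\<in>UNIV. A $ x $ k * \<Phi> $ k $ l * B $ y $ l)"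
    by (simp add: matrix_matrix_mult_def Finite_Cartesian_Product.transpose_def sum_distrib_right)
  also have "\<dots> = (\<Sum>k\<in>UNIV. \<Sum>l\<in>UNIV. A $ x $ k * \<Phi> $ k $ l * B $ y $ l)" by (rule sum.swap)
  also have "\<dots> = form \<Phi> (A $ x) (B $ y)"
    unfolding form_def inner_vec_def matrix_vector_mult_def by (simp add: sum_distrib_left mult.assoc)
  finally show ?thesis .
qed

lemma gram_det:
  assumes G: "\<And>i k. G $ i $ k = form \<Phi> (h i) (h k)" and l: "length is = CARD('n)" "length js = CARD('n)"
  shows "Determinant.det (submatrix_of G is js) =
    Determinants.det (list_matrix h is) * Determinants.det \<Phi> * Determinants.det (list_matrix h js)"
proof -
  let ?M = "list_matrix h is ** \<Phi> ** Finite_Cartesian_Product.transpose (list_matrix h js)"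
  have "submatrix_of G is js = Matrix.mat CARD('n) CARD('n) (\<lambda>(a, b). ?M $ (enum a) $ (enum b))"
    unfolding submatrix_of_def l triple_product
    by (rule eq_matI) (auto simp: list_matrix_def index_enum G)
  hence "Determinant.det (submatrix_of G is js) = Determinants.det ?M" using det_bridge[OF enum_bij, of ?M] by simp
  thus ?thesis by (simp add: det_mul)
qed

text \<open>Rank-nullity for the map that evaluates the form against the \<open>h i\<close>: its
  kernel on their span is the radical of the form there.\<close>

lemma gram_rank:
  assumes G: "\<And>i k. G $ i $ k = form \<Phi> (h i) (h k)" and d: "distinct is"
  shows "vec_space.rank (length is) (submatrix_of G is is) +
    dim (span (h ` set is) \<inter> {x. \<forall>i\<in>set is. form \<Phi> (h i) x = 0}) = dim (span (h ` set is))"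
proof -
  let ?T = "\<lambda>x. \<chi> i. if i \<in> set is then form \<Phi> (h i) x else 0"
  have T: "linear ?T" unfolding form_eq
    by (rule linearI) (auto simp: Finite_Cartesian_Product.vec_eq_iff inner_add_right)
  have "(\<lambda>k. \<chi> i. if i \<in> set is then G $ i $ k else 0) ` set is = ?T ` (h ` set is)"
    unfolding image_image G ..
  hence "vec_space.rank (length is) (submatrix_of G is is) = dim (?T ` (h ` set is))"
    using rank_submatrix[OF d, of G] by simp
  also have "\<dots> = dim (?T ` span (h ` set is))" by (simp only: linear_span_image[OF T, symmetric] dim_span)
  finally have "vec_space.rank (length is) (submatrix_of G is is) = dim (?T ` span (h ` set is))" .
  moreover have "{x. ?T x = 0} = {x. \<forall>i\<in>set is. form \<Phi> (h i) x = 0}"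
    by (auto simp: Finite_Cartesian_Product.vec_eq_iff)
  ultimately show ?thesis using dim_kernel_image[OF T subspace_span, of "h ` set is"] by simp
qed

lemma dim_form_orthogonal: "dim {x. \<forall>i\<in>A. form \<Phi> (h i) x = 0} + dim (span (h ` A)) = CARD('n)"
proof -
  let ?S = "span ((\<lambda>i. \<Phi> *v h i) ` A)"
  have "dim {y \<in> UNIV. \<forall>x \<in> ?S. Linear_Algebra.orthogonal x y} + dim ?S = dim (UNIV :: (real^'n) set)"
    by (intro dim_subspace_orthogonal_to_vectors) auto
  moreover have "{y \<in> UNIV. \<forall>x \<in> ?S. Linear_Algebra.orthogonal x y} = {x. \<forall>i\<in>A. form \<Phi> (h i) x = 0}"
  proof (intro equalityI subsetI)
    fix y assume "y \<in> {x. \<forall>i\<in>A. form \<Phi> (h i) x = 0}"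
    hence "(\<lambda>i. \<Phi> *v h i) ` A \<subseteq> {x. y \<bullet> x = 0}" unfolding form_eq by (auto simp: inner_commute)
    hence "?S \<subseteq> {x. y \<bullet> x = 0}" by (intro span_minimal subspace_hyperplane)
    thus "y \<in> {y \<in> UNIV. \<forall>x \<in> ?S. Linear_Algebra.orthogonal x y}"
      by (auto simp: Linear_Algebra.orthogonal_def inner_commute)
  next
    fix y assume y: "y \<in> {y \<in> UNIV. \<forall>x \<in> ?S. Linear_Algebra.orthogonal x y}"
    have "\<Phi> *v h i \<in> ?S" if "i \<in> A" for i using that by (intro span_base) blast
    thus "y \<in> {x. \<forall>i\<in>A. form \<Phi> (h i) x = 0}" using y unfolding form_eq Linear_Algebra.orthogonal_def by blast
  qed
  moreover have "dim ?S = dim (span (h ` A))"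
  proof -
    have "(\<lambda>i. \<Phi> *v h i) ` A = (*v) \<Phi> ` (h ` A)" unfolding image_image ..
    moreover have "dim ((*v) \<Phi> ` (h ` A)) = dim (h ` A)"
      by (intro dim_image_eq matrix_vector_mul_linear) (use inj_mult inj_on_subset in blast)
    ultimately show ?thesis by (simp only: dim_span)
  qed
  ultimately show ?thesis by simp
qed

text \<open>The map from coefficients to combinations of the \<open>h i\<close> is onto and pulls
  the form of \<open>\<Phi>\<close> back to that of \<open>G\<close>, so inertia applies.\<close>

lemma signature_gram:
  fixes h :: "'i::finite \<Rightarrow> real^'n"
  assumes G: "\<And>i k. G $ i $ k = form \<Phi> (h i) (h k)" and h: "span (range h) = UNIV"
  shows "Finite_Cartesian_Product.transpose G = G" "signature G = signature \<Phi>"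
proof -
  show tG: "Finite_Cartesian_Product.transpose G = G"
    by (simp add: Finite_Cartesian_Product.vec_eq_iff Finite_Cartesian_Product.transpose_def G form_sym[of "h _" "h _"])
  define T where "T x = (\<Sum>i\<in>UNIV. (x $ i) *\<^sub>R h i)" for x :: "real^'i"
  have T: "linear T" unfolding T_def
    by (rule linearI) (auto simp: scaleR_add_left sum.distrib scaleR_sum_right)
  have "h i \<in> range T" for i
  proof -
    have "T (axis i 1) = (\<Sum>k\<in>UNIV. if k = i then h k else 0)"
      unfolding T_def by (rule sum.cong) (auto simp: axis_def)
    hence "h i = T (axis i 1)" by simp
    thus ?thesis by blast
  qed
  hence "span (range h) \<subseteq> range T" using linear_subspace_image[OF T subspace_UNIV] by (intro span_minimal) auto
  hence "surj T" using h by blast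
  moreover have "x \<bullet> (G *v x) = T x \<bullet> (\<Phi> *v T x)" for x
  proof -
    have "\<Phi> *v T x = (\<Sum>k\<in>UNIV. (x $ k) *\<^sub>R (\<Phi> *v h k))"
      unfolding T_def by (subst linear_sum[OF matrix_vector_mul_linear]) (simp add: matrix_vector_mult_scaleR)
    hence r: "h i \<bullet> (\<Phi> *v T x) = (\<Sum>k\<in>UNIV. x $ k * (h i \<bullet> (\<Phi> *v h k)))" for i
      by (simp add: inner_sum_right)
    have l: "T x \<bullet> z = (\<Sum>i\<in>UNIV. x $ i * (h i \<bullet> z))" for z
      unfolding T_def by (simp add: inner_sum_left)
    have "T x \<bullet> (\<Phi> *v T x) = (\<Sum>i\<in>UNIV. \<Sum>k\<in>UNIV. x $ i * (x $ k * (h i \<bullet> (\<Phi> *v h k))))"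
      by (simp only: l r sum_distrib_left)
    also have "\<dots> = x \<bullet> (G *v x)"
      unfolding inner_vec_def matrix_vector_mult_def G form_def by (simp add: sum_distrib_left algebra_simps)
    finally show ?thesis by simp
  qed
  ultimately show "signature G = signature \<Phi>" by (intro signature_pullback[OF tG sym T])
qed

end

section \<open>Orientation of flags\<close>

locale gram_cone = nondegenerate_form \<Phi> + dual_pair R "\<lambda>i. \<Phi> *v h i" v
  for \<Phi> :: "real^'n^'n" and R :: "('i::finite \<times> 'j::finite) set" and h :: "'i \<Rightarrow> real^'n" and v :: "'j \<Rightarrow> real^'n"
begin

text \<open>A vector orthogonal to all \<open>h i\<close> is the image of some \<open>z\<close>
  under \<open>\<Phi>\<close>; by symmetry of the form all normals vanish at \<open>z\<close>,
  against pointedness.\<close>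

lemma span_h: "span (range h) = UNIV"
proof (rule ccontr)
  assume "span (range h) \<noteq> UNIV"
  then obtain a where a: "a \<noteq> 0" "\<forall>x\<in>span (range h). a \<bullet> x = 0" using span_not_UNIV_orthogonal by blast
  obtain z where z: "a = \<Phi> *v z" using surj_mult by (metis surjD)
  have "(\<Phi> *v h i) \<bullet> z = 0" for i
  proof -
    have "(\<Phi> *v h i) \<bullet> z = a \<bullet> h i" using form_eq[of "h i" z] form_eq[of z "h i"] form_sym z by metis
    thus ?thesis using a(2) by (simp add: span_base)
  qed
  hence "z = 0" by (rule pointed)
  with z a(1) show False by simp
qed

lemma rk_top': "rk (face_top R) = CARD('n)"
  using rk_top by simp

definition flag_elem :: "('i set \<times> 'j set) set \<Rightarrow> nat \<Rightarrow> 'i set \<times> 'j set" where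
  "flag_elem F k = (THE a. a \<in> F \<and> rk a = k)"

lemma flag_elem_eq: "flag F \<Longrightarrow> a \<in> F \<Longrightarrow> flag_elem F (rk a) = a"
  unfolding flag_elem_def using flag_bij[of F] unfolding bij_betw_def inj_on_def by (intro the_equality) auto

lemma flag_elem: assumes "flag F" "k \<le> CARD('n)" shows "flag_elem F k \<in> F" "rk (flag_elem F k) = k"
proof -
  obtain x where x: "x \<in> F" "rk x = k" using flag_obtain[OF assms(1)] assms(2) rk_top' by metis
  hence "flag_elem F k = x" using flag_elem_eq[OF assms(1) x(1)] by simp
  with x show "flag_elem F k \<in> F" "rk (flag_elem F k) = k" by auto
qed

lemma flag_elem_in: "flag F \<Longrightarrow> k \<le> CARD('n) \<Longrightarrow> flag_elem F k \<in> maxbicliques R"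
  using flag_elem(1) flag_subset by blast

lemma flag_elem_below: "flag F \<Longrightarrow> k \<le> m \<Longrightarrow> m \<le> CARD('n) \<Longrightarrow> below (flag_elem F k) (flag_elem F m)"
  using flag_le[of F "flag_elem F k" "flag_elem F m"] flag_elem[of F k] flag_elem[of F m] by simp

lemma U_flag:
  assumes F: "flag F"
  shows "k \<le> CARD('n) \<Longrightarrow> U (flag_elem F k) \<subseteq> span ((\<lambda>m. w (flag_elem F m)) ` {1..k})"
proof (induction k)
  case 0
  have "dim (U (flag_elem F 0)) = 0" using flag_elem(2)[OF F, of 0] unfolding rk_def by simp
  hence "U (flag_elem F 0) \<subseteq> {0}" by (simp only: dim_eq_0)
  thus ?case using span_0 by blast
next
  case (Suc k)
  let ?c = "flag_elem F k" and ?b = "flag_elem F (Suc k)"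
  let ?S = "span ((\<lambda>m. w (flag_elem F m)) ` {1..Suc k})"
  have X: "?c \<in> maxbicliques R" "?b \<in> maxbicliques R" "below ?c ?b" "rk ?c + 1 = rk ?b"
    using flag_elem_in[OF F] flag_elem_below[OF F] flag_elem(2)[OF F] Suc.prems by auto
  have "\<not> below ?b ?c" using below_antisym[OF X(1,2,3)] X(4) by auto
  hence wb: "w ?b \<notin> U ?c" using w_in_U_iff[OF X(1,2)] by blast
  show ?case
  proof
    fix x assume x: "x \<in> U ?b"
    obtain a where a: "x - a *\<^sub>R w ?b \<in> U ?c" using cover_decomp[OF X x w_in_U wb] by blast
    have "span ((\<lambda>m. w (flag_elem F m)) ` {1..k}) \<subseteq> ?S" by (intro span_mono) auto
    hence "x - a *\<^sub>R w ?b \<in> ?S" using a Suc by auto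
    moreover have "a *\<^sub>R w ?b \<in> ?S" by (intro span_scale span_base) auto
    ultimately show "x \<in> ?S" using span_add[of "x - a *\<^sub>R w ?b" _ "a *\<^sub>R w ?b"] by simp
  qed
qed

text \<open>Interior points of the flag in descending rank: the row with index \<open>t\<close>
  belongs to the face of corank \<open>t\<close>, matching the meet of the first \<open>t\<close>
  facets of a super cycle. The least face is left out.\<close>

definition flag_rows :: "('i set \<times> 'j set) set \<Rightarrow> 'n \<Rightarrow> real^'n" where
  "flag_rows F x = w (flag_elem F (CARD('n) - index x))"

definition flag_det :: "('i set \<times> 'j set) set \<Rightarrow> real" where
  "flag_det F = Determinants.det (\<chi> x. flag_rows F x)"

definition rank_row :: "nat \<Rightarrow> 'n" where "rank_row k = enum (CARD('n) - k)"

lemma rank_row: "1 \<le> k \<Longrightarrow> k \<le> CARD('n) \<Longrightarrow> CARD('n) - index (rank_row k :: 'n) = k"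
  unfolding rank_row_def by (subst index_enum) auto

lemma flag_rows_rank_row: "1 \<le> k \<Longrightarrow> k \<le> CARD('n) \<Longrightarrow> flag_rows F (rank_row k) = w (flag_elem F k)"
  unfolding flag_rows_def by (simp add: rank_row)

lemma rank_row_inj: "1 \<le> k \<Longrightarrow> k \<le> CARD('n) \<Longrightarrow> 1 \<le> m \<Longrightarrow> m \<le> CARD('n) \<Longrightarrow> rank_row k = rank_row m \<Longrightarrow> k = m"
  by (metis rank_row)

lemma flag_det_nonzero:
  assumes F: "flag F"
  shows "flag_det F \<noteq> 0"
  unfolding flag_det_def det_rows_nonzero
proof -
  have "U (flag_elem F CARD('n)) = UNIV"
    using flag_elem(2)[OF F order_refl] subspace_dim_equal[OF U_subspace subspace_UNIV, of "flag_elem F CARD('n)"]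
    unfolding rk_def by simp
  moreover have "(\<lambda>m. w (flag_elem F m)) ` {1..CARD('n)} \<subseteq> range (flag_rows F)"
  proof
    fix y assume "y \<in> (\<lambda>m. w (flag_elem F m)) ` {1..CARD('n)}"
    then obtain m where "1 \<le> m" "m \<le> CARD('n)" "y = w (flag_elem F m)" by auto
    hence "y = flag_rows F (rank_row m)" by (simp add: flag_rows_rank_row)
    thus "y \<in> range (flag_rows F)" by blast
  qed
  ultimately show "span (range (flag_rows F)) = UNIV"
    using U_flag[OF F order_refl] span_mono by blast
qed

text \<open>The two matrices differ in one row, which holds \<open>w c\<close> or
  \<open>w c'\<close>. By \<open>rank_two_top\<close> a positive combination of these two is
  \<open>w b\<close> modulo \<open>U e\<close>, and both \<open>w b\<close> and \<open>U e\<close>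
  lie in the span of the other rows. So the same positive combination of the two determinants is
  0.\<close>

lemma flag_det_flip:
  assumes F: "flag F" "flag F'" and c: "card (F - F') = 1" "card (F' - F) = 1"
  shows "flag_det F * flag_det F' < 0"
proof -
  obtain c c' where cc: "F - F' = {c}" "F' - F = {c'}" "rk c = rk c'" "0 < rk c" "rk c < rk (face_top R)"
    using flag_swap[OF F c] .
  define k where "k = rk c"
  have k: "1 \<le> k" "k < CARD('n)" using cc(4,5) rk_top' unfolding k_def by auto
  have cF: "c \<in> F" "c' \<in> F'" "c \<notin> F'" "c' \<notin> F" using cc by blast+
  have fc: "flag_elem F k = c" "flag_elem F' k = c'"
    using flag_elem_eq[OF F(1) cF(1)] flag_elem_eq[OF F(2) cF(2)] cc(3) unfolding k_def by auto
  have same: "flag_elem F' m = flag_elem F m" if "m \<noteq> k" "m \<le> CARD('n)" for m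
  proof -
    have "flag_elem F m \<noteq> c" using flag_elem(2)[OF F(1) that(2)] that(1) unfolding k_def by auto
    hence "flag_elem F m \<in> F'" using flag_elem(1)[OF F(1) that(2)] cc(1) by blast
    thus ?thesis using flag_elem_eq[OF F(2)] flag_elem(2)[OF F(1) that(2)] by metis
  qed
  let ?x = "rank_row k :: 'n"
  define e where "e = flag_elem F (k - 1)"
  define b where "b = flag_elem F (k + 1)"
  have X: "e \<in> maxbicliques R" "c \<in> maxbicliques R" "c' \<in> maxbicliques R" "b \<in> maxbicliques R"
    unfolding e_def b_def using flag_elem_in[OF F(1)] k cF flag_subset F by auto
  have le: "below e c" "below c b" unfolding e_def b_def fc(1)[symmetric]
    using flag_elem_below[OF F(1), of "k - 1" k] flag_elem_below[OF F(1), of k "k + 1"] k by auto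
  have le': "below e c'" "below c' b" unfolding e_def b_def fc(2)[symmetric]
    using flag_elem_below[OF F(2), of "k - 1" k] flag_elem_below[OF F(2), of k "k + 1"] k same[of "k - 1"] same[of "k + 1"] by auto
  have rks: "rk e + 1 = rk c" "rk c + 1 = rk b"
    unfolding e_def b_def using flag_elem(2)[OF F(1), of "k - 1"] flag_elem(2)[OF F(1), of "k + 1"] k
    by (auto simp: k_def)
  have "c \<noteq> c'" using cF by blast
  then obtain a a' where a: "a > 0" "a' > 0" "w b - a *\<^sub>R w c - a' *\<^sub>R w c' \<in> U e"
    using rank_two_top[OF X le(1) le'(1) le(2) le'(2) rks cc(3)[symmetric]] by blast
  have rows: "flag_rows F x = flag_rows F' x" if "x \<noteq> ?x" for x
  proof -
    have "CARD('n) - index x \<noteq> k"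
    proof
      assume "CARD('n) - index x = k"
      hence "CARD('n) - k = index x" using index_less[of x] by simp
      hence "?x = x" unfolding rank_row_def by simp
      with that show False by simp
    qed
    thus ?thesis unfolding flag_rows_def using same by simp
  qed
  let ?D = "rowdet (flag_rows F) ?x"
  have D: "flag_det F = ?D (w c)"
    unfolding flag_det_def rowdet_self[of "flag_rows F" ?x, symmetric] using flag_rows_rank_row[of k F] k fc by simp
  have "flag_det F' = rowdet (flag_rows F') ?x (w c')"
    unfolding flag_det_def rowdet_self[of "flag_rows F'" ?x, symmetric] using flag_rows_rank_row[of k F'] k fc by simp
  hence D': "flag_det F' = ?D (w c')" using rowdet_cong[of ?x "flag_rows F" "flag_rows F'"] rows by simp
  have other: "w (flag_elem F m) \<in> flag_rows F ` (- {?x})" if "1 \<le> m" "m \<le> CARD('n)" "m \<noteq> k" for m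
  proof -
    have "w (flag_elem F m) = flag_rows F (rank_row m)" using flag_rows_rank_row that by simp
    moreover have "rank_row m \<noteq> ?x" using rank_row_inj[of m k] that k by auto
    ultimately show ?thesis by blast
  qed
  have "w b \<in> span (flag_rows F ` (- {?x}))" unfolding b_def using k by (intro span_base other) auto
  hence Db: "?D (w b) = 0" by (rule rowdet_span)
  have "(\<lambda>m. w (flag_elem F m)) ` {1..k - 1} \<subseteq> flag_rows F ` (- {?x})" using k by (auto intro!: other)
  hence "span ((\<lambda>m. w (flag_elem F m)) ` {1..k - 1}) \<subseteq> span (flag_rows F ` (- {?x}))" by (rule span_mono)
  moreover have "U e \<subseteq> span ((\<lambda>m. w (flag_elem F m)) ` {1..k - 1})"
    unfolding e_def by (rule U_flag[OF F(1)]) (use k in simp)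
  ultimately have "U e \<subseteq> span (flag_rows F ` (- {?x}))" by blast
  hence "?D (w b - a *\<^sub>R w c - a' *\<^sub>R w c') = 0" using a(3) rowdet_span by blast
  hence "a' * ?D (w c') = - a * ?D (w c)"
    using Db by (simp add: linear_diff[OF linear_rowdet] linear_scale[OF linear_rowdet])
  hence "flag_det F * (a' * flag_det F') = flag_det F * (- a * flag_det F)" unfolding D D' by simp
  hence "a' * (flag_det F * flag_det F') = - a * (flag_det F)\<^sup>2"
    by (simp add: power2_eq_square mult.left_commute)
  also have "\<dots> < 0" using a(1) flag_det_nonzero[OF F(1)] by simp
  finally show ?thesis using a(2) by (simp add: mult_less_0_iff)
qed

lemma flag_graph_bipartite: "bipartite (flag_graph (maxbiclique_lattice R))"
proof -
  let ?F = "flags (maxbiclique_lattice R)"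
  let ?P = "{F \<in> ?F. 0 < flag_det F}" and ?Q = "{F \<in> ?F. flag_det F < 0}"
  have "?P \<union> ?Q = ?F" using flag_det_nonzero flags_iff by (auto simp: order_less_le)
  moreover have "(F, F') \<in> ?P \<times> ?Q \<union> ?Q \<times> ?P" if "(F, F') \<in> parcs (flag_graph (maxbiclique_lattice R))" for F F'
  proof -
    have F: "F \<in> ?F" "F' \<in> ?F" "card (F - F') = 1" "card (F' - F) = 1" using that unfolding flag_graph_def by auto
    hence "flag_det F * flag_det F' < 0" using flag_det_flip flags_iff by blast
    thus ?thesis using F by (auto simp: mult_less_0_iff)
  qed
  ultimately have "bipartition (flag_graph (maxbiclique_lattice R)) ?P ?Q"
    unfolding bipartition_def by (auto simp: flag_graph_def)
  thus ?thesis unfolding bipartite_def by blast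
qed

text \<open>An arbitrary bipartition and the sign of \<open>flag_det\<close> both switch along every
  edge. The flags where they agree, compared with \<open>x\<close>, therefore form a nonempty set
  closed under edges, which is everything.\<close>

lemma same_part_flag_det:
  assumes "same_part (flag_graph (maxbiclique_lattice R)) x y"
  shows "flag x" "flag y" "0 < flag_det x * flag_det y"
proof -
  let ?F = "flags (maxbiclique_lattice R)"
  obtain P Q where PQ: "bipartition (flag_graph (maxbiclique_lattice R)) P Q" "x \<in> P" "y \<in> P"
    using assms unfolding same_part_def by blast
  have un: "P \<union> Q = ?F" "P \<inter> Q = {}"
    and arc: "\<And>F F'. F \<in> ?F \<Longrightarrow> F' \<in> ?F \<Longrightarrow> card (F - F') = 1 \<Longrightarrow> card (F' - F) = 1 \<Longrightarrow> (F, F') \<in> P \<times> Q \<union> Q \<times> P"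
    using PQ(1) unfolding bipartition_def flag_graph_def by auto
  show xy: "flag x" "flag y" using PQ un flags_iff by blast+
  let ?T = "{F \<in> ?F. F \<in> P \<longleftrightarrow> 0 < flag_det x * flag_det F}"
  have "0 < flag_det x * flag_det x" using flag_det_nonzero[OF xy(1)] by (auto simp: zero_less_mult_iff linorder_neq_iff)
  hence "x \<in> ?T" using PQ(2) un by blast
  moreover have "F' \<in> ?T" if F: "F \<in> ?T" "F' \<in> ?F" "card (F - F') = 1" "card (F' - F) = 1" for F F'
  proof -
    have fl: "flag_det F * flag_det F' < 0" using flag_det_flip F flags_iff by blast
    have "F' \<in> P \<longleftrightarrow> F \<notin> P" using arc[of F F'] F un by blast
    also have "\<dots> \<longleftrightarrow> \<not> 0 < flag_det x * flag_det F" using F(1) by blast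
    also have "\<dots> \<longleftrightarrow> 0 < flag_det x * flag_det F'"
      using fl flag_det_nonzero[OF xy(1)] by (auto simp: zero_less_mult_iff mult_less_0_iff)
    finally show ?thesis using F(2) by blast
  qed
  ultimately have "?T = ?F" by (intro flag_graph_closed) blast+
  moreover have "y \<in> ?F" using PQ un by blast
  ultimately show "0 < flag_det x * flag_det y" using PQ(3) by blast
qed

text \<open>The matrix of the values of the form between the facet normals of a super cycle and the flag
  vectors is triangular with negative diagonal.\<close>

lemma super_cycle_det:
  assumes card: "CARD('n) = d + 1" and sc: "super_cycle R d is" and fl: "flag (induced_flag R d is)"
  shows "0 < (- 1) ^ CARD('n) * (Determinants.det (list_matrix h is) * Determinants.det \<Phi> * flag_det (induced_flag R d is))"
proof -
  let ?F = "induced_flag R d is"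
  define a where "a t = row_face R (set (take t is))" for t
  have len: "length is = d + 1" and a_last: "a (d + 1) = face_bot R"
    using sc unfolding super_cycle_def a_def by (simp_all add: facet_meet_eq)
  have F: "?F = a ` {0..d + 1}"
  proof -
    have "{0..d + 1} = {0} \<union> {d + 1} \<union> {1..d}" by auto
    hence "a ` {0..d + 1} = {a 0} \<union> {a (d + 1)} \<union> a ` {1..d}" by (simp only: image_Un image_insert image_empty)
    also have "\<dots> = ?F" unfolding induced_flag_def a_last by (auto simp: a_def facet_meet_eq)
    finally show ?thesis by simp
  qed
  have "card ?F = card {0..rk (face_top R)}" using bij_betw_same_card[OF flag_bij[OF fl]] .
  hence "card ?F = d + 2" using rk_top' card by simp
  \<comment> \<open>A flag has \<open>d + 2\<close> elements, as many as there are partial meets. So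
    no two partial meets coincide, and each facet strictly lowers the meet.\<close>
  hence inj: "inj_on a {0..d + 1}" unfolding F by (intro eq_card_imp_inj_on) auto
  have aX: "a t \<in> maxbicliques R" for t unfolding a_def by (rule row_face_in)
  have step: "below (a (Suc t)) (a t)" for t
    using below_row_face[OF aX[of "Suc t"], of "set (take t is)"] below_row_face[OF row_face_in, of R "set (take (Suc t) is)" "set (take (Suc t) is)"]
      set_take_subset_set_take[of t "Suc t" "is"] unfolding a_def by auto
  have neq: "a (Suc t) \<noteq> a t" if "t \<le> d" for t using inj_onD[OF inj, of "Suc t" t] that by auto
  have dec: "rk (a (Suc t)) < rk (a t)" if "t \<le> d" for t
    using exact_rank_less[OF exact aX aX step neq[OF that]] .
  \<comment> \<open>Ranks drop at each of the \<open>d + 1\<close> steps but must stay between 0 and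
    \<open>d + 1\<close>, so the bounds \<open>up\<close> and \<open>dn\<close> determine
    them.\<close>
  have up: "rk (a t) + t \<le> d + 1" if "t \<le> d + 1" for t
    using that
  proof (induction t)
    case 0
    show ?case using rank_le_top[OF aX[of 0]] rk_top' card by simp
  next
    case (Suc t)
    thus ?case using dec[of t] by simp
  qed
  have dn: "k \<le> d + 1 \<Longrightarrow> k \<le> rk (a (d + 1 - k))" for k
  proof (induction k)
    case (Suc k)
    hence "rk (a (Suc (d - k))) < rk (a (d - k))" by (intro dec) simp
    moreover have "Suc (d - k) = d + 1 - k" using Suc.prems by simp
    ultimately show ?case using Suc by simp
  qed simp
  have rka: "rk (a t) = d + 1 - t" if "t \<le> d + 1" for t using up[OF that] dn[of "d + 1 - t"] that by simp
  have fa: "flag_elem ?F (d + 1 - t) = a t" if "t \<le> d + 1" for t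
    using flag_elem_eq[OF fl, of "a t"] rka[OF that] F that by auto
  let ?M = "list_matrix h is ** \<Phi> ** Finite_Cartesian_Product.transpose (\<chi> x. flag_rows ?F x)"
  have M: "?M $ x $ y = (\<Phi> *v h (is ! index x)) \<bullet> w (a (index y))" for x y
  proof -
    have "index y \<le> d + 1" using index_less[of y] card by simp
    hence "flag_rows ?F y = w (a (index y))" unfolding flag_rows_def card using fa by simp
    thus ?thesis unfolding triple_product form_eq list_matrix_def by simp
  qed
  have "0 < (- 1) ^ CARD('n) * Determinants.det ?M"
  proof (rule det_lower_triangular_sign)
    fix x y :: 'n assume lt: "index x < index y"
    have "index x < length (take (index y) is)" using lt index_less[of y] len card by simp
    hence "take (index y) is ! index x \<in> set (take (index y) is)" by (rule nth_mem)
    hence "is ! index x \<in> set (take (index y) is)" using lt by simp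
    also have "\<dots> \<subseteq> fst (a (index y))" unfolding a_def row_face_def by auto
    finally show "?M $ x $ y = 0" unfolding M using inner_w_iff[OF aX] by blast
  next
    fix x :: 'n
    let ?t = "index x"
    have t: "?t \<le> d" using index_less[of x] card by simp
    have "is ! ?t \<notin> fst (a ?t)"
    proof
      assume i: "is ! ?t \<in> fst (a ?t)"
      have "set (take (Suc ?t) is) = insert (is ! ?t) (set (take ?t is))"
        using t len by (simp add: take_Suc_conv_app_nth)
      also have "\<dots> \<subseteq> fst (a ?t)" using i unfolding a_def row_face_def by auto
      finally have "below (a ?t) (a (Suc ?t))" using below_row_face[OF aX] unfolding a_def by blast
      hence "a (Suc ?t) = a ?t" using below_antisym[OF aX aX step] by blast
      with neq[OF t] show False by blast
    qed
    thus "?M $ x $ x < 0" unfolding M using inner_w_neg[OF aX] by blast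
  qed
  thus ?thesis by (simp add: det_mul flag_det_def)
qed

text \<open>Multiplying the signs of both super cycles squares away the power of \<open>-1\<close>,
  and equal orientation gives the flag determinants the same sign. What remains is the Gram
  determinant times \<open>det \<Phi>\<close>.\<close>

lemma orientation_condition_gram:
  assumes card: "CARD('n) = d + 1" and G: "\<And>i k. G $ i $ k = form \<Phi> (h i) (h k)"
  shows "orientation_condition \<Phi> R d G"
  unfolding orientation_condition_def
proof (intro allI impI)
  fix "is" js assume "super_cycle R d is \<and> super_cycle R d js \<and> same_orientation R d is js"
  hence s: "super_cycle R d is" "super_cycle R d js" "same_part (flag_graph (maxbiclique_lattice R)) (induced_flag R d is) (induced_flag R d js)"
    unfolding same_orientation_def by blast+
  note f = same_part_flag_det[OF s(3)]
  let ?x = "Determinants.det (list_matrix h is)" and ?y = "Determinants.det (list_matrix h js)" and ?p = "Determinants.det \<Phi>"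
  let ?f = "flag_det (induced_flag R d is)" and ?g = "flag_det (induced_flag R d js)"
  have "0 < ((- 1) ^ CARD('n) * (?x * ?p * ?f)) * ((- 1) ^ CARD('n) * (?y * ?p * ?g))"
    by (intro mult_pos_pos super_cycle_det card s f)
  also have "\<dots> = ((- 1) ^ CARD('n) * (- 1) ^ CARD('n)) * ((?x * ?p * ?y * ?p) * (?f * ?g))"
    by (simp add: algebra_simps)
  also have "(- 1) ^ CARD('n) * (- 1) ^ CARD('n) = (1::real)" by (simp add: power_add[symmetric])
  finally have "0 < (?x * ?p * ?y * ?p) * (?f * ?g)" by simp
  hence "0 < ?x * ?p * ?y * ?p" using f(3) by (simp only: zero_less_mult_pos2)
  moreover have "length is = CARD('n)" "length js = CARD('n)" using s card unfolding super_cycle_def by auto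
  ultimately show "0 < Determinant.det (submatrix_of G is js) * ?p"
    using gram_det[of G h "is" js, OF G] by simp
qed

text \<open>The normals at \<open>j\<close> span the hyperplane orthogonal to \<open>v j\<close>,
  whose own orthogonal space is the line of \<open>v j\<close>. The Gram rank is \<open>d\<close>
  minus the dimension of the intersection of the two, which is trivial iff \<open>v j\<close> is not
  null.\<close>

lemma vertex_condition_gram:
  assumes card: "CARD('n) = d + 1" and G: "\<And>i k. G $ i $ k = form \<Phi> (h i) (h k)"
    and rk1: "rk (vertex R j) = 1"
  shows "vertex_condition R d G j \<longleftrightarrow> form \<Phi> (v j) (v j) \<noteq> 0"
proof -
  let ?A = "{i. (i, j) \<in> R}"
  let ?W = "span (h ` ?A)"
  let ?K = "{x. \<forall>i\<in>?A. form \<Phi> (h i) x = 0}"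
  have fA: "fst (vertex R j) = ?A" unfolding vertex_def by simp
  have jv: "j \<in> snd (vertex R j)" unfolding vertex_def by simp
  have "U (vertex R j) = span {v j}"
  proof (rule subspace_dim_equal[symmetric, OF subspace_span U_subspace])
    show "span {v j} \<subseteq> U (vertex R j)" using v_in_U[OF jv] by (intro span_minimal U_subspace) simp
    show "dim (U (vertex R j)) \<le> dim (span {v j})" using rk1 v_nonzero[of j] unfolding rk_def by (simp add: dim_insert)
  qed
  moreover have "?K = U (vertex R j)"
    unfolding form_eq using kernel_face[OF vertex_in, of j] inner_U[OF vertex_in, of _ j] unfolding fA by blast
  ultimately have K: "?K = span {v j}" by simp
  have dK: "dim ?K = 1" unfolding K using v_nonzero[of j] by (simp add: dim_insert)
  have dW: "dim ?W = d" using dim_form_orthogonal[of ?A h] dK card by simp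
  let ?H = "{y. form \<Phi> (v j) y = 0}"
  have "\<Phi> *v v j \<noteq> 0" using mult_eq_0 v_nonzero by blast
  hence dH: "dim ?H = d" unfolding form_eq using dim_hyperplane[of "\<Phi> *v v j"] card by simp
  have sH: "Real_Vector_Spaces.subspace ?H" unfolding form_eq by (rule subspace_hyperplane)
  have "v j \<in> ?K" unfolding K by (simp add: span_base)
  hence "h ` ?A \<subseteq> ?H" using form_sym by auto
  hence "?W \<subseteq> ?H" by (intro span_minimal sH)
  hence WH: "?W = ?H" using dW dH by (intro subspace_dim_equal subspace_span sH) auto
  have rank: "vec_space.rank (length is) (submatrix_of G is is) + dim (?W \<inter> ?K) = d"
    if "distinct is" "set is = ?A" for "is"
    using gram_rank[of G h "is", OF G that(1)] that(2) dW by simp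
  have d0: "dim (?W \<inter> ?K) = 0 \<longleftrightarrow> form \<Phi> (v j) (v j) \<noteq> 0"
  proof
    assume "dim (?W \<inter> ?K) = 0"
    hence "?W \<inter> ?K \<subseteq> {0}" by (simp only: dim_eq_0)
    moreover have "v j \<in> ?K" unfolding K by (simp add: span_base)
    ultimately show "form \<Phi> (v j) (v j) \<noteq> 0" using v_nonzero[of j] WH by blast
  next
    assume nz: "form \<Phi> (v j) (v j) \<noteq> 0"
    have "x = 0" if x: "x \<in> ?W \<inter> ?K" for x
    proof -
      have "x \<in> span {v j}" using x K by blast
      then obtain c where c: "x = c *\<^sub>R v j" by (auto simp: span_singleton)
      moreover have "form \<Phi> (v j) x = 0" using x WH by blast
      ultimately show ?thesis using nz by (simp add: form_scale)
    qed
    hence "?W \<inter> ?K \<subseteq> {0}" by blast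
    thus "dim (?W \<inter> ?K) = 0" by (simp only: dim_eq_0)
  qed
  obtain "is" where isA: "distinct is" "set is = ?A" using finite_distinct_list[of ?A] by auto
  show ?thesis
  proof
    assume "vertex_condition R d G j"
    hence "vec_space.rank (length is) (submatrix_of G is is) = d" using isA unfolding vertex_condition_def by blast
    thus "form \<Phi> (v j) (v j) \<noteq> 0" using rank[OF isA] d0 by simp
  next
    assume "form \<Phi> (v j) (v j) \<noteq> 0"
    hence "dim (?W \<inter> ?K) = 0" using d0 by blast
    thus "vertex_condition R d G j" unfolding vertex_condition_def using rank by (metis add.right_neutral)
  qed
qed

end

section \<open>Normals of realizations\<close>

lemma proportional_normals:
  fixes a b :: "'a::euclidean_space"
  assumes "\<And>x. a \<bullet> x = 0 \<Longrightarrow> b \<bullet> x = 0" "a \<noteq> 0"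
  obtains c where "b = c *\<^sub>R a"
proof -
  let ?x = "b - ((a \<bullet> b) / (a \<bullet> a)) *\<^sub>R a"
  have ax: "a \<bullet> ?x = 0" using assms(2) by (simp add: inner_diff_right)
  hence "b \<bullet> ?x = 0" by (rule assms(1))
  hence "?x \<bullet> ?x = 0" using ax by (simp add: inner_diff_left)
  hence "b = ((a \<bullet> b) / (a \<bullet> a)) *\<^sub>R a" by simp
  with that show ?thesis by blast
qed

context nondegenerate_form
begin

lemma proportional_form_normals:
  assumes "\<And>x. form \<Phi> a x = 0 \<Longrightarrow> form \<Phi> b x = 0" "a \<noteq> 0"
  obtains c where "b = c *\<^sub>R a"
proof -
  have "\<Phi> *v a \<noteq> 0" using mult_eq_0 assms(2) by blast
  then obtain c where "\<Phi> *v b = c *\<^sub>R (\<Phi> *v a)"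
    using proportional_normals[of "\<Phi> *v a" "\<Phi> *v b"] assms(1) unfolding form_eq by metis
  hence "\<Phi> *v b = \<Phi> *v (c *\<^sub>R a)" by (simp add: matrix_vector_mult_scaleR)
  hence "b = c *\<^sub>R a" using inj_mult by (metis injD)
  with that show ?thesis by blast
qed

text \<open>The hyperplane fixes a normal up to a factor, the normalisation up to sign, and the
  point \<open>w\<close> off the hyperplane fixes the sign.\<close>

lemma outward_normal_eq:
  assumes h: "\<bar>form \<Phi> h h\<bar> = 1" "span F = {x. form \<Phi> h x = 0}" "C \<subseteq> {x. form \<Phi> h x \<le> 0}"
    and w: "w \<in> C" "form \<Phi> h w < 0"
  shows "outward_normal \<Phi> C F = h"
  unfolding outward_normal_def
proof (rule the_equality)
  show "\<bar>form \<Phi> h h\<bar> = 1 \<and> {x. form \<Phi> h x = 0} = span F \<and> C \<subseteq> {x. form \<Phi> h x \<le> 0}" using h by blast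
  fix k assume k: "\<bar>form \<Phi> k k\<bar> = 1 \<and> {x. form \<Phi> k x = 0} = span F \<and> C \<subseteq> {x. form \<Phi> k x \<le> 0}"
  have "h \<noteq> 0" using h(1) by (auto simp: form_def)
  then obtain c where c: "k = c *\<^sub>R h"
    using proportional_form_normals[of h k] k h(2) by blast
  have "c * c * form \<Phi> h h = form \<Phi> k k" unfolding c by (simp add: form_scale)
  hence "\<bar>c * c\<bar> * \<bar>form \<Phi> h h\<bar> = \<bar>form \<Phi> k k\<bar>" by (metis abs_mult)
  hence "c * c = 1" using h(1) k by simp
  hence "c = 1 \<or> c = - 1" by (simp add: square_eq_1_iff)
  moreover have "c \<noteq> - 1"
  proof
    assume "c = - 1"
    hence "form \<Phi> k w = - form \<Phi> h w" unfolding c by (simp only: form_scale)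
    moreover have "form \<Phi> k w \<le> 0" using k w(1) by blast
    ultimately show False using w(2) by simp
  qed
  ultimately show "k = h" using c by simp
qed

lemma facet_normals_outward:
  assumes pc: "polyhedral_cone C f" and n: "facet_normals C f (\<lambda>i. \<Phi> *v h i)"
    and unit: "\<And>i. \<bar>form \<Phi> (h i) (h i)\<bar> = 1"
  shows "outward_normal \<Phi> C (f i) = h i" "span (f i) = {x. form \<Phi> (h i) x = 0}"
    "\<exists>w\<in>C. form \<Phi> (h i) w < 0"
proof -
  interpret polyhedral_cone C f by (rule pc)
  show sp: "span (f i) = {x. form \<Phi> (h i) x = 0}" using span_facet[OF n] unfolding form_eq .
  obtain w where w: "w \<in> interior C" using int by blast
  have wC: "w \<in> C" using w interior_subset by blast
  have wn: "form \<Phi> (h i) w < 0" using interior_neg[OF n w] unfolding form_eq .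
  show "\<exists>w\<in>C. form \<Phi> (h i) w < 0" using wC wn by blast
  have le: "C \<subseteq> {x. form \<Phi> (h i) x \<le> 0}" using n_le[OF n] unfolding form_eq by blast
  show "outward_normal \<Phi> C (f i) = h i" by (rule outward_normal_eq[OF unit sp le wC wn])
qed

text \<open>Euclidean normals become normals \<open>k i\<close> for the form because
  \<open>\<Phi>\<close> is onto. As the facet hyperplanes are not lightlike,
  \<open>form \<Phi> (k i) (k i)\<close> is nonzero and rescaling gives the outward normals.\<close>

lemma realization_gram_cone:
  fixes R :: "('i::finite \<times> 'j::finite) set"
  assumes X: "(C, f, r) \<in> realizations \<Phi> R"
  obtains h v where "gram_cone \<Phi> R h v" "\<And>i. \<bar>form \<Phi> (h i) (h i)\<bar> = 1"
    "sign_pattern.V v (face_top R) = C" "\<And>i. f i = sign_pattern.V v (facet R i)"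
    "\<And>j. r j = sign_pattern.V v (vertex R j)" "\<And>j. r j = {t *\<^sub>R v j | t. 0 \<le> t}"
    "indexed_by_irreducibles R" "\<And>i. outward_normal \<Phi> C (f i) = h i"
    "\<And>i. span (f i) = {x. form \<Phi> (h i) x = 0}" "\<And>i. \<exists>w\<in>C. form \<Phi> (h i) w < 0"
proof -
  have tc: "type_cone R (C, f, r)" and nl: "\<And>i. \<not> lightlike_hyperplane \<Phi> (span (f i))"
    using X unfolding realizations_def by blast+
  have tc': "pointed_cone C" "interior C \<noteq> {}" "bij_betw f UNIV {F. F facet_of C}"
    using tc unfolding type_cone_def by auto
  interpret pc: polyhedral_cone C f by unfold_locales (use tc' in auto)
  obtain n where n: "facet_normals C f n" using pc.facet_normals_exist by blast
  have "\<exists>k. n i = \<Phi> *v k" for i using surj_mult by (metis surjD)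
  then obtain k where k: "\<And>i. n i = \<Phi> *v k i" by metis
  have nk: "n i \<bullet> x = form \<Phi> (k i) x" for i x unfolding k form_eq ..
  have k0: "k i \<noteq> 0" for i using pc.n0[OF n, of i] k[of i] by auto
  have nz: "form \<Phi> (k i) (k i) \<noteq> 0" for i
    using nl[of i] k0[of i] pc.span_facet[OF n, of i] unfolding lightlike_hyperplane_def nk by blast
  define h where "h i = (1 / sqrt \<bar>form \<Phi> (k i) (k i)\<bar>) *\<^sub>R k i" for i
  have pos: "0 < 1 / sqrt \<bar>form \<Phi> (k i) (k i)\<bar>" for i using nz by simp
  have hk: "form \<Phi> (h i) x = (1 / sqrt \<bar>form \<Phi> (k i) (k i)\<bar>) * form \<Phi> (k i) x" for i x
    unfolding h_def by (rule form_scale)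
  have unit: "\<bar>form \<Phi> (h i) (h i)\<bar> = 1" for i
  proof -
    have "form \<Phi> (h i) (h i) = form \<Phi> (k i) (k i) / \<bar>form \<Phi> (k i) (k i)\<bar>"
      unfolding hk unfolding h_def form_scale by simp
    thus ?thesis using nz[of i] by simp
  qed
  have hle: "form \<Phi> (h i) x \<le> 0 \<longleftrightarrow> form \<Phi> (k i) x \<le> 0" and h0: "form \<Phi> (h i) x = 0 \<longleftrightarrow> form \<Phi> (k i) x = 0" for i x
    unfolding hk using pos[of i] nz[of i] by (auto simp: mult_le_0_iff mult_less_0_iff divide_le_0_iff divide_less_0_iff)
  have n': "facet_normals C f (\<lambda>i. \<Phi> *v h i)"
    unfolding facet_normals_def form_eq[symmetric] h0 hle
  proof (intro allI conjI)
    fix i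
    have "h i \<noteq> 0" unfolding h_def using k0 nz by simp
    thus "\<Phi> *v h i \<noteq> 0" using mult_eq_0 by blast
    show "C \<subseteq> {x. form \<Phi> (k i) x \<le> 0}" "f i = C \<inter> {x. form \<Phi> (k i) x = 0}"
      using n unfolding facet_normals_def nk by blast+
  qed
  obtain v where v: "dual_pair R (\<lambda>i. \<Phi> *v h i) v" "sign_pattern.V v (face_top R) = C"
    "\<And>i. f i = sign_pattern.V v (facet R i)" "\<And>j. r j = sign_pattern.V v (vertex R j)"
    "\<And>j. r j = {t *\<^sub>R v j | t. 0 \<le> t}" "indexed_by_irreducibles R"
    using type_cone_dual_pair[OF tc n'] by blast
  have gc: "gram_cone \<Phi> R h v" by (intro gram_cone.intro v nondegenerate_form_axioms)
  have pc': "polyhedral_cone C f" by (rule pc.polyhedral_cone_axioms)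
  from that[OF gc unit v(2-6) facet_normals_outward[OF pc' n' unit]] show ?thesis .
qed

end

lemma (in dual_pair) rk_vertex: "indexed_by_irreducibles R \<Longrightarrow> rk (vertex R j) = 1"
  unfolding indexed_by_irreducibles_def join_irr by (auto dest!: bij_betwE)

lemma (in dual_pair) rk_facet: "indexed_by_irreducibles R \<Longrightarrow> rk (facet R i) + 1 = DIM('a)"
  unfolding indexed_by_irreducibles_def meet_irr by (auto dest!: bij_betwE)

lemma (in gram_cone) combinatorial_condition_gram:
  assumes "CARD('n) = d + 1" "indexed_by_irreducibles R"
  shows "combinatorial_condition R d"
  unfolding combinatorial_condition_def
  using assms lattice_facts connected_flag_graph flag_graph_bipartite by simp

lemma (in gram_cone) signature_condition_gram:
  assumes G: "\<And>i k. G $ i $ k = form \<Phi> (h i) (h k)" and unit: "\<And>i. \<bar>form \<Phi> (h i) (h i)\<bar> = 1"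
  shows "signature_condition \<Phi> G"
proof -
  have "G $ i $ i = 1 \<or> G $ i $ i = -1" for i using unit[of i] unfolding G by linarith
  thus ?thesis unfolding signature_condition_def using signature_gram[of G h, OF G span_h] by blast
qed

section \<open>Constructing a cone from its Gram matrix\<close>

text \<open>A flag through the vertex is traced from the top, choosing at each step a facet that
  contains the next face but not the current one. Any facet missing the vertex completes this cycle,
  since only the least face lies strictly below a vertex; the induced flag is the same for all of
  them.\<close>

lemma (in ranked_faces) super_cycles_at_vertex:
  assumes top: "r (face_top R) = d + 1" and j: "r (vertex R j) = 1"
  obtains F cyc where "flag F" "length cyc = d" "set cyc \<subseteq> {i. (i, j) \<in> R}" "\<exists>i. (i, j) \<notin> R"
    "\<And>i. (i, j) \<notin> R \<Longrightarrow> super_cycle R d (cyc @ [i])" "\<And>i. induced_flag R d (cyc @ [i]) = F"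
proof -
  have "pred_on.chain (maxbicliques R) below {vertex R j}"
    unfolding faces.chain_iff using vertex_in by auto
  then obtain F where F: "flag F" "{vertex R j} \<subseteq> F" by (rule faces.chain_extend)
  have "\<exists>x. x \<in> F \<and> r x = d + 1 - t" for t 
    by (rule flag_obtain[OF F(1), of "d + 1 - t"]) (simp add: top, blast)
  \<comment> \<open>\<open>a t\<close> is the element of corank \<open>t\<close>, so that
    \<open>a 0\<close> is the top, \<open>a d\<close> the vertex and \<open>a (d + 1)\<close> the
    least face.\<close>
  then obtain a where a: "\<And>t. a t \<in> F" "\<And>t. r (a t) = d + 1 - t" by metis
  have aX: "a t \<in> maxbicliques R" for t using a(1) flag_subset[OF F(1)] by blast
  have uniq: "x = y" if "x \<in> F" "y \<in> F" "r x = r y" for x y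
    using flag_bij[OF F(1)] that unfolding bij_betw_def inj_on_def by blast
  have a0: "a 0 = face_top R" using uniq[OF a(1) flag_zt(2)[OF F(1)]] a(2) top by simp
  have ad: "a d = vertex R j" using uniq[OF a(1), of "vertex R j"] a(2) F(2) j by simp
  have ab: "a (d + 1) = face_bot R" using uniq[OF a(1) flag_zt(1)[OF F(1)]] a(2) z(3) by simp
  have le: "below (a (Suc t)) (a t)" for t using flag_le[OF F(1) a(1) a(1)] a(2) by simp
  have "\<exists>i. i \<in> fst (a (Suc t)) \<and> i \<notin> fst (a t)" if "t \<le> d" for t
  proof (rule ccontr)
    assume "\<not> ?thesis"
    hence "below (a t) (a (Suc t))" using below_fst[OF aX aX] by blast
    hence "a t = a (Suc t)" using below_antisym[OF aX aX _ le] by blast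
    hence "r (a t) = r (a (Suc t))" by simp
    thus False using a(2) that by simp
  qed
  then obtain i where i: "\<And>t. t \<le> d \<Longrightarrow> i t \<in> fst (a (Suc t)) \<and> i t \<notin> fst (a t)" by metis
  define cyc where "cyc = map i [0..<d]"
  have tk: "take t cyc = map i [0..<t]" if "t \<le> d" for t unfolding cyc_def using that by (simp add: take_map)
  have meet: "row_face R (set (take t cyc)) = a t" if "t \<le> d" for t
    using that
  proof (induction t)
    case 0
    show ?case using a0 by simp
  next
    case (Suc t)
    let ?S = "set (take t cyc)"
    let ?p = "row_face R (set (take (Suc t) cyc))"
    have S: "set (take (Suc t) cyc) = insert (i t) ?S" using tk[of t] tk[of "Suc t"] Suc.prems by auto
    have IH: "row_face R ?S = a t" using Suc by simp
    have pX: "?p \<in> maxbicliques R" by (rule row_face_in)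
    have sub: "insert (i t) ?S \<subseteq> fst ?p" unfolding S row_face_def by auto
    have 1: "below ?p (a t)" using below_row_face[OF pX, of ?S] sub unfolding IH by blast
    have 2: "?p \<noteq> a t" using sub i[of t] Suc.prems by auto
    have "?S \<subseteq> fst (a t)" unfolding IH[symmetric] row_face_def by auto
    also have "\<dots> \<subseteq> fst (a (Suc t))" using below_fst[OF aX aX] le by blast
    finally have 3: "below (a (Suc t)) ?p" using below_row_face[OF aX[of "Suc t"], of "insert (i t) ?S"] i[of t] Suc.prems unfolding S by auto
    \<comment> \<open>The new meet is strictly below \<open>a t\<close> and not below the rank of
      the next member of the flag, so it is that member.\<close>
    have "r ?p < r (a t)" using exact_rank_less[OF exact pX aX 1 2] .
    moreover have "r (a (Suc t)) \<le> r ?p" using faces.exact_rank_mono[OF exact aX pX 3] .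
    ultimately have "r (a (Suc t)) = r ?p" using a(2) Suc.prems by simp
    thus ?case using faces.exact_rank_inj[OF exact aX pX 3] by simp
  qed
  have len: "length cyc = d" unfolding cyc_def by simp
  have cyc: "row_face R (set cyc) = vertex R j" using meet[of d] ad len by simp
  have "set cyc \<subseteq> fst (row_face R (set cyc))" unfolding row_face_def by auto
  hence sc: "set cyc \<subseteq> {i. (i, j) \<in> R}" unfolding cyc unfolding vertex_def by simp
  have sup: "super_cycle R d (cyc @ [k])" if k: "(k, j) \<notin> R" for k
  proof -
    let ?q = "row_face R (insert k (set cyc))"
    have q: "?q \<in> maxbicliques R" by (rule row_face_in)
    have sub: "insert k (set cyc) \<subseteq> fst ?q" unfolding row_face_def by auto
    have "below ?q (vertex R j)" unfolding cyc[symmetric] using below_row_face[OF q] sub by blast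
    moreover have "?q \<noteq> vertex R j" using sub k unfolding vertex_def by auto
    ultimately have "r ?q < 1" using exact_rank_less[OF exact q vertex_in] j by metis
    hence "?q = face_bot R" using faces.exact_rank_inj[OF exact row_face_in q face_bot_below[OF q]] z(3) by simp
    thus ?thesis unfolding super_cycle_def is_cycle_def using len cyc by (simp add: facet_meet_eq)
  qed
  have ind: "induced_flag R d (cyc @ [k]) = F" for k
  proof -
    have "facet_meet R (take t (cyc @ [k])) = a t" if "t \<le> d" for t
      using meet[OF that] that len by (simp add: facet_meet_eq)
    hence "{facet_meet R (take t (cyc @ [k])) | t. 1 \<le> t \<and> t \<le> d} = {a t | t. 1 \<le> t \<and> t \<le> d}"
      unfolding setcompr_eq_image by (intro image_cong) auto
    hence "induced_flag R d (cyc @ [k]) = {a (d + 1), a 0} \<union> {a t | t. 1 \<le> t \<and> t \<le> d}"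
      unfolding induced_flag_def a0 ab by simp
    moreover have "F \<subseteq> {a (d + 1), a 0} \<union> {a t | t. 1 \<le> t \<and> t \<le> d}"
    proof
      fix x assume x: "x \<in> F"
      have "r x \<le> d + 1" using rank_le_top[of x] flag_subset[OF F(1)] x top by auto
      hence xe: "x = a (d + 1 - r x)" using uniq[OF x a(1)] a(2) by simp
      consider "d + 1 - r x = 0" | "d + 1 - r x = d + 1" | "1 \<le> d + 1 - r x" "d + 1 - r x \<le> d" by linarith
      thus "x \<in> {a (d + 1), a 0} \<union> {a t | t. 1 \<le> t \<and> t \<le> d}" using xe by cases auto
    qed
    ultimately show ?thesis using a(1) by auto
  qed
  have "i d \<notin> fst (vertex R j)" using i[of d] ad by simp
  hence "\<exists>i. (i, j) \<notin> R" unfolding vertex_def by auto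
  with that[OF F(1) len sc _ sup ind] show ?thesis by blast
qed

section \<open>Generators at the vertices and their signs\<close>

context nondegenerate_form
begin

text \<open>The dimensions of the span \<open>?W\<close> of the normals at \<open>j\<close> and of
  its orthogonal space \<open>?K\<close> add up to \<open>d + 1\<close>, while the rank condition
  gives \<open>dim ?W \<ge> d\<close>. If \<open>?W\<close> were everything, \<open>?K\<close> would
  be zero and yet meet \<open>?W\<close> in a line; so \<open>?K\<close> is a line.\<close>

lemma vertex_vector_exists:
  assumes card: "CARD('n) = d + 1" and h: "span (range h) = UNIV"
    and G: "\<And>i k. G $ i $ k = form \<Phi> (h i) (h k)" and vc: "vertex_condition R d G j"
  obtains u where "u \<noteq> 0" "dim (span (h ` {i. (i, j) \<in> R})) = d" "\<And>i. (i, j) \<in> R \<Longrightarrow> form \<Phi> (h i) u = 0"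
proof -
  let ?A = "{i. (i, j) \<in> R}"
  let ?K = "{x. \<forall>i\<in>?A. form \<Phi> (h i) x = 0}"
  let ?W = "span (h ` ?A)"
  obtain "is" where isA: "distinct is" "set is = ?A" using finite_distinct_list[of ?A] by auto
  have "vec_space.rank (length is) (submatrix_of G is is) = d" using vc isA unfolding vertex_condition_def by blast
  hence 1: "d + dim (?W \<inter> ?K) = dim ?W" using gram_rank[of G h "is", OF G isA(1)] isA(2) by simp
  have 2: "dim ?K + dim ?W = d + 1" using dim_form_orthogonal[of ?A h] card by simp
  have "dim ?W \<noteq> d + 1"
  proof
    assume W: "dim ?W = d + 1"
    hence "dim (?W \<inter> ?K) = 1" "dim ?K = 0" using 1 2 by linarith+
    moreover have "dim (?W \<inter> ?K) \<le> dim ?K" by (rule dim_subset) blast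
    ultimately show False by linarith
  qed
  hence W: "dim ?W = d" and K: "dim ?K = 1" using 1 2 by linarith+
  have "\<not> ?K \<subseteq> {0}"
  proof
    assume "?K \<subseteq> {0}"
    hence "dim ?K = 0" by (simp only: dim_eq_0)
    with K show False by simp
  qed
  then obtain u where u: "u \<noteq> 0" "u \<in> ?K" by blast
  show ?thesis by (rule that[OF u(1) W]) (use u(2) in blast)
qed

text \<open>The determinant as a function of its last row and the form against \<open>u\<close> both
  vanish on the hyperplane spanned by the normals at the vertex. They are therefore proportional,
  and equal signs of one are equal signs of the other.\<close>

lemma cycle_sides:
  assumes card: "CARD('n) = d + 1" and cyc: "length cyc = d" "set cyc \<subseteq> A"
    and u: "u \<noteq> 0" "dim (span (h ` A)) = d" "\<And>i. i \<in> A \<Longrightarrow> form \<Phi> (h i) u = 0"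
    and det: "0 < Determinants.det (list_matrix h (cyc @ [i])) * Determinants.det (list_matrix h (cyc @ [i']))"
  shows "0 < form \<Phi> (h i) u * form \<Phi> (h i') u"
proof -
  define x0 :: 'n where "x0 = enum d"
  \<comment> \<open>Position \<open>d\<close> is the row where \<open>rowdet\<close> inserts the
    varying normal; 0 is a placeholder for it.\<close>
  define c where "c x = (if index x < d then h (cyc ! index x) else 0)" for x :: 'n
  let ?D = "rowdet c x0"
  let ?W = "span (h ` A)" and ?S = "span (c ` (- {x0}))"
  have ix: "index x < d" if "x \<noteq> x0" for x :: 'n
  proof -
    have "index x \<noteq> d" using that enum_index[of x] unfolding x0_def by metis
    thus ?thesis using index_less[of x] card by simp
  qed
  have ix0: "index x0 = d" unfolding x0_def using card by (intro index_enum) simp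
  have D: "Determinants.det (list_matrix h (cyc @ [k])) = ?D (h k)" for k
    unfolding rowdet_def list_matrix_def
    by (intro arg_cong[where f=Determinants.det]) (auto simp: Finite_Cartesian_Product.vec_eq_iff nth_append cyc(1) ix0 ix c_def)
  have Di: "?D (h i) \<noteq> 0" using det unfolding D by auto
  have cW: "c ` (- {x0}) \<subseteq> h ` A"
  proof
    fix y assume "y \<in> c ` (- {x0})"
    then obtain x where x: "x \<noteq> x0" "y = c x" by blast
    have "cyc ! index x \<in> A" using ix[OF x(1)] cyc nth_mem by blast
    thus "y \<in> h ` A" using ix[OF x(1)] x(2) unfolding c_def by simp
  qed
  hence SW: "?S \<subseteq> ?W" by (rule span_mono)
  have "span (range (\<lambda>x. if x = x0 then h i else c x)) = UNIV"
    using Di unfolding rowdet_def det_rows_nonzero .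
  moreover have "range (\<lambda>x. if x = x0 then h i else c x) \<subseteq> insert (h i) ?S"
    by (auto intro: span_base)
  ultimately have full: "span (insert (h i) ?S) = UNIV" using span_mono by blast
  \<comment> \<open>Together with \<open>h i\<close> the normals of the cycle span the space, so
    their own span has dimension at least \<open>d\<close> and fills \<open>?W\<close>.\<close>
  hence "dim (span (insert (h i) ?S)) = d + 1" using card by simp
  moreover have "dim (span (insert (h i) ?S)) \<le> dim ?S + 1" by (simp add: dim_insert)
  ultimately have "d \<le> dim ?S" by linarith
  hence S: "?S = ?W" using SW u(2) by (intro subspace_dim_equal subspace_span) auto
  have hi: "h i \<notin> ?W" using Di rowdet_span[of "h i" c x0] S by auto
  have dU: "dim (UNIV :: (real^'n) set) \<le> dim ?W + 1" using u(2) card by simp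
  have Wu: "form \<Phi> x u = 0" if "x \<in> ?W" for x
  proof -
    have "h ` A \<subseteq> {x. form \<Phi> u x = 0}" using u(3) form_sym by auto
    hence "?W \<subseteq> {x. form \<Phi> u x = 0}" unfolding form_eq by (intro span_minimal subspace_hyperplane)
    thus ?thesis using that form_sym by auto
  qed
  have form_decomp: "form \<Phi> x u = b * form \<Phi> (h i) u" if "x - b *\<^sub>R h i \<in> ?W" for x b
    using Wu[OF that] unfolding form_def by (simp add: inner_diff_left)
  have ex: "\<exists>b. x - b *\<^sub>R h i \<in> ?W" for x
    using one_dim_extension[OF subspace_span subspace_UNIV subset_UNIV dU UNIV_I hi UNIV_I] by blast
  have nz: "form \<Phi> (h i) u \<noteq> 0"
  proof
    assume z: "form \<Phi> (h i) u = 0"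
    have "form \<Phi> u x = 0" for x
    proof -
      obtain b where "x - b *\<^sub>R h i \<in> ?W" using ex by blast
      from form_decomp[OF this] z show ?thesis unfolding form_sym[of u x] by simp
    qed
    hence "u = 0" by (rule nd)
    with u(1) show False by simp
  qed
  obtain b where b: "h i' - b *\<^sub>R h i \<in> ?W" using ex by blast
  have "?D (h i' - b *\<^sub>R h i) = 0" by (rule rowdet_span) (use b S in simp)
  hence "?D (h i') = b * ?D (h i)" by (simp add: linear_diff[OF linear_rowdet] linear_scale[OF linear_rowdet])
  hence "0 < b * (?D (h i) * ?D (h i))" using det unfolding D by (simp add: mult.left_commute)
  hence "b > 0" using Di by (simp add: zero_less_mult_iff)
  hence "0 < b * (form \<Phi> (h i) u * form \<Phi> (h i) u)"
    using nz by (metis mult_pos_pos not_real_square_gt_zero)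
  thus ?thesis unfolding form_decomp[OF b] by (simp add: mult.left_commute)
qed

end

text \<open>Hull dimensions grow by at least one at each step of the lattice. Climbing from the
  bottom gives \<open>r a \<le> rk a\<close>; climbing on to the top must still fit into the
  dimension of the space, which gives the other inequality.\<close>

lemma (in sign_pattern) rk_eq_rank:
  assumes r: "ranked_faces R r" "r (face_top R) = DIM('a)" and a: "a \<in> maxbicliques R"
  shows "rk a = r a"
proof -
  interpret r: ranked_faces R r by (rule r(1))
  have "r a \<le> rk a" if "a \<in> maxbicliques R" for a
    using that
  proof (induction "r a" arbitrary: a)
    case (Suc k)
    have "face_bot R \<noteq> a" using Suc.hyps(2) r.z(3) by auto
    then obtain c where c: "c \<in> maxbicliques R" "below c a" "r c + 1 = r a"
      using faces.exact_rank_cover_down[OF r.exact row_face_in Suc.prems face_bot_below[OF Suc.prems]] by metis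
    have "r c \<le> rk c" using Suc.hyps c by simp
    moreover have "rk c < rk a" using c by (intro rk_less c Suc.prems) auto
    ultimately show ?case using c(3) by simp
  qed simp
  moreover have "rk a + (r (face_top R) - r a) \<le> DIM('a)" if "a \<in> maxbicliques R" for a
    using that
  proof (induction "r (face_top R) - r a" arbitrary: a)
    case 0
    show ?case using 0 dim_subset_UNIV[of "U a"] unfolding rk_def by simp
  next
    case (Suc k)
    have "a \<noteq> face_top R" using Suc.hyps(2) by auto
    then obtain c where c: "c \<in> maxbicliques R" "below a c" "r c = r a + 1"
      using faces.exact_rank_cover_up[OF r.exact Suc.prems row_face_in, of "{}"] by auto
    have "k = r (face_top R) - r c" using Suc.hyps(2) c(3) by linarith
    from Suc.hyps(1)[OF this c(1)] have "rk c + (r (face_top R) - r c) \<le> DIM('a)" .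
    moreover have "rk a < rk c" using c by (intro rk_less c Suc.prems) auto
    ultimately show ?case using c(3) Suc.hyps(2) by simp
  qed
  ultimately show ?thesis using a r(2) r.rank_le_top[OF a] by (metis add_le_cancel_right le_add_diff_inverse order_antisym add.commute)
qed

text \<open>Equality of ranks transfers exactness and the diamond property to hull dimensions, after
  which \<open>V_eq\<close> at the top face is the inclusion \<open>cone\<close>.\<close>

lemma (in sign_pattern) dual_pairI:
  assumes r: "ranked_faces R r" "r (face_top R) = DIM('a)" "diamond_rank R r" and v: "\<And>j. v j \<noteq> 0"
    and pointed: "\<And>x. (\<And>i. n i \<bullet> x = 0) \<Longrightarrow> x = 0"
  shows "dual_pair R n v"
proof -
  interpret r: ranked_faces R r by (rule r(1))
  have rk: "rk a = r a" if "a \<in> maxbicliques R" for a by (rule rk_eq_rank[OF r(1,2) that])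
  have "dim (U (face_bot R)) = 0" using rk[OF row_face_in] r.z(3) unfolding rk_def by metis
  hence "U (face_bot R) \<subseteq> {0}" by (simp only: dim_eq_0)
  hence bot: "snd (face_bot R) = {}" using v_in_U v by blast
  have ex: "exact_rank (maxbicliques R) below rk"
    using r.exact rk unfolding exact_rank_def by simp
  interpret rsp: ranked_sign_pattern R n v
  proof
    show "snd (face_bot R) = {}" by (rule bot)
    show "exact_rank (maxbicliques R) below rk" by (rule ex)
    show "\<exists>c'\<in>maxbicliques R. below e c' \<and> below c' b \<and> c' \<noteq> c \<and> rk c' = rk c"
      if X: "e \<in> maxbicliques R" "c \<in> maxbicliques R" "b \<in> maxbicliques R"
        and le: "below e c" "below c b" and rks: "rk c = rk e + 1" "rk b = rk c + 1" for e c b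
    proof -
      obtain c' where "c' \<in> maxbicliques R" "below e c'" "below c' b" "c' \<noteq> c" "r c' = r c"
        using r.diamond_other[OF r(3) X le] rks rk X by metis
      thus ?thesis using rk X by auto
    qed
  qed
  have "dim (U (face_top R)) = DIM('a)" using rk[OF row_face_in] r(2) unfolding rk_def by metis
  hence top: "U (face_top R) = UNIV" using subspace_dim_equal[OF U_subspace subspace_UNIV, of "face_top R"] by simp
  show ?thesis
  proof
    show "x \<in> V (face_top R)" if "\<And>i. n i \<bullet> x \<le> 0" for x
      using rsp.V_eq[OF row_face_in, of x] that top by blast
    show "x = 0" if "\<And>i. n i \<bullet> x = 0" for x using pointed that .
    show "span (range v) = UNIV" using top unfolding U_def by simp
    show "v j \<noteq> 0" for j by (rule v)
  qed
qed

lemma type_coneI: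
  fixes n :: "'i::finite \<Rightarrow> real^'n" and v :: "'j::finite \<Rightarrow> real^'n"
  assumes dp: "dual_pair R n v" and ind: "indexed_by_irreducibles R"
  shows "type_cone R (sign_pattern.V v (face_top R), \<lambda>i. sign_pattern.V v (facet R i), \<lambda>j. sign_pattern.V v (vertex R j))"
proof -
  interpret dual_pair R n v by (rule dp)
  have fin: "V (face_top R) = {\<Sum>x\<in>range v. c x *\<^sub>R x | c. \<forall>x\<in>range v. 0 \<le> c x}"
  proof (intro equalityI subsetI)
    fix x assume "x \<in> V (face_top R)"
    then obtain c where c0: "\<And>j. 0 \<le> c j" "x = (\<Sum>j\<in>snd (face_top R). c j *\<^sub>R v j)" by (elim VE) blast
    hence c: "\<And>j. 0 \<le> c j" "x = (\<Sum>j\<in>UNIV. c j *\<^sub>R v j)" by simp_all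
    \<comment> \<open>\<open>pointed_cone\<close> asks for a set of generators while
      \<open>V\<close> indexes them, so the coefficients of equal vectors are collected.\<close>
    have "x = (\<Sum>y\<in>range v. \<Sum>j\<in>{j\<in>UNIV. v j = y}. c j *\<^sub>R v j)"
      unfolding c(2) by (rule sum.image_gen) simp
    also have "\<dots> = (\<Sum>y\<in>range v. (\<Sum>j\<in>{j\<in>UNIV. v j = y}. c j) *\<^sub>R y)"
      by (intro sum.cong refl) (simp add: scaleR_sum_left)
    finally show "x \<in> {\<Sum>x\<in>range v. c x *\<^sub>R x | c. \<forall>x\<in>range v. 0 \<le> c x}"
      using c(1) by (intro CollectI exI[of _ "\<lambda>y. \<Sum>j\<in>{j\<in>UNIV. v j = y}. c j"]) (auto intro: sum_nonneg)
  next
    fix x assume "x \<in> {\<Sum>x\<in>range v. c x *\<^sub>R x | c. \<forall>x\<in>range v. 0 \<le> c x}"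
    then obtain c where c: "\<forall>x\<in>range v. 0 \<le> c x" "x = (\<Sum>x\<in>range v. c x *\<^sub>R x)" by blast
    have "n i \<bullet> x \<le> 0" for i
      unfolding c(2) using c(1) nonpos by (auto simp: inner_sum_right intro!: sum_nonpos mult_nonneg_nonpos)
    thus "x \<in> V (face_top R)" by (rule cone)
  qed
  have noline: "\<not> range (\<lambda>t::real. a + t *\<^sub>R u) \<subseteq> V (face_top R)" if "u \<noteq> 0" for a u
  proof
    assume L: "range (\<lambda>t::real. a + t *\<^sub>R u) \<subseteq> V (face_top R)"
    have "n i \<bullet> u = 0" for i
    proof (rule ccontr)
      assume nz: "n i \<bullet> u \<noteq> 0"
      have "n i \<bullet> (a + t *\<^sub>R u) \<le> 0" for t using L inner_V by blast
      \<comment> \<open>At this parameter the row takes the value 1, which is not allowed in the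
        cone.\<close>
      from this[of "(1 - n i \<bullet> a) / (n i \<bullet> u)"] nz show False by (simp add: inner_add_right)
    qed
    hence "u = 0" by (rule pointed)
    with that show False by simp
  qed
  have pc: "pointed_cone (V (face_top R))"
    unfolding pointed_cone_def
  proof (intro conjI exI)
    show "finite (range v)" by simp
    show "V (face_top R) = {\<Sum>x\<in>range v. c x *\<^sub>R x | c. \<forall>x\<in>range v. 0 \<le> c x}" by (rule fin)
    show "\<not> (\<exists>a u. u \<noteq> 0 \<and> range (\<lambda>t::real. a + t *\<^sub>R u) \<subseteq> V (face_top R))" using noline by blast
  qed
  have ntop: "i \<notin> fst (face_top R)" for i
  proof
    assume "i \<in> fst (face_top R)"
    hence "below (face_top R) (facet R i)" by (rule below_facet[OF row_face_in, THEN iffD2])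
    hence "face_top R = facet R i" by (rule below_antisym[OF row_face_in facet_in]) simp
    hence "rk (facet R i) = DIM(real^'n)" using rk_top by simp
    thus False using rk_facet[OF ind, of i] by simp
  qed
  have "w (face_top R) \<in> interior (V (face_top R))"
  proof (rule interiorI)
    have "{x. \<forall>i. n i \<bullet> x < 0} = (\<Inter>i. {x. n i \<bullet> x < 0})" by blast
    moreover have "open (\<Inter>i. {x. n i \<bullet> x < 0})" by (intro open_INT finite ballI open_halfspace_lt)
    ultimately show "open {x. \<forall>i. n i \<bullet> x < 0}" by simp
    show "w (face_top R) \<in> {x. \<forall>i. n i \<bullet> x < 0}" using inner_w_neg[OF row_face_in ntop] by blast
    show "{x. \<forall>i. n i \<bullet> x < 0} \<subseteq> V (face_top R)" using cone by (auto intro: less_imp_le)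
  qed
  hence int: "interior (V (face_top R)) \<noteq> {}" by blast
  have inc: "V (vertex R j) \<subseteq> V (facet R i) \<longleftrightarrow> (i, j) \<in> R" for i j
    unfolding V_subset_iff[OF vertex_in facet_in] using below_facet[OF vertex_in, of R j i] unfolding vertex_def by simp
  have ind': "bij_betw (facet R) UNIV (meet_irreducibles (maxbiclique_lattice R))"
    "bij_betw (vertex R) UNIV (join_irreducibles (maxbiclique_lattice R))"
    using ind unfolding indexed_by_irreducibles_def by blast+
  show ?thesis
    unfolding type_cone_def using pc int inc bij_betw_trans[OF ind'(1) facets_bij] bij_betw_trans[OF ind'(2) edges_bij]
    by (simp add: comp_def)
qed

section \<open>Realizations and their Gramians\<close>

context nondegenerate_form
begin

lemma gramian_eq:
  assumes "\<And>i. outward_normal \<Phi> C (f i) = h i"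
  shows "gramian \<Phi> (C, f, r) $ i $ k = form \<Phi> (h i) (h k)"
  unfolding gramian_def using assms by simp

lemma realization_conditions:
  fixes R :: "('i::finite \<times> 'j::finite) set"
  assumes card: "CARD('n) = d + 1" and X: "(C, f, r) \<in> realizations \<Phi> R"
  shows "combinatorial_condition R d" "signature_condition \<Phi> (gramian \<Phi> (C, f, r))"
    "vertex_condition R d (gramian \<Phi> (C, f, r)) j \<longleftrightarrow> \<not> lightlike_ray \<Phi> (r j)"
    "orientation_condition \<Phi> R d (gramian \<Phi> (C, f, r))"
proof -
  obtain h v where gc: "gram_cone \<Phi> R h v" and unit: "\<And>i. \<bar>form \<Phi> (h i) (h i)\<bar> = 1"
    and ray: "\<And>j. r j = {t *\<^sub>R v j | t. 0 \<le> t}" and ind: "indexed_by_irreducibles R"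
    and out: "\<And>i. outward_normal \<Phi> C (f i) = h i"
    by (rule realization_gram_cone[OF X]) (rule that, assumption+)
  interpret gram_cone \<Phi> R h v by (rule gc)
  note G = gramian_eq[of C f h r, OF out]
  show "combinatorial_condition R d" by (rule combinatorial_condition_gram[OF card ind])
  show "signature_condition \<Phi> (gramian \<Phi> (C, f, r))" by (rule signature_condition_gram[OF G unit])
  show "orientation_condition \<Phi> R d (gramian \<Phi> (C, f, r))" by (rule orientation_condition_gram[OF card G])
  have "lightlike_ray \<Phi> (r j) \<longleftrightarrow> form \<Phi> (v j) (v j) = 0"
  proof
    assume "lightlike_ray \<Phi> (r j)"
    moreover have "v j \<in> r j" unfolding ray by (auto intro!: exI[of _ 1])
    ultimately show "form \<Phi> (v j) (v j) = 0" unfolding lightlike_ray_def by blast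
  qed (auto simp: lightlike_ray_def ray form_scale)
  thus "vertex_condition R d (gramian \<Phi> (C, f, r)) j \<longleftrightarrow> \<not> lightlike_ray \<Phi> (r j)"
    using vertex_condition_gram[OF card G rk_vertex[OF ind]] by simp
qed

lemma orthogonal_iff:
  fixes Q :: "real^'n^'n"
  shows "Finite_Cartesian_Product.transpose Q ** \<Phi> ** Q = \<Phi> \<longleftrightarrow> (\<forall>x y. form \<Phi> (Q *v x) (Q *v y) = form \<Phi> x y)"
proof -
  have *: "form \<Phi> (Q *v x) (Q *v y) = x \<bullet> ((Finite_Cartesian_Product.transpose Q ** \<Phi> ** Q) *v y)" for x y
  proof -
    have "form \<Phi> (Q *v x) (Q *v y) = (\<Phi> *v (Q *v y)) \<bullet> (Q *v x)" unfolding form_def by (rule inner_commute)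
    also have "\<dots> = (Finite_Cartesian_Product.transpose Q *v (\<Phi> *v (Q *v y))) \<bullet> x"
      using dot_lmul_matrix[of "\<Phi> *v (Q *v y)" Q x] by simp
    finally show ?thesis by (simp add: matrix_vector_mul_assoc inner_commute matrix_mul_assoc del: transpose_matrix_vector)
  qed
  show ?thesis
  proof
    assume "Finite_Cartesian_Product.transpose Q ** \<Phi> ** Q = \<Phi>"
    thus "\<forall>x y. form \<Phi> (Q *v x) (Q *v y) = form \<Phi> x y" using * by (simp add: form_def)
  next
    assume "\<forall>x y. form \<Phi> (Q *v x) (Q *v y) = form \<Phi> x y"
    hence "x \<bullet> ((Finite_Cartesian_Product.transpose Q ** \<Phi> ** Q) *v y) = x \<bullet> (\<Phi> *v y)" for x y
      using *[of x y] by (simp add: form_def)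
    hence "(Finite_Cartesian_Product.transpose Q ** \<Phi> ** Q) *v y = \<Phi> *v y" for y by (metis vector_eq_ldot)
    thus "Finite_Cartesian_Product.transpose Q ** \<Phi> ** Q = \<Phi>" by (simp add: matrix_eq)
  qed
qed

lemma orthogonal_surj:
  assumes "\<And>x y. form \<Phi> (Q *v x) (Q *v y) = form \<Phi> x y"
  shows "surj ((*v) Q)"
proof -
  have "x = 0" if "Q *v x = 0" for x
  proof (rule nd)
    fix y
    show "form \<Phi> x y = 0" using assms[of x y] that by (simp add: form_def)
  qed
  hence "inj ((*v) Q)" using linear_injective_0[OF matrix_vector_mul_linear, of Q] by blast
  thus ?thesis using linear_injective_imp_surjective[OF matrix_vector_mul_linear] by blast
qed

text \<open>By uniqueness, \<open>Q\<close> maps each outward normal to the outward normal of the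
  image facet, and it preserves the form.\<close>

lemma gramian_orthogonal:
  fixes R :: "('i::finite \<times> 'j::finite) set"
  assumes X: "X \<in> realizations \<Phi> R" and XY: "(X, Y) \<in> orthogonally_equivalent \<Phi>"
  shows "gramian \<Phi> Y = gramian \<Phi> X"
proof -
  obtain C f r where X': "X = (C, f, r)" by (cases X)
  obtain C' f' r' where Y': "Y = (C', f', r')" by (cases Y)
  obtain Q :: "real^'n^'n" where Q: "Finite_Cartesian_Product.transpose Q ** \<Phi> ** Q = \<Phi>"
    "C' = (*v) Q ` C" "\<And>i. f' i = (*v) Q ` f i"
    using XY unfolding X' Y' orthogonally_equivalent_def by blast
  have Qf: "form \<Phi> (Q *v x) (Q *v y) = form \<Phi> x y" for x y using Q(1) orthogonal_iff by blast
  obtain h where unit: "\<And>i. \<bar>form \<Phi> (h i) (h i)\<bar> = 1" and out: "\<And>i. outward_normal \<Phi> C (f i) = h i"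
    and sp: "\<And>i. span (f i) = {x. form \<Phi> (h i) x = 0}" and w: "\<And>i. \<exists>w\<in>C. form \<Phi> (h i) w < 0"
    and le: "\<And>i. C \<subseteq> {x. form \<Phi> (h i) x \<le> 0}"
  proof -
    obtain h v where h: "gram_cone \<Phi> R h v" "\<And>i. \<bar>form \<Phi> (h i) (h i)\<bar> = 1"
      "sign_pattern.V v (face_top R) = C" "\<And>i. outward_normal \<Phi> C (f i) = h i"
      "\<And>i. span (f i) = {x. form \<Phi> (h i) x = 0}" "\<And>i. \<exists>w\<in>C. form \<Phi> (h i) w < 0"
      by (rule realization_gram_cone[OF X[unfolded X']]) (rule that, assumption+)
    interpret gram_cone \<Phi> R h v by (rule h(1))
    have "C \<subseteq> {x. form \<Phi> (h i) x \<le> 0}" for i unfolding h(3)[symmetric] form_eq using inner_V by blast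
    with that h show ?thesis by blast
  qed
  have "outward_normal \<Phi> C' (f' i) = Q *v h i" for i
  proof -
    obtain x where x: "x \<in> C" "form \<Phi> (h i) x < 0" using w by blast
    show ?thesis
    proof (rule outward_normal_eq[where w = "Q *v x"])
      show "\<bar>form \<Phi> (Q *v h i) (Q *v h i)\<bar> = 1" using unit Qf by simp
      have "span (f' i) = (*v) Q ` {x. form \<Phi> (h i) x = 0}"
        unfolding Q(3) linear_span_image[OF matrix_vector_mul_linear] sp ..
      also have "\<dots> = {x. form \<Phi> (Q *v h i) x = 0}"
      proof (intro equalityI subsetI)
        fix y assume y: "y \<in> {x. form \<Phi> (Q *v h i) x = 0}"
        obtain z where "y = Q *v z" using orthogonal_surj[OF Qf] by (metis surjD)
        with y Qf show "y \<in> (*v) Q ` {x. form \<Phi> (h i) x = 0}" by auto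
      qed (auto simp: Qf)
      finally show "span (f' i) = {x. form \<Phi> (Q *v h i) x = 0}" .
      show "C' \<subseteq> {x. form \<Phi> (Q *v h i) x \<le> 0}" using le[of i] unfolding Q(2) by (auto simp: Qf)
      show "Q *v x \<in> C'" unfolding Q(2) using x by blast
      show "form \<Phi> (Q *v h i) (Q *v x) < 0" using x Qf by simp
    qed
  qed
  thus ?thesis unfolding X' Y' gramian_def using out Qf by simp
qed

text \<open>\<open>Q\<close> lifts a vector to coefficients over the \<open>h i\<close> and
  evaluates them over the \<open>h' i\<close>. Equal Gram matrices make the result independent of
  the lift: the difference of two results is orthogonal to all \<open>h' i\<close> with respect to
  the form, hence zero.\<close>

lemma gram_isometry:
  fixes h h' :: "'i::finite \<Rightarrow> real^'n"
  assumes span: "span (range h) = UNIV" "span (range h') = UNIV"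
    and G: "\<And>i k. form \<Phi> (h i) (h k) = form \<Phi> (h' i) (h' k)"
  obtains Q :: "real^'n^'n" where "\<And>x y. form \<Phi> (Q *v x) (Q *v y) = form \<Phi> x y" "\<And>i. Q *v h i = h' i"
proof -
  define T where "T g x = (\<Sum>i\<in>UNIV. (x $ i) *\<^sub>R g i)" for g :: "'i \<Rightarrow> real^'n" and x :: "real^'i"
  have T: "linear (T g)" for g unfolding T_def
    by (rule linearI) (auto simp: scaleR_add_left sum.distrib scaleR_sum_right)
  have Tg: "T g (axis i 1) = g i" for g i
  proof -
    have "T g (axis i 1) = (\<Sum>k\<in>UNIV. if k = i then g k else 0)"
      unfolding T_def by (rule sum.cong) (auto simp: axis_def)
    thus ?thesis by simp
  qed
  have surj: "surj (T h)"
  proof -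
    have "range h \<subseteq> range (T h)" using Tg by (metis image_subsetI rangeI)
    hence "span (range h) \<subseteq> range (T h)" using linear_subspace_image[OF T subspace_UNIV] by (intro span_minimal)
    thus ?thesis using span(1) by blast
  qed
  have formT: "form \<Phi> (g k) (T g x) = (\<Sum>i\<in>UNIV. x $ i * form \<Phi> (g k) (g i))" for g k x
    unfolding T_def form_eq by (simp add: inner_sum_right)
  have GT: "form \<Phi> (h k) (T h x) = form \<Phi> (h' k) (T h' x)" for k x
    unfolding formT G ..
  have GTT: "form \<Phi> (T h x) (T h y) = form \<Phi> (T h' x) (T h' y)" for x y
  proof -
    have e: "form \<Phi> (T g x) z = (\<Sum>i\<in>UNIV. x $ i * form \<Phi> (g i) z)" for g z
      unfolding T_def form_def by (simp add: inner_sum_left)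
    show ?thesis unfolding e GT ..
  qed
  have h'0: "z = 0" if "\<And>k. form \<Phi> (h' k) z = 0" for z
  proof (rule nd)
    fix y
    have "range h' \<subseteq> {y. form \<Phi> z y = 0}" using that form_sym by auto
    hence "span (range h') \<subseteq> {y. form \<Phi> z y = 0}" unfolding form_eq by (intro span_minimal subspace_hyperplane)
    thus "form \<Phi> z y = 0" using span(2) by blast
  qed
  obtain s where s: "linear s" "T h \<circ> s = id" using linear_surjective_right_inverse[OF T surj] by blast
  have Ts: "T h (s x) = x" for x using s(2) by (metis comp_apply id_apply)
  have lin: "linear (T h' \<circ> s)" using linear_compose[OF s(1) T] .
  define Q where "Q = matrix (T h' \<circ> s)"
  have "(\<lambda>x. Q *v x) = T h' \<circ> s" unfolding Q_def using lin by (simp add: fun_eq_iff)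
  hence Q: "Q *v x = T h' (s x)" for x by (metis comp_apply)
  have QT: "Q *v T h x = T h' x" for x
  proof -
    have "T h' (s (T h x)) - T h' x = 0"
    proof (rule h'0)
      fix k
      have "form \<Phi> (h' k) (T h' (s (T h x))) = form \<Phi> (h k) (T h x)" using GT[of k "s (T h x)"] Ts by simp
      also have "\<dots> = form \<Phi> (h' k) (T h' x)" by (rule GT)
      finally show "form \<Phi> (h' k) (T h' (s (T h x)) - T h' x) = 0" unfolding form_eq by (simp add: inner_diff_right)
    qed
    thus ?thesis unfolding Q by simp
  qed
  have "form \<Phi> (Q *v x) (Q *v y) = form \<Phi> x y" for x y
    using GTT[of "s x" "s y"] unfolding Q Ts by simp
  moreover have "Q *v h i = h' i" for i using QT[of "axis i 1"] unfolding Tg .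
  ultimately show ?thesis using that by blast
qed

text \<open>The isometry matching the outward normals carries inequalities to inequalities, and the
  cone, its facets and its rays are all described by inequalities and equations in these
  normals.\<close>

lemma gramian_eq_imp_equivalent:
  fixes R :: "('i::finite \<times> 'j::finite) set"
  assumes X: "X \<in> realizations \<Phi> R" and Y: "Y \<in> realizations \<Phi> R" and eq: "gramian \<Phi> X = gramian \<Phi> Y"
  shows "(X, Y) \<in> orthogonally_equivalent \<Phi>"
proof -
  obtain C f r where X': "X = (C, f, r)" by (cases X)
  obtain C' f' r' where Y': "Y = (C', f', r')" by (cases Y)
  obtain h v where h: "gram_cone \<Phi> R h v" "sign_pattern.V v (face_top R) = C"
    "\<And>i. f i = sign_pattern.V v (facet R i)" "\<And>j. r j = sign_pattern.V v (vertex R j)"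
    "\<And>i. outward_normal \<Phi> C (f i) = h i"
    by (rule realization_gram_cone[OF X[unfolded X']]) (rule that, assumption+)
  obtain h' v' where h': "gram_cone \<Phi> R h' v'" "sign_pattern.V v' (face_top R) = C'"
    "\<And>i. f' i = sign_pattern.V v' (facet R i)" "\<And>j. r' j = sign_pattern.V v' (vertex R j)"
    "\<And>i. outward_normal \<Phi> C' (f' i) = h' i"
    by (rule realization_gram_cone[OF Y[unfolded Y']]) (rule that, assumption+)
  interpret x: gram_cone \<Phi> R h v by (rule h(1))
  interpret y: gram_cone \<Phi> R h' v' by (rule h'(1))
  have G: "form \<Phi> (h i) (h k) = form \<Phi> (h' i) (h' k)" for i k
    using gramian_eq[of C f h r, OF h(5)] gramian_eq[of C' f' h' r', OF h'(5)] eq unfolding X' Y' by metis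
  obtain Q where Q: "\<And>x y. form \<Phi> (Q *v x) (Q *v y) = form \<Phi> x y" "\<And>i. Q *v h i = h' i"
    using gram_isometry[OF x.span_h y.span_h G] by metis
  have Qh: "form \<Phi> (h' i) (Q *v z) = form \<Phi> (h i) z" for i z using Q(1)[of "h i" z] Q(2) by simp
  have C: "z \<in> C \<longleftrightarrow> (\<forall>i. form \<Phi> (h i) z \<le> 0)" for z using x.cone_iff[of z] h(2) unfolding form_eq by simp
  have C': "z \<in> C' \<longleftrightarrow> (\<forall>i. form \<Phi> (h' i) z \<le> 0)" for z using y.cone_iff[of z] h'(2) unfolding form_eq by simp
  have mem: "Q *v z \<in> C' \<longleftrightarrow> z \<in> C" for z unfolding C C' Qh ..
  have img: "{y \<in> C'. P y} = (*v) Q ` {z \<in> C. P (Q *v z)}" for P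
  proof (intro equalityI subsetI)
    fix y assume y: "y \<in> {y \<in> C'. P y}"
    obtain z where "y = Q *v z" using orthogonal_surj[OF Q(1)] by (metis surjD)
    with y mem show "y \<in> (*v) Q ` {z \<in> C. P (Q *v z)}" by blast
  qed (use mem in auto)
  have 1: "C' = (*v) Q ` C" using img[of "\<lambda>_. True"] by simp
  have f: "f i = {z \<in> C. form \<Phi> (h i) z = 0}" for i
    unfolding h(3) x.V_facet h(2) form_eq by blast
  have f': "f' i = {z \<in> C'. form \<Phi> (h' i) z = 0}" for i
    unfolding h'(3) y.V_facet h'(2) form_eq by blast
  have 2: "f' i = (*v) Q ` f i" for i unfolding f f' img Qh ..
  have r: "r j = {z \<in> C. \<forall>i. (i, j) \<in> R \<longrightarrow> form \<Phi> (h i) z = 0}" for j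
    unfolding h(4) x.V_vertex h(2) form_eq ..
  have r': "r' j = {z \<in> C'. \<forall>i. (i, j) \<in> R \<longrightarrow> form \<Phi> (h' i) z = 0}" for j
    unfolding h'(4) y.V_vertex h'(2) form_eq ..
  have 3: "r' j = (*v) Q ` r j" for j unfolding r r' img Qh ..
  have "Finite_Cartesian_Product.transpose Q ** \<Phi> ** Q = \<Phi>" using orthogonal_iff Q(1) by blast
  with 1 2 3 show ?thesis unfolding X' Y' orthogonally_equivalent_def by blast
qed

lemma equiv_orthogonally_equivalent:
  "equiv UNIV (orthogonally_equivalent \<Phi> :: (('n, 'i, 'j) labelled_cone \<times> ('n, 'i, 'j) labelled_cone) set)"
proof (rule equivI)
  let ?E = "orthogonally_equivalent \<Phi> :: (('n, 'i, 'j) labelled_cone \<times> ('n, 'i, 'j) labelled_cone) set"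
  have E: "((C, f, r), (C', f', r')) \<in> ?E \<longleftrightarrow> (\<exists>Q. (\<forall>x y. form \<Phi> (Q *v x) (Q *v y) = form \<Phi> x y) \<and>
    C' = (*v) Q ` C \<and> (\<forall>i. f' i = (*v) Q ` f i) \<and> (\<forall>j. r' j = (*v) Q ` r j))" for C f r C' f' r'
    unfolding orthogonally_equivalent_def orthogonal_iff by simp
  show "?E \<subseteq> UNIV \<times> UNIV" by simp
  show "refl ?E"
  proof (rule refl_onI)
    fix X :: "('n, 'i, 'j) labelled_cone"
    obtain C f r where X: "X = (C, f, r)" by (cases X)
    show "(X, X) \<in> ?E" unfolding X E by (rule exI[of _ "Finite_Cartesian_Product.mat 1"]) simp
  qed
  show "sym ?E"
  proof (rule symI)
    fix X Y assume XY: "(X, Y) \<in> ?E"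
    obtain C f r where X: "X = (C, f, r)" by (cases X)
    obtain C' f' r' where Y: "Y = (C', f', r')" by (cases Y)
    obtain Q :: "real^'n^'n" where Q: "\<And>x y. form \<Phi> (Q *v x) (Q *v y) = form \<Phi> x y"
      "C' = (*v) Q ` C" "\<And>i. f' i = (*v) Q ` f i" "\<And>j. r' j = (*v) Q ` r j"
      using XY unfolding X Y E by blast
    obtain P :: "real^'n^'n" where P: "Q ** P = Finite_Cartesian_Product.mat 1"
      using orthogonal_surj[OF Q(1)] matrix_right_invertible_surjective[of Q] by blast
    hence P': "P ** Q = Finite_Cartesian_Product.mat 1" using matrix_left_right_inverse by blast
    have QP: "Q *v (P *v x) = x" "P *v (Q *v x) = x" for x
      using P P' by (simp_all add: matrix_vector_mul_assoc)
    have "form \<Phi> (P *v x) (P *v y) = form \<Phi> x y" for x y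
      using Q(1)[of "P *v x" "P *v y"] unfolding QP by simp
    moreover have "(*v) P ` (*v) Q ` S = S" for S unfolding image_image QP by simp
    ultimately show "(Y, X) \<in> ?E" unfolding X Y E Q(2-4) by (intro exI[of _ P]) simp
  qed
  show "trans ?E"
  proof (rule transI)
    fix X Y Z assume XY: "(X, Y) \<in> ?E" and YZ: "(Y, Z) \<in> ?E"
    obtain C f r where X: "X = (C, f, r)" by (cases X)
    obtain C' f' r' where Y: "Y = (C', f', r')" by (cases Y)
    obtain C'' f'' r'' where Z: "Z = (C'', f'', r'')" by (cases Z)
    obtain Q :: "real^'n^'n" where Q: "\<And>x y. form \<Phi> (Q *v x) (Q *v y) = form \<Phi> x y"
      "C' = (*v) Q ` C" "\<And>i. f' i = (*v) Q ` f i" "\<And>j. r' j = (*v) Q ` r j"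
      using XY unfolding X Y E by blast
    obtain P :: "real^'n^'n" where P: "\<And>x y. form \<Phi> (P *v x) (P *v y) = form \<Phi> x y"
      "C'' = (*v) P ` C'" "\<And>i. f'' i = (*v) P ` f' i" "\<And>j. r'' j = (*v) P ` r' j"
      using YZ unfolding Y Z E by blast
    have "(*v) P ` (*v) Q ` S = (*v) (P ** Q) ` S" for S
      unfolding image_image by (simp add: matrix_vector_mul_assoc)
    moreover have "form \<Phi> ((P ** Q) *v x) ((P ** Q) *v y) = form \<Phi> x y" for x y
      using P(1) Q(1) by (simp add: matrix_vector_mul_assoc[symmetric])
    ultimately show "(X, Z) \<in> ?E" unfolding X Z E P(2-4) Q(2-4) by (intro exI[of _ "P ** Q"]) simp
  qed
qed

lemma realization_exists:
  fixes R :: "('i::finite \<times> 'j::finite) set" and G :: "real^'i^'i"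
  assumes card: "CARD('n) = d + 1" and comb: "combinatorial_condition R d" and sig: "signature_condition \<Phi> G"
    and vc: "\<And>j. vertex_condition R d G j" and oc: "orientation_condition \<Phi> R d G"
  shows "\<exists>X\<in>realizations \<Phi> R. gramian \<Phi> X = G"
proof -
  let ?r = "element_rank (maxbiclique_lattice R)"
  have ind: "indexed_by_irreducibles R" and dl: "diamond_lattice (maxbiclique_lattice R)"
    and ro: "rank_of (maxbiclique_lattice R) = d + 1" and bip: "bipartite (flag_graph (maxbiclique_lattice R))"
    using comb unfolding combinatorial_condition_def by blast+
  have gr: "graded (maxbiclique_lattice R)" using dl unfolding diamond_lattice_def by blast
  have rf: "ranked_faces R ?r" and top: "?r (face_top R) = d + 1"
    using ranked_faces_element_rank[OF gr ro] by simp_all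
  interpret rf: ranked_faces R ?r by (rule rf)
  have dr: "diamond_rank R ?r" using dl rf.diamond_lattice_iff by blast
  have rv: "?r (vertex R j) = 1" for j
    using ind rf.join_irreducibles_eq[OF dr] unfolding indexed_by_irreducibles_def by (auto dest!: bij_betwE)
  obtain h :: "'i \<Rightarrow> real^'n" where h: "\<And>i k. form \<Phi> (h i) (h k) = G $ i $ k" "span (range h) = UNIV"
    using gram_vectors_exist[OF _ sym nd, of G] sig unfolding signature_condition_def by blast
  have G: "G $ i $ k = form \<Phi> (h i) (h k)" for i k using h(1) by simp
  have unit: "\<bar>form \<Phi> (h i) (h i)\<bar> = 1" for i
    using sig unfolding signature_condition_def h(1) by (metis abs_minus_cancel abs_one)
  have "\<exists>u. u \<noteq> 0 \<and> (\<forall>i. if (i, j) \<in> R then form \<Phi> (h i) u = 0 else form \<Phi> (h i) u < 0)" for j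
  proof -
    obtain F cyc where F: "pred_on.maxchain (maxbicliques R) below F" and cyc: "length cyc = d" "set cyc \<subseteq> {i. (i, j) \<in> R}" "\<exists>i. (i, j) \<notin> R"
      and sc: "\<And>i. (i, j) \<notin> R \<Longrightarrow> super_cycle R d (cyc @ [i])" and indF: "\<And>i. induced_flag R d (cyc @ [i]) = F"
      using rf.super_cycles_at_vertex[OF top rv] by blast
    obtain u where u: "u \<noteq> 0" "dim (span (h ` {i. (i, j) \<in> R})) = d" "\<And>i. (i, j) \<in> R \<Longrightarrow> form \<Phi> (h i) u = 0"
      using vertex_vector_exists[OF card h(2) G vc] by blast
    \<comment> \<open>\<open>same_part\<close> asks for both flags in the first part, so the parts
      are exchanged if necessary.\<close>
    have same: "same_part (flag_graph (maxbiclique_lattice R)) F F"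
    proof -
      obtain P Q where PQ: "bipartition (flag_graph (maxbiclique_lattice R)) P Q" using bip unfolding bipartite_def by blast
      have QP: "bipartition (flag_graph (maxbiclique_lattice R)) Q P" using PQ unfolding bipartition_def by blast
      have "F \<in> flags (maxbiclique_lattice R)" using F flags_iff by blast
      hence "F \<in> P \<union> Q" using PQ unfolding bipartition_def by (simp add: flag_graph_def)
      thus ?thesis unfolding same_part_def using PQ QP by blast
    qed
    have side: "0 < form \<Phi> (h i) u * form \<Phi> (h i') u" if "(i, j) \<notin> R" "(i', j) \<notin> R" for i i'
    proof (rule cycle_sides[OF card cyc(1,2) u(1,2)])
      let ?x = "Determinants.det (list_matrix h (cyc @ [i]))" and ?y = "Determinants.det (list_matrix h (cyc @ [i']))"
      have "same_orientation R d (cyc @ [i]) (cyc @ [i'])" unfolding same_orientation_def indF by (rule same)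
      hence "0 < Determinant.det (submatrix_of G (cyc @ [i]) (cyc @ [i'])) * Determinants.det \<Phi>"
        using oc sc that unfolding orientation_condition_def by blast
      also have "Determinant.det (submatrix_of G (cyc @ [i]) (cyc @ [i'])) = ?x * Determinants.det \<Phi> * ?y"
        by (rule gram_det[OF G]) (simp_all add: cyc(1) card)
      finally have "0 < (?x * ?y) * (Determinants.det \<Phi>)\<^sup>2" by (simp add: power2_eq_square algebra_simps)
      thus "0 < ?x * ?y" by (simp add: zero_less_mult_iff)
    qed (use u(3) in blast)
    obtain i0 where i0: "(i0, j) \<notin> R" using cyc(3) by blast
    have nz: "form \<Phi> (h i0) u \<noteq> 0" using side[OF i0 i0] by auto
    \<comment> \<open>The sign of \<open>u\<close> is still free; \<open>s\<close> makes one facet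
      off the vertex negative, and \<open>side\<close> extends this to all others.\<close>
    define s :: real where "s = (if form \<Phi> (h i0) u < 0 then 1 else - 1)"
    have "form \<Phi> (h i) (s *\<^sub>R u) < 0" if "(i, j) \<notin> R" for i
      using side[OF that i0] nz unfolding form_scale s_def by (auto simp: zero_less_mult_iff)
    moreover have "form \<Phi> (h i) (s *\<^sub>R u) = 0" if "(i, j) \<in> R" for i using u(3)[OF that] by (simp add: form_scale)
    moreover have "s *\<^sub>R u \<noteq> 0" using u(1) unfolding s_def by simp
    ultimately show ?thesis by (intro exI[of _ "s *\<^sub>R u"]) auto
  qed
  then obtain v where v: "\<And>j. v j \<noteq> 0"
    "\<And>i j. if (i, j) \<in> R then form \<Phi> (h i) (v j) = 0 else form \<Phi> (h i) (v j) < 0" by metis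
  interpret sp: sign_pattern R "\<lambda>i. \<Phi> *v h i" v
  proof
    fix i j
    show "(\<Phi> *v h i) \<bullet> v j \<le> 0" "(\<Phi> *v h i) \<bullet> v j = 0 \<longleftrightarrow> (i, j) \<in> R"
      unfolding form_eq[symmetric] using v(2)[of i j] by (auto split: if_splits)
  qed
  have dp: "dual_pair R (\<lambda>i. \<Phi> *v h i) v"
  proof (rule sp.dual_pairI[OF rf _ dr v(1)])
    show "?r (face_top R) = DIM(real^'n)" using top card by simp
    fix x assume x: "\<And>i. (\<Phi> *v h i) \<bullet> x = 0"
    show "x = 0"
    proof (rule nd)
      fix y
      have "range h \<subseteq> {y. form \<Phi> x y = 0}" using x form_sym[of x] unfolding form_eq by auto
      hence "span (range h) \<subseteq> {y. form \<Phi> x y = 0}" unfolding form_eq by (intro span_minimal subspace_hyperplane)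
      thus "form \<Phi> x y = 0" using h(2) by blast
    qed
  qed
  interpret dp: dual_pair R "\<lambda>i. \<Phi> *v h i" v by (rule dp)
  let ?C = "sp.V (face_top R)" and ?f = "\<lambda>i. sp.V (facet R i)" and ?s = "\<lambda>j. sp.V (vertex R j)"
  have tc: "type_cone R (?C, ?f, ?s)" by (rule type_coneI[OF dp ind])
  hence pc: "polyhedral_cone ?C ?f" unfolding type_cone_def polyhedral_cone_def by simp
  have h0: "h i \<noteq> 0" for i using unit[of i] by (auto simp: form_def)
  have n: "facet_normals ?C ?f (\<lambda>i. \<Phi> *v h i)"
    unfolding facet_normals_def
  proof (intro allI conjI)
    fix i
    show "\<Phi> *v h i \<noteq> 0" using mult_eq_0 h0 by blast
    show "?C \<subseteq> {x. (\<Phi> *v h i) \<bullet> x \<le> 0}" using sp.inner_V by blast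
    show "?f i = ?C \<inter> {x. (\<Phi> *v h i) \<bullet> x = 0}" by (rule dp.V_facet)
  qed
  note out = facet_normals_outward[OF pc n unit]
  have "\<not> lightlike_hyperplane \<Phi> (span (?f i))" for i
  proof
    assume "lightlike_hyperplane \<Phi> (span (?f i))"
    then obtain x where x: "x \<noteq> 0" "form \<Phi> x x = 0" "{y. form \<Phi> (h i) y = 0} = {y. form \<Phi> x y = 0}"
      unfolding lightlike_hyperplane_def out(2) by blast
    obtain c where "x = c *\<^sub>R h i"
      using proportional_form_normals[of "h i" x] x(3) h0 by blast
    hence "c = 0" using x(2) unit[of i] by (auto simp: form_scale)
    thus False using \<open>x = c *\<^sub>R h i\<close> x(1) by simp
  qed
  hence "(?C, ?f, ?s) \<in> realizations \<Phi> R" unfolding realizations_def using tc by simp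
  moreover have "gramian \<Phi> (?C, ?f, ?s) = G"
    using gramian_eq[of ?C ?f h ?s, OF out(1)] G by (simp add: Finite_Cartesian_Product.vec_eq_iff)
  ultimately show ?thesis by blast
qed

end

theorem theorem7:
  fixes R :: "('i::finite \<times> 'j::finite) set" and \<Phi> :: "real^'n^'n" and G :: "real^'i^'i" and d :: nat
  assumes "CARD('n) = d + 1"
    and "Finite_Cartesian_Product.transpose \<Phi> = \<Phi>"
    and "\<forall>x. (\<forall>y. form \<Phi> x y = 0) \<longrightarrow> x = 0"
  shows
    "((\<exists>X. X \<in> nonlightlike_realizations \<Phi> R \<and> gramian \<Phi> X = G) \<longleftrightarrow>
        combinatorial_condition R d \<and> signature_condition \<Phi> G \<and>
        (\<forall>j. vertex_condition R d G j) \<and> orientation_condition \<Phi> R d G) \<and>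
     (\<forall>(C, f, r) \<in> realizations \<Phi> R.
        combinatorial_condition R d \<and> signature_condition \<Phi> (gramian \<Phi> (C, f, r)) \<and>
        (\<forall>j. vertex_condition R d (gramian \<Phi> (C, f, r)) j \<longleftrightarrow> \<not> lightlike_ray \<Phi> (r j)) \<and>
        orientation_condition \<Phi> R d (gramian \<Phi> (C, f, r))) \<and>
     (\<forall>X \<in> realizations \<Phi> R. \<forall>Y \<in> realizations \<Phi> R.
        gramian \<Phi> X = gramian \<Phi> Y \<longleftrightarrow> (X, Y) \<in> orthogonally_equivalent \<Phi>) \<and>
     bij_betw (\<lambda>K. the_elem (gramian \<Phi> ` K))
       (nonlightlike_realizations \<Phi> R // orthogonally_equivalent \<Phi>)
       {G'. combinatorial_condition R d \<and> signature_condition \<Phi> G' \<and>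
         (\<forall>j. vertex_condition R d G' j) \<and> orientation_condition \<Phi> R d G'}"
proof -
  interpret nondegenerate_form \<Phi> by unfold_locales (use assms(2,3) in blast)+
  let ?N = "nonlightlike_realizations \<Phi> R"
  let ?E = "orthogonally_equivalent \<Phi> :: (('n, 'i, 'j) labelled_cone \<times> ('n, 'i, 'j) labelled_cone) set"
  let ?cond = "\<lambda>G. combinatorial_condition R d \<and> signature_condition \<Phi> G \<and>
         (\<forall>j. vertex_condition R d G j) \<and> orientation_condition \<Phi> R d G"
  note conds = realization_conditions[OF assms(1)]
  have NR: "?N \<subseteq> realizations \<Phi> R" unfolding nonlightlike_realizations_def by blast
  have N: "(C, f, r) \<in> ?N \<longleftrightarrow> (C, f, r) \<in> realizations \<Phi> R \<and> (\<forall>j. \<not> lightlike_ray \<Phi> (r j))" for C f r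
    unfolding nonlightlike_realizations_def by simp
  have 1: "(\<exists>X. X \<in> ?N \<and> gramian \<Phi> X = G) \<longleftrightarrow> ?cond G" for G
  proof
    assume "\<exists>X. X \<in> ?N \<and> gramian \<Phi> X = G"
    then obtain C f r where "(C, f, r) \<in> ?N" "gramian \<Phi> (C, f, r) = G" by (metis prod_cases3)
    thus "?cond G" using conds N by metis
  next
    assume c: "?cond G"
    then obtain C f r where X: "(C, f, r) \<in> realizations \<Phi> R" "gramian \<Phi> (C, f, r) = G"
      using realization_exists[OF assms(1), of R G] by (metis prod_cases3)
    \<comment> \<open>For a realization the vertex condition is equivalent to its rays being off the
      null cone.\<close>
    hence "\<forall>j. \<not> lightlike_ray \<Phi> (r j)" using conds(3)[OF X(1)] c by blast
    thus "\<exists>X. X \<in> ?N \<and> gramian \<Phi> X = G" using X N by blast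
  qed
  have 3: "gramian \<Phi> X = gramian \<Phi> Y \<longleftrightarrow> (X, Y) \<in> ?E"
    if "X \<in> realizations \<Phi> R" "Y \<in> realizations \<Phi> R" for X Y
    using gramian_eq_imp_equivalent[OF that] gramian_orthogonal[OF that(1), of Y] by auto
  \<comment> \<open>The classes are formed among all labelled cones. The Gramian is constant on the
    class of a realization by invariance under \<open>Q\<close>, which makes \<open>the_elem\<close>
    meaningful.\<close>
  have cls: "the_elem (gramian \<Phi> ` (?E `` {X})) = gramian \<Phi> X" if X: "X \<in> ?N" for X
  proof -
    have "(X, X) \<in> ?E" using 3[of X X] X NR by blast
    hence "gramian \<Phi> X \<in> gramian \<Phi> ` (?E `` {X})" by (intro imageI) (simp only: Image_singleton_iff)
    moreover have "gramian \<Phi> ` (?E `` {X}) \<subseteq> {gramian \<Phi> X}"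
    proof
      fix g assume "g \<in> gramian \<Phi> ` (?E `` {X})"
      then obtain Y where "Y \<in> ?E `` {X}" "g = gramian \<Phi> Y" by (rule imageE)
      moreover from this have "(X, Y) \<in> ?E" by (simp only: Image_singleton_iff)
      ultimately show "g \<in> {gramian \<Phi> X}" using gramian_orthogonal[of X R Y] X NR by blast
    qed
    ultimately have "gramian \<Phi> ` (?E `` {X}) = {gramian \<Phi> X}" by blast
    thus ?thesis by simp
  qed
  have "bij_betw (\<lambda>K. the_elem (gramian \<Phi> ` K)) (?N // ?E) {G'. ?cond G'}"
    unfolding bij_betw_def
  proof
    show "inj_on (\<lambda>K. the_elem (gramian \<Phi> ` K)) (?N // ?E)"
    proof (rule inj_onI)
      fix K L assume KL: "K \<in> ?N // ?E" "L \<in> ?N // ?E" and e: "the_elem (gramian \<Phi> ` K) = the_elem (gramian \<Phi> ` L)"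
      obtain X where X: "X \<in> ?N" "K = ?E `` {X}" using KL(1) by (rule quotientE)
      obtain Y where Y: "Y \<in> ?N" "L = ?E `` {Y}" using KL(2) by (rule quotientE)
      have "gramian \<Phi> X = gramian \<Phi> Y" using e cls X Y by simp
      hence "(X, Y) \<in> ?E" using 3 X(1) Y(1) NR by blast
      thus "K = L" unfolding X(2) Y(2) by (rule equiv_class_eq[OF equiv_orthogonally_equivalent])
    qed
    have "?N // ?E = (\<lambda>X. ?E `` {X}) ` ?N" unfolding quotient_def by blast
    hence "(\<lambda>K. the_elem (gramian \<Phi> ` K)) ` (?N // ?E) = gramian \<Phi> ` ?N"
      using cls by (simp add: image_image)
    also have "\<dots> = {G'. ?cond G'}" unfolding 1[symmetric] by blast
    finally show "(\<lambda>K. the_elem (gramian \<Phi> ` K)) ` (?N // ?E) = {G'. ?cond G'}" .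
  qed
  moreover have "\<forall>(C, f, r) \<in> realizations \<Phi> R.
        combinatorial_condition R d \<and> signature_condition \<Phi> (gramian \<Phi> (C, f, r)) \<and>
        (\<forall>j. vertex_condition R d (gramian \<Phi> (C, f, r)) j \<longleftrightarrow> \<not> lightlike_ray \<Phi> (r j)) \<and>
        orientation_condition \<Phi> R d (gramian \<Phi> (C, f, r))"
    using conds by blast
  ultimately show ?thesis using 1 3 by blast
qed

end
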